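(* Let $F\in\mathbb{R}^{cn\times cn}$, $H\in\mathbb{R}^{dn\times cn}$, $V\in\mathbb{R}^{cn\times cn}$, $R\in\mathbb{R}^{dn\times dn}$ be block diagonal with $n$ diagonal blocks $F^{(i)}\in\mathbb{R}^{c\times c}$, $H^{(i)}\in\mathbb{R}^{d\times c}$, $V^{(i)}\in\mathbb{R}^{c\times c}$, $R^{(i)}\in\mathbb{R}^{d\times d}$, where $V$ and $R$ are symmetric positive definite and $[F,H]$ is detectable. Let $G\in\mathbb{R}^{cn\times r}$ be the vertical stacking of $G^{(i)}\in\mathbb{R}^{c\times r}$, $i=1,\dots,n$, and let $U\in\mathbb{R}^{r\times r}$ be symmetric positive definite. With $P_{\pm}(Q)$, $\tilde P_{\pm}(Q)$, $F_c(Q)$, $\tilde F_c(Q)$ and $C$ as defined in the context, put $$\epsilon^{(i)}=\left\Vert G^{(i)}CG^{(i)T}\right\Vert_F,\qquad \eta=\left\Vert GUG^{T}\right\Vert_F .$$ (1) For small enough $\epsilon^{(i)}$, the difference $\Delta\tilde P_{+}^{(i)}$ between the $i$-th diagonal blocks of $P_{+}(V)$ and $\tilde P_{+}(V+GUG^T)$ satisfies $\Vert\Delta\tilde P_{+}^{(i)}\Vert_F=O(\epsilon^{(i)})$. That is, for each $i$ there are constants $\delta^{(i)},M^{(i)}>0$, depending only on $F^{(i)},H^{(i)},V^{(i)},R^{(i)}$, such that $\epsilon^{(i)}\le\delta^{(i)}$ implies $\Vert\Delta\tilde P_{+}^{(i)}\Vert_F\le M^{(i)}\epsilon^{(i)}$.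 (2) Let $\Delta P_{-}$ stand for either $P_{-}(V+GUG^T)-P_{-}(V)$ or $\tilde P_{-}(V+GUG^T)-P_{-}(V)$, and correspondingly let $\Delta F_c$ stand for $F_c(V+GUG^T)-F_c(V)$ or $\tilde F_c(V+GUG^T)-F_c(V)$. For small enough $\eta$, $$\Vert\Delta P_{-}\Vert_F=O(\eta),\qquad \Vert\Delta F_c\Vert_F=O(\eta).$$ That is, there are constants $\delta,M>0$, depending only on $F,H,V,R$, such that $\eta\le\delta$ implies $\Vert\Delta P_{-}\Vert_F\le M\eta$ and $\Vert\Delta F_c\Vert_F\le M\eta$, in both cases.
   Context: $\Vert\cdot\Vert_F$ is the Frobenius norm. $\mathcal{D}$ is the linear projection on $cn\times cn$ matrices that keeps the $n$ diagonal $c\times c$ blocks and sets all off-diagonal blocks to zero. The pair $[F,H]$ is detectable if there is $L$ such that all eigenvalues of $F-LH$ lie strictly inside the unit circle. For symmetric positive-definite $Q\in\mathbb{R}^{cn\times cn}$: - $P_{-}(Q)$ is the unique positive-definite solution of the Riccati equation $P_{-}=F\left(P_{-}-P_{-}H^T(HP_{-}H^T+R)^{-1}HP_{-}\right)F^T+Q$ (steady-state predicted covariance of the full Kalman filter), and $P_{+}(Q)=P_{-}-P_{-}H^T(HP_{-}H^T+R)^{-1}HP_{-}$ with $P_-=P_-(Q)$ is the corresponding updated covariance. - $\tilde P_{-}(Q)$ is the unique positive-definite solution of $\tilde P_{-}=F\,\mathcal{D}\left\{\tilde P_{-}-\tilde P_{-}H^T(H\tilde P_{-}H^T+R)^{-1}H\tilde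 P_{-}\right\}F^T+Q$ (steady-state covariance approximation of the block-diagonal filter), and $\tilde P_{+}(Q)=\mathcal{D}\left\{\tilde P_{-}-\tilde P_{-}H^T(H\tilde P_{-}H^T+R)^{-1}H\tilde P_{-}\right\}$ with $\tilde P_-=\tilde P_-(Q)$. - $F_c(Q)=(I-K(Q)H)F$ with $K(Q)=P_{-}H^T(HP_{-}H^T+R)^{-1}$, $P_-=P_-(Q)$, is the (stable) closed-loop transition matrix of the full Kalman filter; $\tilde F_c(Q)=(I-\tilde K(Q)H)F$ with $\tilde K(Q)=\tilde P_{-}H^T(H\tilde P_{-}H^T+R)^{-1}$, $\tilde P_-=\tilde P_-(Q)$, is that of the block-diagonal filter. Since $F,H,V,R$ are block diagonal, $P_{\pm}(V)=\tilde P_{\pm}(V)$ are block diagonal. The matrix $C\in\mathbb{R}^{r\times r}$ is $$C=\left(U^{-1}+G^TH^T\left(H(F\grave P_{+}F^T+V)H^T+R\right)^{-1}HG\right)^{-1},\qquad \grave P_{+}=P_{+}\left(\mathcal{D}\{V+GUG^T\}\right).$$ *)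

theory Defs
  imports
    "Jordan_Normal_Form.Char_Poly"
    "Jordan_Normal_Form.Gauss_Jordan_Elimination"
begin

definition frob_norm :: "real mat \<Rightarrow> real" where
  "frob_norm A = sqrt (\<Sum>i<dim_row A. \<Sum>j<dim_col A. (A $$ (i, j))\<^sup>2)"

definition sym_pos_def :: "real mat \<Rightarrow> bool" where
  "sym_pos_def A \<longleftrightarrow> square_mat A \<and> transpose_mat A = A \<and>
     (\<forall>x \<in> carrier_vec (dim_row A). x \<noteq> 0\<^sub>v (dim_row A) \<longrightarrow> x \<bullet> (A *\<^sub>v x) > 0)"

text \<open>Only meaningful for invertible arguments; below it is applied to positive definite
  matrices.\<close>

definition minv :: "real mat \<Rightarrow> real mat" where
  "minv A = the (mat_inverse A)"

definition detectable :: "real mat \<Rightarrow> real mat \<Rightarrow> bool" where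
  "detectable F H \<longleftrightarrow> (\<exists>L \<in> carrier_mat (dim_row F) (dim_row H).
     \<forall>z. eigenvalue (map_mat complex_of_real (F - L * H)) z \<longrightarrow> cmod z < 1)"

text \<open>The projection \<open>\<D>\<close>, where the blocks have size \<open>c \<times> c\<close>. Indices are 0-based, so
  row \<open>k\<close> lies in block \<open>k div c\<close>.\<close>

definition block_proj :: "nat \<Rightarrow> real mat \<Rightarrow> real mat" where
  "block_proj c A = mat (dim_row A) (dim_col A)
     (\<lambda>(k, l). if k div c = l div c then A $$ (k, l) else 0)"

definition nth_diag_block :: "nat \<Rightarrow> nat \<Rightarrow> real mat \<Rightarrow> real mat" where
  "nth_diag_block c i A = mat c c (\<lambda>(k, l). A $$ (i * c + k, i * c + l))"

text \<open>The explicit column count \<open>r\<close> only serves as the base case of the recursion.\<close>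

definition vstack :: "nat \<Rightarrow> real mat list \<Rightarrow> real mat" where
  "vstack r Gs = foldr (@\<^sub>r) Gs (0\<^sub>m 0 r)"

definition gain :: "real mat \<Rightarrow> real mat \<Rightarrow> real mat \<Rightarrow> real mat" where
  "gain H R P = P * transpose_mat H * minv (H * P * transpose_mat H + R)"

definition meas_update :: "real mat \<Rightarrow> real mat \<Rightarrow> real mat \<Rightarrow> real mat" where
  "meas_update H R P = P - P * transpose_mat H * minv (H * P * transpose_mat H + R) * H * P"

definition closed_loop :: "real mat \<Rightarrow> real mat \<Rightarrow> real mat \<Rightarrow> real mat \<Rightarrow> real mat" where
  "closed_loop F H R P = (1\<^sub>m (dim_row F) - gain H R P * H) * F"

text \<open>Full Kalman filter: \<open>P\<^sub>-(Q)\<close>, \<open>P\<^sub>+(Q)\<close>, \<open>F\<^sub>c(Q)\<close>.\<close>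

definition kf_pred :: "real mat \<Rightarrow> real mat \<Rightarrow> real mat \<Rightarrow> real mat \<Rightarrow> real mat" where
  "kf_pred F H R Q = (THE P. P \<in> carrier_mat (dim_row F) (dim_row F) \<and> sym_pos_def P \<and>
     P = F * meas_update H R P * transpose_mat F + Q)"

definition kf_upd :: "real mat \<Rightarrow> real mat \<Rightarrow> real mat \<Rightarrow> real mat \<Rightarrow> real mat" where
  "kf_upd F H R Q = meas_update H R (kf_pred F H R Q)"

definition kf_cl :: "real mat \<Rightarrow> real mat \<Rightarrow> real mat \<Rightarrow> real mat \<Rightarrow> real mat" where
  "kf_cl F H R Q = closed_loop F H R (kf_pred F H R Q)"

text \<open>Block-diagonal filter with blocks of size \<open>c\<close>: the same quantities with a tilde.\<close>

definition bd_pred :: "nat \<Rightarrow> real mat \<Rightarrow> real mat \<Rightarrow> real mat \<Rightarrow> real mat \<Rightarrow> real mat" where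
  "bd_pred c F H R Q = (THE P. P \<in> carrier_mat (dim_row F) (dim_row F) \<and> sym_pos_def P \<and>
     P = F * block_proj c (meas_update H R P) * transpose_mat F + Q)"

definition bd_upd :: "nat \<Rightarrow> real mat \<Rightarrow> real mat \<Rightarrow> real mat \<Rightarrow> real mat \<Rightarrow> real mat" where
  "bd_upd c F H R Q = block_proj c (meas_update H R (bd_pred c F H R Q))"

definition bd_cl :: "nat \<Rightarrow> real mat \<Rightarrow> real mat \<Rightarrow> real mat \<Rightarrow> real mat \<Rightarrow> real mat" where
  "bd_cl c F H R Q = closed_loop F H R (bd_pred c F H R Q)"

definition C_mat :: "nat \<Rightarrow> real mat \<Rightarrow> real mat \<Rightarrow> real mat \<Rightarrow> real mat \<Rightarrow> real mat \<Rightarrow> real mat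
    \<Rightarrow> real mat" where
  "C_mat c F H V R G U =
     (let Pgrave = kf_upd F H R (block_proj c (V + G * U * transpose_mat G))
      in minv (minv U + transpose_mat G * transpose_mat H *
           minv (H * (F * Pgrave * transpose_mat F + V) * transpose_mat H + R) * H * G))"

definition block_system ::
  "nat \<Rightarrow> nat \<Rightarrow> nat \<Rightarrow> real mat list \<Rightarrow> real mat list \<Rightarrow> real mat list \<Rightarrow> real mat list \<Rightarrow> bool" where
  "block_system c d n Fs Hs Vs Rs \<longleftrightarrow>
     0 < c \<and> 0 < d \<and> 0 < n \<and>
     length Fs = n \<and> length Hs = n \<and> length Vs = n \<and> length Rs = n \<and>
     set Fs \<subseteq> carrier_mat c c \<and> set Hs \<subseteq> carrier_mat d c \<and>
     set Vs \<subseteq> carrier_mat c c \<and> set Rs \<subseteq> carrier_mat d d \<and>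
     sym_pos_def (diag_block_mat Vs) \<and> sym_pos_def (diag_block_mat Rs) \<and>
     detectable (diag_block_mat Fs) (diag_block_mat Hs)"

definition common_noise :: "nat \<Rightarrow> nat \<Rightarrow> nat \<Rightarrow> real mat list \<Rightarrow> real mat \<Rightarrow> bool" where
  "common_noise c n r Gs U \<longleftrightarrow>
     0 < r \<and> length Gs = n \<and> set Gs \<subseteq> carrier_mat c r \<and> U \<in> carrier_mat r r \<and> sym_pos_def U"

end

theory Submission
  imports Defs "Jordan_Normal_Form.Spectral_Radius" "HOL-Analysis.L2_Norm"
begin

text \<open>
  Both filters solve an equation \<open>P = F D(\<Phi>(P)) F\<^sup>T + Q\<close>, where \<open>\<Phi>\<close> is the measurement update
  and \<open>D\<close> is either the identity or the projection to the diagonal blocks. Apart from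
  the existence of solutions, the proof uses only the order structure of this equation. The updated
  variance of a linear combination \<open>x\<close> is a
  minimum over measurement weights \<open>k\<close> of \<open>qform P (x - H\<^sup>T k) + qform R k\<close>
  (\<open>meas_update_complete_square\<close>). Hence \<open>\<Phi>\<close> is monotone, satisfies \<open>\<Phi>(t P) \<le> t \<Phi>(P)\<close> for
  \<open>t \<ge> 1\<close>, and obeys the pinching inequality \<open>D(\<Phi>(P)) \<le> \<Phi>(D(P))\<close>.

  The noise \<open>Q\<close> is positive definite and so dominates a multiple of any solution. Therefore the
  equation contracts ratios of covariances: a subsolution up to the factor \<open>1 + s\<close> exceeds a
  supersolution at most by a factor \<open>1 + O(s)\<close> (\<open>riccati_comparison\<close>). This gives uniqueness and,
  as \<open>V + G U G\<^sup>T\<close> lies between \<open>V\<close> and \<open>(1 + O(\<eta>)) V\<close>, the bound for the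
  predicted covariances of both filters; the closed-loop matrix is a Lipschitz function of them
  (\<open>bd_pred_perturbation\<close>). Existence follows by monotone iteration below a supersolution, which
  detectability provides for the full filter (\<open>full_solution_exists\<close>) and, through a block-diagonal
  solution of the full equation, also for the block-diagonal filter (\<open>solution_exists\<close>).

  For a single diagonal block, let \<open>X\<close> be the updated covariance of the block-diagonal filter and let
  \<open>B = F X F\<^sup>T + V\<close> be its prediction without the common noise. The update of \<open>B + G U G\<^sup>T\<close>
  exceeds that of \<open>B\<close> at most by the posterior covariance of the common noise, propagated through
  the corrected \<open>G\<close>. The matrix \<open>C\<close> bounds that posterior covariance, since \<open>C\<close> is
  computed from a larger prediction (\<open>X_le_grave\<close>, \<open>update_upper\<close>). In block \<open>i\<close> the excess is therefore
  controlled by \<open>G\<^sub>i C G\<^sub>i\<^sup>T\<close>, which is at most a multiple of \<open>\<epsilon>\<^sub>i V\<^sub>i\<close>. So the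
  block \<open>X\<^sub>i\<close> reproduces itself through prediction and update of block \<open>i\<close> up to a factor
  \<open>1 + O(\<epsilon>\<^sub>i)\<close> (\<open>block_sandwich\<close>), and the comparison principle, applied to block \<open>i\<close>
  alone, gives a bound whose constants depend on the data of that block only (\<open>update_sandwich\<close>).
\<close>

section \<open>Quadratic forms of symmetric matrices\<close>

lemma sum_cauchy_schwarz:
  fixes f g :: "'a \<Rightarrow> real"
  shows "(\<Sum>i\<in>A. f i * g i)\<^sup>2 \<le> (\<Sum>i\<in>A. (f i)\<^sup>2) * (\<Sum>i\<in>A. (g i)\<^sup>2)"
proof -
  have "\<bar>\<Sum>i\<in>A. f i * g i\<bar> \<le> (\<Sum>i\<in>A. \<bar>f i\<bar> * \<bar>g i\<bar>)"
    by (rule order_trans[OF sum_abs]) (simp add: abs_mult)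
  also have "\<dots> \<le> L2_set f A * L2_set g A" by (rule L2_set_mult_ineq)
  finally have "\<bar>\<Sum>i\<in>A. f i * g i\<bar>\<^sup>2 \<le> (L2_set f A * L2_set g A)\<^sup>2"
    by (intro power_mono) auto
  thus ?thesis by (simp add: L2_set_def power_mult_distrib sum_nonneg)
qed

definition qform :: "real mat \<Rightarrow> real vec \<Rightarrow> real" where
  "qform A x = x \<bullet> (A *\<^sub>v x)"

definition sym_psd :: "nat \<Rightarrow> real mat \<Rightarrow> bool" where
  "sym_psd m A \<longleftrightarrow> A \<in> carrier_mat m m \<and> transpose_mat A = A \<and>
     (\<forall>x \<in> carrier_vec m. 0 \<le> qform A x)"

text \<open>Positive definiteness with the dimension as a parameter, so that the carrier conditions of the
  matrix operations can be read off.\<close>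

definition spd :: "nat \<Rightarrow> real mat \<Rightarrow> bool" where
  "spd m A \<longleftrightarrow> A \<in> carrier_mat m m \<and> sym_pos_def A"

definition loewner_le :: "nat \<Rightarrow> real mat \<Rightarrow> real mat \<Rightarrow> bool" where
  "loewner_le m A B \<longleftrightarrow> (\<forall>x \<in> carrier_vec m. qform A x \<le> qform B x)"

definition tr :: "real mat \<Rightarrow> real" where
  "tr A = (\<Sum>i<dim_row A. A $$ (i,i))"

lemma sym_psdD:
  assumes "sym_psd m A"
  shows "A \<in> carrier_mat m m" "transpose_mat A = A" "x \<in> carrier_vec m \<Longrightarrow> 0 \<le> qform A x"
  using assms by (auto simp: sym_psd_def)

lemma spdD:
  assumes "spd m A"
  shows "A \<in> carrier_mat m m" "transpose_mat A = A"
    "x \<in> carrier_vec m \<Longrightarrow> x \<noteq> 0\<^sub>v m \<Longrightarrow> 0 < qform A x" "sym_pos_def A"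
  using assms by (auto simp: spd_def sym_pos_def_def qform_def)

lemma qform_zero_vec: "A \<in> carrier_mat m m \<Longrightarrow> qform A (0\<^sub>v m) = 0"
  by (simp add: qform_def)

lemma spd_imp_psd: "spd m A \<Longrightarrow> sym_psd m A"
  unfolding sym_psd_def
  by (metis less_eq_real_def order_refl qform_zero_vec spdD(1) spdD(2) spdD(3))

lemma spdI:
  assumes "A \<in> carrier_mat m m" "transpose_mat A = A"
    "\<And>x. x \<in> carrier_vec m \<Longrightarrow> x \<noteq> 0\<^sub>v m \<Longrightarrow> 0 < qform A x"
  shows "spd m A"
  using assms by (auto simp: spd_def sym_pos_def_def qform_def)

lemma qform_add: "A \<in> carrier_mat m m \<Longrightarrow> B \<in> carrier_mat m m \<Longrightarrow> x \<in> carrier_vec m \<Longrightarrow>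
   qform (A + B) x = qform A x + qform B x"
  unfolding qform_def
  by (metis add_mult_distrib_mat_vec mult_mat_vec_carrier scalar_prod_add_distrib)

lemma qform_minus: "A \<in> carrier_mat m m \<Longrightarrow> B \<in> carrier_mat m m \<Longrightarrow> x \<in> carrier_vec m \<Longrightarrow>
   qform (A - B) x = qform A x - qform B x"
  unfolding qform_def
  by (metis minus_mult_distrib_mat_vec mult_mat_vec_carrier scalar_prod_minus_distrib)

lemma qform_congruence:
  assumes "B \<in> carrier_mat m p" "A \<in> carrier_mat p p" "x \<in> carrier_vec m"
  shows "qform (B * A * transpose_mat B) x = qform A (transpose_mat B *\<^sub>v x)"
proof -
  have "(B * A * transpose_mat B) *\<^sub>v x = B *\<^sub>v (A *\<^sub>v (transpose_mat B *\<^sub>v x))"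
    using assms by (simp add: assoc_mult_mat_vec[of _ m p _ m] assoc_mult_mat_vec[of _ m p _ p])
  thus ?thesis unfolding qform_def
    using transpose_vec_mult_scalar[of B m p "A *\<^sub>v (transpose_mat B *\<^sub>v x)" x] assms
    by (metis mult_mat_vec_carrier transpose_carrier_mat)
qed

lemma symmetric_congruence:
  fixes A B :: "real mat"
  assumes "B \<in> carrier_mat m p" "A \<in> carrier_mat p p" "transpose_mat A = A"
  shows "transpose_mat (B * A * transpose_mat B) = B * A * transpose_mat B"
  using assms transpose_mult[of "B * A" m p "transpose_mat B" m] transpose_mult[of B m p A p]
    assoc_mult_mat[of B m p A p "transpose_mat B" m]
  by auto

lemma symmetric_scalar_prod:
  fixes A :: "real mat"
  assumes "A \<in> carrier_mat m m" "transpose_mat A = A" "x \<in> carrier_vec m" "y \<in> carrier_vec m"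
  shows "x \<bullet> (A *\<^sub>v y) = y \<bullet> (A *\<^sub>v x)"
  using assms transpose_vec_mult_scalar[of A m m y x]
  by (metis comm_scalar_prod mult_mat_vec_carrier)

lemma qform_add_vec:
  assumes "A \<in> carrier_mat m m" "transpose_mat A = A" "x \<in> carrier_vec m" "y \<in> carrier_vec m"
  shows "qform A (x + y) = qform A x + 2 * (x \<bullet> (A *\<^sub>v y)) + qform A y"
  using assms symmetric_scalar_prod[OF assms]
  by (simp add: qform_def mult_add_distrib_mat_vec[of _ m m] add_scalar_prod_distrib[of _ m]
      scalar_prod_add_distrib[of _ m])

lemma qform_minus_vec:
  assumes "A \<in> carrier_mat m m" "transpose_mat A = A" "x \<in> carrier_vec m" "y \<in> carrier_vec m"
  shows "qform A (x - y) = qform A x - 2 * (x \<bullet> (A *\<^sub>v y)) + qform A y"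
  using assms symmetric_scalar_prod[OF assms]
  by (simp add: qform_def mult_minus_distrib_mat_vec[of _ m m] minus_scalar_prod_distrib[of _ m]
      scalar_prod_minus_distrib[of _ m])

lemma qform_sum:
  assumes "A \<in> carrier_mat m m" "x \<in> carrier_vec m"
  shows "qform A x = (\<Sum>i<m. \<Sum>j<m. A $$ (i,j) * (x $ i * x $ j))"
  using assms unfolding qform_def scalar_prod_def
  by (auto simp: scalar_prod_def atLeast0LessThan sum_distrib_left algebra_simps intro!: sum.cong)

lemma unit_vec_scalar_entry:
  fixes A :: "real mat"
  assumes "A \<in> carrier_mat m m" "i < m" "j < m"
  shows "unit_vec m i \<bullet> (A *\<^sub>v unit_vec m j) = A $$ (i,j)"
  using assms by simp

text \<open>Polarisation. Equalities of symmetric matrices are proved below by comparing quadratic forms,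
  and limits of matrices are obtained from limits of quadratic forms; both rest on this formula.\<close>

lemma entry_polarisation:
  assumes "A \<in> carrier_mat m m" "transpose_mat A = A" "i < m" "j < m"
  shows "A $$ (i,j) = (qform A (unit_vec m i + unit_vec m j) - qform A (unit_vec m i)
     - qform A (unit_vec m j)) / 2"
  using assms qform_add_vec[OF assms(1,2), of "unit_vec m i" "unit_vec m j"]
  by (simp add: unit_vec_scalar_entry)

lemma qform_unit: "A \<in> carrier_mat m m \<Longrightarrow> i < m \<Longrightarrow> qform A (unit_vec m i) = A $$ (i,i)"
  by (simp add: qform_def unit_vec_scalar_entry)

lemma qform_determines:
  assumes "A \<in> carrier_mat m m" "transpose_mat A = A" "B \<in> carrier_mat m m" "transpose_mat B = B"
    "\<And>x. x \<in> carrier_vec m \<Longrightarrow> qform A x = qform B x"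
  shows "A = B"
  using assms by (intro eq_matI) (auto simp: entry_polarisation)

text \<open>Nonnegativity of the form at \<open>s x - t y\<close> for all \<open>s\<close>, \<open>t\<close>.\<close>

lemma qform_cauchy_schwarz:
  assumes A: "sym_psd m A" and x: "x \<in> carrier_vec m" and y: "y \<in> carrier_vec m"
  shows "(x \<bullet> (A *\<^sub>v y))\<^sup>2 \<le> qform A x * qform A y"
proof -
  note A' = sym_psdD[OF A]
  let ?b = "x \<bullet> (A *\<^sub>v y)"
  have *: "0 \<le> s\<^sup>2 * qform A x - 2 * s * t * ?b + t\<^sup>2 * qform A y" for s t
  proof -
    have "0 \<le> qform A (s \<cdot>\<^sub>v x - t \<cdot>\<^sub>v y)"
      using A' x y by auto
    also have "\<dots> = s\<^sup>2 * qform A x - 2 * s * t * ?b + t\<^sup>2 * qform A y"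
      using A' x y qform_minus_vec[OF A'(1,2), of "s \<cdot>\<^sub>v x" "t \<cdot>\<^sub>v y"]
      by (simp add: qform_def mult_mat_vec[of _ m m] power2_eq_square)
    finally show ?thesis .
  qed
  have x0: "0 \<le> qform A x" and y0: "0 \<le> qform A y" using A' x y by auto
  show ?thesis
  proof (cases "qform A y = 0")
    case True
    show ?thesis
    proof (cases "?b = 0")
      case False
      have "0 \<le> qform A x - 2 * ((qform A x + 1) / (2 * ?b)) * ?b"
        using *[of 1 "(qform A x + 1) / (2 * ?b)"] True by simp
      hence False using False by (simp add: field_simps)
      thus ?thesis ..
    qed (use True in simp)
  next
    case False
    with y0 have yp: "0 < qform A y" by simp
    have "0 \<le> (qform A y)\<^sup>2 * qform A x - 2 * qform A y * ?b * ?b + ?b\<^sup>2 * qform A y"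
      using *[of "qform A y" "?b"] by simp
    also have "\<dots> = qform A y * (qform A x * qform A y - ?b\<^sup>2)"
      by (simp add: power2_eq_square algebra_simps)
    finally show ?thesis using yp by (simp add: zero_le_mult_iff)
  qed
qed

section \<open>Inverses of positive definite matrices\<close>

lemma minv_spd_inverse:
  assumes "spd m A"
  shows "minv A \<in> carrier_mat m m" "A * minv A = 1\<^sub>m m" "minv A * A = 1\<^sub>m m"
proof -
  note A = spdD[OF assms]
  have "det A \<noteq> 0"
  proof
    assume "det A = 0"
    then obtain v where v: "v \<in> carrier_vec m" "v \<noteq> 0\<^sub>v m" "A *\<^sub>v v = 0\<^sub>v m"
      using det_0_iff_vec_prod_zero_field[OF A(1)] by blast
    hence "qform A v = 0" by (simp add: qform_def)
    thus False using A(3)[OF v(1,2)] by simp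
  qed
  hence "A \<in> Units (ring_mat TYPE(real) m ())"
    by (rule det_non_zero_imp_unit[OF A(1)])
  then obtain B where "mat_inverse A = Some B"
    using mat_inverse(1)[OF A(1), where b="()"] by (cases "mat_inverse A") auto
  with mat_inverse(2)[OF A(1) this]
  show "minv A \<in> carrier_mat m m" "A * minv A = 1\<^sub>m m" "minv A * A = 1\<^sub>m m"
    by (auto simp: minv_def)
qed

lemma minv_cancel_vec:
  assumes "spd m A" "x \<in> carrier_vec m"
  shows "A *\<^sub>v (minv A *\<^sub>v x) = x" "minv A *\<^sub>v (A *\<^sub>v x) = x" "minv A *\<^sub>v x \<in> carrier_vec m"
  using minv_spd_inverse[OF assms(1)] spdD(1)[OF assms(1)] assms(2)
  by (metis assoc_mult_mat_vec one_mult_mat_vec, metis assoc_mult_mat_vec one_mult_mat_vec, simp)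

lemma minv_symmetric:
  assumes "spd m A" shows "transpose_mat (minv A) = minv A"
proof -
  note A = spdD[OF assms] and I = minv_spd_inverse[OF assms]
  have "transpose_mat (minv A) * A = 1\<^sub>m m"
    using transpose_mult[of A m m "minv A" m] A I by simp
  hence "minv A = transpose_mat (minv A) * A * minv A" using I by simp
  also have "\<dots> = transpose_mat (minv A) * (A * minv A)"
    by (rule assoc_mult_mat[of _ m m _ m _ m]) (use A I in auto)
  also have "\<dots> = transpose_mat (minv A)"
    unfolding I(2) by (rule right_mult_one_mat[of _ m]) (use I in simp)
  finally show ?thesis by simp
qed

lemma qform_minv:
  assumes "spd m A" "x \<in> carrier_vec m"
  shows "qform (minv A) x = qform A (minv A *\<^sub>v x)"
  using minv_cancel_vec[OF assms] assms(2)
  by (simp add: qform_def comm_scalar_prod[of _ m])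

lemma minv_spd:
  assumes "spd m A" shows "spd m (minv A)"
proof (rule spdI)
  note A = spdD[OF assms] and I = minv_spd_inverse[OF assms]
  show "minv A \<in> carrier_mat m m" "transpose_mat (minv A) = minv A"
    using I minv_symmetric[OF assms] by auto
  fix x :: "real vec" assume x: "x \<in> carrier_vec m" "x \<noteq> 0\<^sub>v m"
  have "A *\<^sub>v 0\<^sub>v m = 0\<^sub>v m" using A(1) by auto
  hence "minv A *\<^sub>v x \<noteq> 0\<^sub>v m"
    using minv_cancel_vec(1)[OF assms x(1)] x(2) by metis
  thus "0 < qform (minv A) x"
    using qform_minv[OF assms x(1)] A(3) minv_cancel_vec[OF assms x(1)] by simp
qed

text \<open>The form of the inverse is the convex conjugate of the form, which is why inversion reverses the
  Loewner order.\<close>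

lemma qform_minv_fenchel:
  assumes A: "spd m A" and x: "x \<in> carrier_vec m" and z: "z \<in> carrier_vec m"
  shows "2 * (x \<bullet> z) - qform A z \<le> qform (minv A) x"
proof -
  let ?w = "minv A *\<^sub>v x"
  note A' = spdD[OF A] and w = minv_cancel_vec[OF A x]
  have "0 \<le> qform A (z - ?w)"
    using sym_psdD(3)[OF spd_imp_psd[OF A]] z w by simp
  also have "\<dots> = qform A z - 2 * (z \<bullet> x) + qform (minv A) x"
    using qform_minus_vec[OF A'(1,2) z w(3)] w qform_minv[OF A x] by simp
  finally show ?thesis using comm_scalar_prod[OF x z] by simp
qed

lemma minv_antimono:
  assumes A: "spd m A" and B: "spd m B" and le: "loewner_le m A B"
  shows "loewner_le m (minv B) (minv A)"
  unfolding loewner_le_def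
proof
  fix x :: "real vec" assume x: "x \<in> carrier_vec m"
  let ?w = "minv B *\<^sub>v x"
  have w: "?w \<in> carrier_vec m" using minv_cancel_vec[OF B x] by simp
  have "qform (minv B) x = 2 * (x \<bullet> ?w) - qform B ?w"
    using qform_minv[OF B x] by (simp add: qform_def)
  also have "\<dots> \<le> 2 * (x \<bullet> ?w) - qform A ?w"
    using le w by (simp add: loewner_le_def)
  also have "\<dots> \<le> qform (minv A) x" by (rule qform_minv_fenchel[OF A x w])
  finally show "qform (minv B) x \<le> qform (minv A) x" .
qed

section \<open>Frobenius norm, trace and the Loewner order\<close>

lemma frob_norm_nonneg: "0 \<le> frob_norm A"
  by (simp add: frob_norm_def sum_nonneg)

lemma frob_norm_sq: "A \<in> carrier_mat m p \<Longrightarrow> (frob_norm A)\<^sup>2 = (\<Sum>i<m. \<Sum>j<p. (A $$ (i,j))\<^sup>2)"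
  by (simp add: frob_norm_def sum_nonneg)

lemma vec_sq_sum: "(x :: real vec) \<in> carrier_vec m \<Longrightarrow> x \<bullet> x = (\<Sum>i<m. (x $ i)\<^sup>2)"
  unfolding scalar_prod_def by (auto simp: power2_eq_square intro!: sum.cong)

lemma vec_sq_nonneg: "0 \<le> (x :: real vec) \<bullet> x"
  by (simp add: scalar_prod_def sum_nonneg)

lemma qform_le_frob_norm:
  assumes A: "A \<in> carrier_mat m m" and x: "x \<in> carrier_vec m"
  shows "qform A x \<le> frob_norm A * (x \<bullet> x)"
proof -
  let ?S = "{..<m} \<times> {..<m}"
  have "(qform A x)\<^sup>2 = (\<Sum>(i,j)\<in>?S. A $$ (i,j) * (x $ i * x $ j))\<^sup>2"
    by (simp add: qform_sum[OF A x] sum.cartesian_product)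
  also have "\<dots> \<le> (\<Sum>(i,j)\<in>?S. (A $$ (i,j))\<^sup>2) * (\<Sum>(i,j)\<in>?S. (x $ i * x $ j)\<^sup>2)"
    using sum_cauchy_schwarz[of "\<lambda>p. A $$ (fst p, snd p)" "\<lambda>p. x $ fst p * x $ snd p" ?S]
    by (simp add: split_beta)
  also have "(\<Sum>(i,j)\<in>?S. (x $ i * x $ j)\<^sup>2) = (x \<bullet> x)\<^sup>2"
    by (simp add: vec_sq_sum[OF x] sum.cartesian_product[symmetric] power_mult_distrib
        sum_product power2_eq_square[of "sum _ _"])
  also have "(\<Sum>(i,j)\<in>?S. (A $$ (i,j))\<^sup>2) = (frob_norm A)\<^sup>2"
    by (simp add: frob_norm_sq[OF A] sum.cartesian_product)
  finally have "(qform A x)\<^sup>2 \<le> (frob_norm A * (x \<bullet> x))\<^sup>2" by (simp add: power_mult_distrib)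
  thus ?thesis
    using frob_norm_nonneg vec_sq_nonneg by (meson mult_nonneg_nonneg power2_le_imp_le)
qed

text \<open>For a positive semidefinite matrix \<open>A\<^sub>i\<^sub>j\<^sup>2 \<le> A\<^sub>i\<^sub>i A\<^sub>j\<^sub>j\<close>, by Cauchy--Schwarz for unit
  vectors. The trace is monotone in the Loewner order, so this turns order bounds into bounds of
  the Frobenius norm.\<close>

lemma frob_norm_le_tr:
  assumes "sym_psd m A"
  shows "frob_norm A \<le> tr A" "0 \<le> tr A"
proof -
  note A = sym_psdD[OF assms]
  have d: "0 \<le> A $$ (i,i)" if "i < m" for i
    using A(3)[of "unit_vec m i"] qform_unit[OF A(1) that] by simp
  have e: "(A $$ (i,j))\<^sup>2 \<le> A $$ (i,i) * A $$ (j,j)" if "i < m" "j < m" for i j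
    using qform_cauchy_schwarz[OF assms, of "unit_vec m i" "unit_vec m j"] that
    by (simp add: qform_unit[OF A(1)] unit_vec_scalar_entry[OF A(1)])
  have t: "tr A = (\<Sum>i<m. A $$ (i,i))" using A(1) by (auto simp: tr_def)
  show t0: "0 \<le> tr A" unfolding t using d by (intro sum_nonneg) auto
  have "(frob_norm A)\<^sup>2 \<le> (\<Sum>i<m. \<Sum>j<m. A $$ (i,i) * A $$ (j,j))"
    unfolding frob_norm_sq[OF A(1)] using e by (intro sum_mono) auto
  also have "\<dots> = (tr A)\<^sup>2" by (simp add: t power2_eq_square sum_product)
  finally show "frob_norm A \<le> tr A" using t0 power2_le_imp_le by blast
qed

lemma tr_mono:
  assumes "A \<in> carrier_mat m m" "B \<in> carrier_mat m m"
    "\<And>x. x \<in> carrier_vec m \<Longrightarrow> qform A x \<le> t * qform B x"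
  shows "tr A \<le> t * tr B"
proof -
  have "A $$ (i,i) \<le> t * B $$ (i,i)" if "i < m" for i
    using assms(3)[of "unit_vec m i"] assms(1,2) that by (simp add: qform_unit)
  thus ?thesis using assms(1,2) by (auto simp: tr_def sum_distrib_left intro!: sum_mono)
qed

lemma tr_minus: "A \<in> carrier_mat m m \<Longrightarrow> B \<in> carrier_mat m m \<Longrightarrow> tr (A - B) = tr A - tr B"
  by (auto simp: tr_def sum_subtractf)

lemma frob_norm_diff_le:
  assumes A: "A \<in> carrier_mat m m" "transpose_mat A = A"
    and B: "B \<in> carrier_mat m m" "transpose_mat B = B"
    and lo: "\<And>x. x \<in> carrier_vec m \<Longrightarrow> qform B x \<le> qform A x"
    and hi: "\<And>x. x \<in> carrier_vec m \<Longrightarrow> qform A x \<le> (1 + t) * qform B x"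
  shows "frob_norm (A - B) \<le> t * tr B"
proof -
  have "sym_psd m (A - B)"
    using A B lo by (auto simp: sym_psd_def qform_minus transpose_minus[of A m m])
  hence "frob_norm (A - B) \<le> tr (A - B)" by (rule frob_norm_le_tr)
  also have "\<dots> \<le> t * tr B"
    using A B hi by (intro tr_mono[of _ m]) (auto simp: qform_minus algebra_simps)
  finally show ?thesis .
qed

lemma frob_norm_minus_commute:
  "A \<in> carrier_mat m p \<Longrightarrow> B \<in> carrier_mat m p \<Longrightarrow> frob_norm (A - B) = frob_norm (B - A)"
  by (auto simp: frob_norm_def power2_commute)

text \<open>The difference is positive semidefinite and has trace zero, hence norm zero. Applied to \<open>A\<close>
  and its block-diagonal part, which always have the same trace, this shows that a matrix which
  dominates its own block-diagonal part, or is dominated by it, is block diagonal.\<close>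

lemma loewner_trace_rigid:
  assumes A: "A \<in> carrier_mat m m" "transpose_mat A = A"
    and B: "B \<in> carrier_mat m m" "transpose_mat B = B"
    and le: "loewner_le m B A" and t: "tr A = tr B"
  shows "A = B"
proof -
  have psd: "sym_psd m (A - B)"
    using A B le by (auto simp: sym_psd_def qform_minus transpose_minus[of A m m] loewner_le_def)
  hence "frob_norm (A - B) \<le> 0" using frob_norm_le_tr(1)[OF psd] tr_minus[OF A(1) B(1)] t by simp
  hence z: "frob_norm (A - B) = 0" using frob_norm_nonneg[of "A - B"] by simp
  have "A - B \<in> carrier_mat m m" using A B by auto
  from frob_norm_sq[OF this] z have *: "(\<Sum>i<m. \<Sum>j<m. ((A - B) $$ (i,j))\<^sup>2) = 0" by simp
  show ?thesis
  proof (rule eq_matI)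
    fix i j assume "i < dim_row B" "j < dim_col B"
    hence ij: "i < m" "j < m" using B by auto
    from * ij have "((A - B) $$ (i,j))\<^sup>2 = 0"
      by (simp add: sum_nonneg_eq_0_iff sum_nonneg)
    thus "A $$ (i,j) = B $$ (i,j)" using ij A B by simp
  qed (use A B in auto)
qed

lemma frob_norm_mult:
  assumes A: "A \<in> carrier_mat m p" and B: "B \<in> carrier_mat p q"
  shows "frob_norm (A * B) \<le> frob_norm A * frob_norm B"
proof -
  have AB: "A * B \<in> carrier_mat m q" using A B by auto
  have "(frob_norm (A * B))\<^sup>2 = (\<Sum>i<m. \<Sum>j<q. (\<Sum>k<p. A $$ (i,k) * B $$ (k,j))\<^sup>2)"
    unfolding frob_norm_sq[OF AB] using A B
    by (auto simp: scalar_prod_def atLeast0LessThan intro!: sum.cong)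
  also have "\<dots> \<le> (\<Sum>i<m. \<Sum>j<q. (\<Sum>k<p. (A $$ (i,k))\<^sup>2) * (\<Sum>k<p. (B $$ (k,j))\<^sup>2))"
    by (intro sum_mono sum_cauchy_schwarz)
  also have "\<dots> = (\<Sum>i<m. \<Sum>k<p. (A $$ (i,k))\<^sup>2) * (\<Sum>j<q. \<Sum>k<p. (B $$ (k,j))\<^sup>2)"
    by (simp add: sum_product)
  also have "\<dots> = (frob_norm A * frob_norm B)\<^sup>2"
    unfolding power_mult_distrib frob_norm_sq[OF A] frob_norm_sq[OF B]
    by (subst (2) sum.swap) simp
  finally show ?thesis
    using frob_norm_nonneg by (meson mult_nonneg_nonneg power2_le_imp_le)
qed

text \<open>Write \<open>x\<^sub>i = x \<bullet> A A\<inverse> e\<^sub>i\<close> and apply Cauchy--Schwarz for \<open>A\<close>: then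
  \<open>x\<^sub>i\<^sup>2 \<le> (A\<inverse>)\<^sub>i\<^sub>i qform A x\<close>.\<close>

lemma spd_coercive:
  assumes "spd m A"
  obtains l where "0 < l" "\<And>x. x \<in> carrier_vec m \<Longrightarrow> l * (x \<bullet> x) \<le> qform A x"
proof -
  note A = spdD[OF assms] and I = minv_spd[OF assms]
  define T where "T = tr (minv A)"
  have T0: "0 \<le> T" using frob_norm_le_tr(2)[OF spd_imp_psd[OF I]] by (simp add: T_def)
  have main: "x \<bullet> x \<le> T * qform A x" if x: "x \<in> carrier_vec m" for x
  proof -
    have "(x $ i)\<^sup>2 \<le> minv A $$ (i,i) * qform A x" if i: "i < m" for i
    proof -
      let ?e = "unit_vec m i :: real vec"
      have e: "?e \<in> carrier_vec m" by simp
      let ?u = "minv A *\<^sub>v ?e"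
      note u = minv_cancel_vec[OF assms e]
      have "x $ i = x \<bullet> (A *\<^sub>v ?u)" using i x u(1) by simp
      moreover have "qform A ?u = minv A $$ (i,i)"
        using qform_minv[OF assms e] qform_unit[OF minv_spd_inverse(1)[OF assms] i] by simp
      ultimately show ?thesis
        using qform_cauchy_schwarz[OF spd_imp_psd[OF assms] x u(3)] by (simp add: mult.commute)
    qed
    hence "x \<bullet> x \<le> (\<Sum>i<m. minv A $$ (i,i) * qform A x)"
      unfolding vec_sq_sum[OF x] by (intro sum_mono) auto
    also have "\<dots> = T * qform A x"
      using minv_spd_inverse(1)[OF assms] by (auto simp: T_def tr_def sum_distrib_right)
    finally show ?thesis .
  qed
  show thesis
  proof (rule that[of "1 / (T + 1)"])
    show "0 < 1 / (T + 1)" using T0 by simp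
    fix x :: "real vec" assume x: "x \<in> carrier_vec m"
    have "x \<bullet> x \<le> (T + 1) * qform A x"
      using main[OF x] sym_psdD(3)[OF spd_imp_psd[OF assms] x] by (simp add: algebra_simps)
    thus "1 / (T + 1) * (x \<bullet> x) \<le> qform A x" using T0 by (simp add: field_simps)
  qed
qed

lemma spd_dominates:
  assumes Q: "spd m Q" and P: "P \<in> carrier_mat m m"
  obtains \<delta> where "0 < \<delta>" "\<delta> \<le> 1" "\<And>x. x \<in> carrier_vec m \<Longrightarrow> \<delta> * qform P x \<le> qform Q x"
proof -
  obtain l where l: "0 < l" "\<And>x. x \<in> carrier_vec m \<Longrightarrow> l * (x \<bullet> x) \<le> qform Q x"
    using spd_coercive[OF Q] by blast
  define d where "d = min 1 (l / (frob_norm P + 1))"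
  have f: "0 \<le> frob_norm P" by (rule frob_norm_nonneg)
  have d: "0 < d" "d \<le> 1" using l f by (auto simp: d_def)
  have dl: "d * frob_norm P \<le> l"
  proof -
    have "d * frob_norm P \<le> l / (frob_norm P + 1) * frob_norm P"
      using f by (intro mult_right_mono) (auto simp: d_def)
    also have "\<dots> \<le> l" using l f by (simp add: field_simps)
    finally show ?thesis .
  qed
  show thesis
  proof (rule that[OF d])
    fix x :: "real vec" assume x: "x \<in> carrier_vec m"
    have "d * qform P x \<le> d * (frob_norm P * (x \<bullet> x))"
      using d qform_le_frob_norm[OF P x] by simp
    also have "\<dots> = (d * frob_norm P) * (x \<bullet> x)" by simp
    also have "\<dots> \<le> l * (x \<bullet> x)" using dl vec_sq_nonneg by (intro mult_right_mono)
    also have "\<dots> \<le> qform Q x" by (rule l(2)[OF x])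
    finally show "d * qform P x \<le> qform Q x" .
  qed
qed

section \<open>The measurement update as a minimum\<close>

text \<open>The measurement model \<open>y = H x + v\<close>, where \<open>v\<close> has covariance \<open>R\<close>.\<close>

locale measurement =
  fixes m p :: nat and H R :: "real mat"
  assumes H: "H \<in> carrier_mat p m" and R: "spd p R"
begin

abbreviation innov :: "real mat \<Rightarrow> real mat" where
  "innov P \<equiv> H * P * transpose_mat H + R"

lemma HT: "transpose_mat H \<in> carrier_mat m p" using H by simp

lemma HT_vec: "k \<in> carrier_vec p \<Longrightarrow> transpose_mat H *\<^sub>v k \<in> carrier_vec m"
  using HT by simp

lemma innov_carrier: "P \<in> carrier_mat m m \<Longrightarrow> innov P \<in> carrier_mat p p"
  using H spdD(1)[OF R] by auto

lemma qform_innov: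
  assumes "P \<in> carrier_mat m m" "k \<in> carrier_vec p"
  shows "qform (innov P) k = qform P (transpose_mat H *\<^sub>v k) + qform R k"
proof -
  have "H * P * transpose_mat H \<in> carrier_mat p p" using H assms by auto
  thus ?thesis using qform_add[of _ p R k] spdD(1)[OF R] assms qform_congruence[OF H assms] by simp
qed

lemma innov_spd:
  assumes "sym_psd m P" shows "spd p (innov P)"
proof (rule spdI)
  note P = sym_psdD[OF assms] and R' = spdD[OF R]
  show "innov P \<in> carrier_mat p p" by (rule innov_carrier[OF P(1)])
  have HPH: "H * P * transpose_mat H \<in> carrier_mat p p" using H P by auto
  show "transpose_mat (innov P) = innov P"
    using transpose_add[OF HPH R'(1)] symmetric_congruence[OF H P(1,2)] R'(2) by simp
  fix x :: "real vec" assume x: "x \<in> carrier_vec p" "x \<noteq> 0\<^sub>v p"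
  have "0 < qform R x" using R'(3) x by blast
  moreover have "0 \<le> qform P (transpose_mat H *\<^sub>v x)" using P(3) HT_vec x by blast
  ultimately show "0 < qform (innov P) x" using qform_innov[OF P(1) x(1)] by simp
qed

text \<open>The Kalman gain acts by its transpose on the vectors at which covariances are evaluated; this is
  that action.\<close>

abbreviation opt_gain :: "real mat \<Rightarrow> real vec \<Rightarrow> real vec" where
  "opt_gain P x \<equiv> minv (innov P) *\<^sub>v (H *\<^sub>v (P *\<^sub>v x))"

lemma opt_gain_carrier:
  assumes "sym_psd m P" "x \<in> carrier_vec m" shows "opt_gain P x \<in> carrier_vec p"
  using minv_cancel_vec(3)[OF innov_spd[OF assms(1)]] H sym_psdD(1)[OF assms(1)] assms(2)
  by (meson mult_mat_vec_carrier)

lemma meas_update_congruence: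
  assumes "sym_psd m P"
  shows "meas_update H R P
     = P - (P * transpose_mat H) * minv (innov P) * transpose_mat (P * transpose_mat H)"
proof -
  note P = sym_psdD[OF assms] and I = minv_spd_inverse(1)[OF innov_spd[OF assms]]
  have PH: "P * transpose_mat H \<in> carrier_mat m p" using P H by auto
  have "transpose_mat (P * transpose_mat H) = H * P"
    using transpose_mult[OF P(1) HT] P(2) by simp
  moreover have "P * transpose_mat H * minv (innov P) * H * P
      = P * transpose_mat H * minv (innov P) * (H * P)"
    by (rule assoc_mult_mat[of _ m p _ m _ m]) (use PH I H P in auto)
  ultimately show ?thesis unfolding meas_update_def by simp
qed

lemma meas_update_carrier:
  assumes "sym_psd m P" shows "meas_update H R P \<in> carrier_mat m m"
  using assms sym_psdD(1)[OF assms] unfolding meas_update_def by auto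

lemma meas_update_symmetric:
  assumes "sym_psd m P" shows "transpose_mat (meas_update H R P) = meas_update H R P"
proof -
  note P = sym_psdD[OF assms] and S = innov_spd[OF assms]
  note I = minv_spd_inverse(1)[OF S]
  have PH: "P * transpose_mat H \<in> carrier_mat m p" using P H by auto
  have c: "P * transpose_mat H * minv (innov P) * transpose_mat (P * transpose_mat H)
      \<in> carrier_mat m m" using PH I by auto
  show ?thesis unfolding meas_update_congruence[OF assms]
    using transpose_minus[OF P(1) c] P(2) symmetric_congruence[OF PH I minv_symmetric[OF S]] by simp
qed

lemma qform_meas_update:
  assumes "sym_psd m P" and x: "x \<in> carrier_vec m"
  shows "qform (meas_update H R P) x = qform P x - qform (minv (innov P)) (H *\<^sub>v (P *\<^sub>v x))"
proof -
  note P = sym_psdD[OF assms(1)] and S = innov_spd[OF assms(1)]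
  note I = minv_spd_inverse(1)[OF S]
  have PH: "P * transpose_mat H \<in> carrier_mat m p" using P H by auto
  have c: "P * transpose_mat H * minv (innov P) * transpose_mat (P * transpose_mat H)
      \<in> carrier_mat m m" using PH I by auto
  have "transpose_mat (P * transpose_mat H) *\<^sub>v x = H *\<^sub>v (P *\<^sub>v x)"
    using transpose_mult[OF P(1) HT] P H x by simp
  thus ?thesis unfolding meas_update_congruence[OF assms(1)]
    using qform_minus[OF P(1) c x] qform_congruence[OF PH I x] by simp
qed

text \<open>The left-hand side is the variance of the linear combination \<open>x\<close> of the estimation error when
  the measurement is used with an arbitrary weight \<open>k\<close>. Completing the square in \<open>k\<close> shows that
  the updated covariance is the minimum over all weights. All properties of the measurement update
  below (monotonicity, subhomogeneity, behaviour under block-diagonal projection) follow by inserting a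
  weight that is optimal for one problem into another.\<close>

lemma meas_update_complete_square:
  assumes "sym_psd m P" and x: "x \<in> carrier_vec m" and k: "k \<in> carrier_vec p"
  shows "qform P (x - transpose_mat H *\<^sub>v k) + qform R k
     = qform (meas_update H R P) x + qform (innov P) (k - opt_gain P x)"
proof -
  note P = sym_psdD[OF assms(1)] and S = innov_spd[OF assms(1)]
  let ?y = "H *\<^sub>v (P *\<^sub>v x)"
  have y: "?y \<in> carrier_vec p" using H P x by (meson mult_mat_vec_carrier)
  have Px: "P *\<^sub>v x \<in> carrier_vec m" using P x by simp
  note k0 = minv_cancel_vec[OF S y]
  have "qform (innov P) (k - opt_gain P x)
     = qform (innov P) k - 2 * (k \<bullet> ?y) + qform (minv (innov P)) ?y"
    using qform_minus_vec[OF spdD(1,2)[OF S] k k0(3)] k0(1) qform_minv[OF S y] by simp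
  moreover have "qform P (x - transpose_mat H *\<^sub>v k)
     = qform P x - 2 * (k \<bullet> ?y) + qform P (transpose_mat H *\<^sub>v k)"
    using qform_minus_vec[OF P(1,2) x HT_vec[OF k]]
      symmetric_scalar_prod[OF P(1,2) x HT_vec[OF k]]
      transpose_vec_mult_scalar[OF H Px k] comm_scalar_prod[OF Px HT_vec[OF k]]
      comm_scalar_prod[OF k y] by simp
  ultimately show ?thesis
    using qform_innov[OF P(1) k] qform_meas_update[OF assms(1) x] by simp
qed

lemma meas_update_le:
  assumes "sym_psd m P" "x \<in> carrier_vec m" "k \<in> carrier_vec p"
  shows "qform (meas_update H R P) x \<le> qform P (x - transpose_mat H *\<^sub>v k) + qform R k"
  unfolding meas_update_complete_square[OF assms]
  using sym_psdD(3)[OF spd_imp_psd[OF innov_spd[OF assms(1)]]] opt_gain_carrier[OF assms(1,2)] assms(3)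
  by simp

lemma meas_update_attained:
  assumes "sym_psd m P" "x \<in> carrier_vec m"
  shows "qform (meas_update H R P) x
     = qform P (x - transpose_mat H *\<^sub>v opt_gain P x) + qform R (opt_gain P x)"
proof -
  note k0 = opt_gain_carrier[OF assms]
  show ?thesis
    unfolding meas_update_complete_square[OF assms k0]
    using minus_cancel_vec[OF k0] qform_zero_vec[OF spdD(1)[OF innov_spd[OF assms(1)]]] by simp
qed

lemma meas_update_psd:
  assumes "sym_psd m P" shows "sym_psd m (meas_update H R P)"
  unfolding sym_psd_def
proof (intro conjI ballI)
  show "meas_update H R P \<in> carrier_mat m m" by (rule meas_update_carrier[OF assms])
  show "transpose_mat (meas_update H R P) = meas_update H R P"
    by (rule meas_update_symmetric[OF assms])
  fix x :: "real vec" assume x: "x \<in> carrier_vec m"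
  note k0 = opt_gain_carrier[OF assms x]
  have "0 \<le> qform R (opt_gain P x)" using sym_psdD(3)[OF spd_imp_psd[OF R] k0] .
  moreover have "0 \<le> qform P (x - transpose_mat H *\<^sub>v opt_gain P x)"
    using sym_psdD(3)[OF assms] x HT_vec[OF k0] by simp
  ultimately show "0 \<le> qform (meas_update H R P) x"
    using meas_update_attained[OF assms x] by simp
qed

text \<open>Monotonicity together with subhomogeneity: enlarging the prior by the factor \<open>t \<ge> 1\<close> enlarges
  the first part of the minimised expression by \<open>t\<close> and leaves the noise part alone.\<close>

lemma meas_update_mono_scale:
  assumes X: "sym_psd m X" and P: "sym_psd m P" and t: "1 \<le> t"
    and le: "\<And>x. x \<in> carrier_vec m \<Longrightarrow> qform X x \<le> t * qform P x" and x: "x \<in> carrier_vec m"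
  shows "qform (meas_update H R X) x \<le> t * qform (meas_update H R P) x"
proof -
  let ?k = "opt_gain P x" let ?z = "x - transpose_mat H *\<^sub>v ?k"
  note k = opt_gain_carrier[OF P x]
  have z: "?z \<in> carrier_vec m" using x HT_vec[OF k] by simp
  have "0 \<le> qform R ?k" using sym_psdD(3)[OF spd_imp_psd[OF R] k] .
  hence "qform R ?k \<le> t * qform R ?k" using t by (metis mult_left_le_imp_le mult_le_cancel_right1 not_le)
  moreover have "qform X ?z \<le> t * qform P ?z" by (rule le[OF z])
  moreover have "qform (meas_update H R X) x \<le> qform X ?z + qform R ?k"
    by (rule meas_update_le[OF X x k])
  ultimately show ?thesis unfolding meas_update_attained[OF P x] by (simp add: distrib_left)
qed

end

section \<open>Projection to the diagonal blocks\<close>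

text \<open>The part of a vector that belongs to block \<open>i\<close>, as a vector of the same length. For block size
  \<open>0\<close> the convention \<open>k div 0 = 0\<close> makes everything one block; the full Kalman filter is thereby
  the block-diagonal filter with block size \<open>0\<close>.\<close>

definition bpart :: "nat \<Rightarrow> nat \<Rightarrow> real vec \<Rightarrow> real vec" where
  "bpart c i x = vec (dim_vec x) (\<lambda>k. if k div c = i then x $ k else 0)"

lemma bpart_carrier: "x \<in> carrier_vec m \<Longrightarrow> bpart c i x \<in> carrier_vec m"
  by (auto simp: bpart_def)

lemma block_proj_carrier: "A \<in> carrier_mat m p \<Longrightarrow> block_proj c A \<in> carrier_mat m p"
  by (auto simp: block_proj_def)

lemma block_proj_add:
  "A \<in> carrier_mat m p \<Longrightarrow> B \<in> carrier_mat m p \<Longrightarrow>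
    block_proj c (A + B) = block_proj c A + block_proj c B"
  by (auto simp: block_proj_def)

lemma block_proj_0: "block_proj 0 A = A"
  by (auto simp: block_proj_def)

lemma block_proj_symmetric:
  assumes "A \<in> carrier_mat m m" "transpose_mat A = A"
  shows "transpose_mat (block_proj c A) = block_proj c A"
proof (rule eq_matI)
  fix k l assume "k < dim_row (block_proj c A)" "l < dim_col (block_proj c A)"
  hence kl: "k < m" "l < m" using assms(1) by (auto simp: block_proj_def)
  have "A $$ (l,k) = A $$ (k,l)" using assms kl by (metis carrier_matD index_transpose_mat(1))
  thus "transpose_mat (block_proj c A) $$ (k,l) = block_proj c A $$ (k,l)"
    using kl assms(1) by (auto simp: block_proj_def)
qed (use assms(1) in \<open>auto simp: block_proj_def\<close>)

lemma qform_block_proj: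
  assumes A: "A \<in> carrier_mat m m" and x: "x \<in> carrier_vec m"
    and n: "\<And>k. k < m \<Longrightarrow> k div c < n"
  shows "qform (block_proj c A) x = (\<Sum>i<n. qform A (bpart c i x))"
proof -
  have "(\<Sum>i<n. qform A (bpart c i x))
    = (\<Sum>i<n. \<Sum>k<m. \<Sum>l<m. if k div c = i then (if l div c = i then A $$ (k,l) * (x $ k * x $ l) else 0) else 0)"
    unfolding qform_sum[OF A bpart_carrier[OF x]]
    using x by (intro sum.cong refl) (auto simp: bpart_def)
  also have "\<dots> = (\<Sum>k<m. \<Sum>l<m. \<Sum>i<n. if k div c = i then (if l div c = i then A $$ (k,l) * (x $ k * x $ l) else 0) else 0)"
    by (rule trans[OF sum.swap], rule sum.cong[OF refl], rule sum.swap)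
  also have "\<dots> = (\<Sum>k<m. \<Sum>l<m. block_proj c A $$ (k,l) * (x $ k * x $ l))"
    using A n by (intro sum.cong refl) (auto simp: block_proj_def)
  finally show ?thesis using qform_sum[OF block_proj_carrier[OF A] x] by simp
qed

lemma qform_block_proj_all_parts: 
  "A \<in> carrier_mat m m \<Longrightarrow> x \<in> carrier_vec m \<Longrightarrow>
     qform (block_proj c A) x = (\<Sum>i<m. qform A (bpart c i x))"
  by (rule qform_block_proj) (auto intro: le_less_trans[OF div_le_dividend])

lemma block_proj_psd: "sym_psd m A \<Longrightarrow> sym_psd m (block_proj c A)"
  unfolding sym_psd_def
  using block_proj_carrier[of A m m c] block_proj_symmetric[of A m c] qform_block_proj_all_parts[of A m _ c]
  by (auto simp: bpart_carrier intro!: sum_nonneg)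

text \<open>A nonzero vector has a nonzero block part, and its contribution alone is positive.\<close>

lemma block_proj_spd:
  assumes "spd m A" shows "spd m (block_proj c A)"
proof -
  obtain l where l: "0 < l" "\<And>x. x \<in> carrier_vec m \<Longrightarrow> l * (x \<bullet> x) \<le> qform A x"
    using spd_coercive[OF assms] by blast
  note A = spdD[OF assms]
  show ?thesis
  proof (rule spdI)
    fix x :: "real vec" assume x: "x \<in> carrier_vec m" "x \<noteq> 0\<^sub>v m"
    obtain k where k: "k < m" "x $ k \<noteq> 0" using x by (metis carrier_vecD eq_vecI index_zero_vec)
    let ?y = "bpart c (k div c) x"
    have i: "k div c < m" using k(1) by (meson div_le_dividend le_less_trans)
    have "?y $ k \<noteq> 0" using k x by (auto simp: bpart_def)
    hence y: "?y \<noteq> 0\<^sub>v m" using k by auto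
    have "0 < qform A ?y" by (rule A(3)[OF bpart_carrier[OF x(1)] y])
    also have "\<dots> \<le> (\<Sum>i<m. qform A (bpart c i x))"
      using i sym_psdD(3)[OF spd_imp_psd[OF assms] bpart_carrier[OF x(1)]]
      by (intro member_le_sum) auto
    finally show "0 < qform (block_proj c A) x" using qform_block_proj_all_parts[OF A(1) x(1)] by simp
  qed (use A block_proj_carrier block_proj_symmetric in auto)
qed

section \<open>Riccati equations: comparison and uniqueness\<close>

locale riccati = measurement +
  fixes c :: nat and F :: "real mat"
  assumes F: "F \<in> carrier_mat m m"
begin

text \<open>The part of the Riccati operator that does not depend on the process noise. By the convention
  on block size \<open>0\<close> this covers both filters.\<close>

definition step :: "real mat \<Rightarrow> real mat" where
  "step P = F * block_proj c (meas_update H R P) * transpose_mat F"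

lemma FT_vec: "x \<in> carrier_vec m \<Longrightarrow> transpose_mat F *\<^sub>v x \<in> carrier_vec m"
  using F by simp

lemma step_carrier: "sym_psd m P \<Longrightarrow> step P \<in> carrier_mat m m"
  using F block_proj_carrier[OF meas_update_carrier] by (auto simp: step_def)

lemma qform_step:
  assumes "sym_psd m P" "x \<in> carrier_vec m"
  shows "qform (step P) x = qform (block_proj c (meas_update H R P)) (transpose_mat F *\<^sub>v x)"
  unfolding step_def
  by (rule qform_congruence[OF F block_proj_carrier[OF meas_update_carrier[OF assms(1)]] assms(2)])

lemma step_psd:
  assumes "sym_psd m P" shows "sym_psd m (step P)"
proof -
  note B = sym_psdD[OF block_proj_psd[OF meas_update_psd[OF assms], of c]]
  show ?thesis unfolding sym_psd_def
    using step_carrier[OF assms] qform_step[OF assms] B FT_vec symmetric_congruence[OF F B(1,2)]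
    by (simp add: step_def)
qed

lemma block_update_mono_scale:
  assumes "sym_psd m X" "sym_psd m P" "1 \<le> t"
    "\<And>x. x \<in> carrier_vec m \<Longrightarrow> qform X x \<le> t * qform P x" "x \<in> carrier_vec m"
  shows "qform (block_proj c (meas_update H R X)) x \<le> t * qform (block_proj c (meas_update H R P)) x"
  using meas_update_mono_scale[OF assms(1-4) bpart_carrier[OF assms(5)]] assms
  by (simp add: qform_block_proj_all_parts[OF meas_update_carrier] sum_distrib_left sum_mono)

lemma step_mono_scale:
  assumes "sym_psd m X" "sym_psd m P" "1 \<le> t"
    "\<And>x. x \<in> carrier_vec m \<Longrightarrow> qform X x \<le> t * qform P x" "x \<in> carrier_vec m"
  shows "qform (step X) x \<le> t * qform (step P) x"
  using block_update_mono_scale[OF assms(1-4) FT_vec[OF assms(5)]]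
  by (simp add: qform_step[OF assms(1,5)] qform_step[OF assms(2,5)])

text \<open>The comparison principle. Let \<open>t\<close> be the least factor \<open>\<ge> 1\<close> with
  \<open>X \<le> t P\<close>. Subhomogeneity gives \<open>step X + Q \<le> t (step P + Q) - (t - 1) Q\<close>, and the last term
  gains at least \<open>(t - 1) \<delta> P\<close>, so that \<open>t\<close> can be replaced by
  \<open>(1 + s) (t - (t - 1) \<delta>)\<close>. Minimality of \<open>t\<close> then bounds it. With \<open>s = 0\<close> this
  is uniqueness and monotone dependence on \<open>Q\<close>, with \<open>s > 0\<close> it is a perturbation bound.\<close>

lemma riccati_comparison:
  assumes X: "sym_psd m X" and P: "spd m P"
    and \<delta>: "0 < \<delta>" "\<delta> \<le> 1" and s: "0 \<le> s" "s \<le> \<delta> / 2"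
    and sub: "\<And>x. x \<in> carrier_vec m \<Longrightarrow> qform X x \<le> (1 + s) * (qform (step X) x + qform Q x)"
    and super: "\<And>x. x \<in> carrier_vec m \<Longrightarrow> qform (step P) x + qform Q x \<le> qform P x"
    and dom: "\<And>x. x \<in> carrier_vec m \<Longrightarrow> \<delta> * qform P x \<le> qform Q x"
    and x: "x \<in> carrier_vec m"
  shows "qform X x \<le> (1 + 2 * s / \<delta>) * qform P x"
proof -
  note Ppsd = spd_imp_psd[OF P]
  have P0: "0 \<le> qform P x" if "x \<in> carrier_vec m" for x using sym_psdD(3)[OF Ppsd that] .
  \<comment> \<open>Subhomogeneity is available only for factors \<open>t \<ge> 1\<close>.\<close>
  define S where "S = {t. 1 \<le> t \<and> (\<forall>x \<in> carrier_vec m. qform X x \<le> t * qform P x)}"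
  obtain d where d: "0 < d" "\<And>x. x \<in> carrier_vec m \<Longrightarrow> d * qform X x \<le> qform P x"
    using spd_dominates[OF P sym_psdD(1)[OF X]] by metis
  have "max 1 (1/d) \<in> S"
  proof -
    have "qform X x \<le> max 1 (1/d) * qform P x" if x: "x \<in> carrier_vec m" for x
    proof -
      have "qform X x \<le> 1/d * qform P x" using d(2)[OF x] d(1) by (simp add: field_simps)
      also have "\<dots> \<le> max 1 (1/d) * qform P x" using P0[OF x] by (intro mult_right_mono) auto
      finally show ?thesis .
    qed
    thus ?thesis by (simp add: S_def)
  qed
  hence ne: "S \<noteq> {}" by auto
  have bdd: "bdd_below S" by (rule bdd_belowI[of _ 1]) (simp add: S_def)
  define t where "t = Inf S"
  have t1: "1 \<le> t" unfolding t_def using ne by (intro cInf_greatest) (auto simp: S_def)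
  have tX: "qform X x \<le> t * qform P x" if x: "x \<in> carrier_vec m" for x
  proof (cases "qform P x = 0")
    case True
    thus ?thesis using ne x by (auto simp: S_def)
  next
    case False
    hence p: "0 < qform P x" using P0[OF x] by simp
    have "qform X x / qform P x \<le> t" unfolding t_def using ne
      by (rule cInf_greatest) (use p x in \<open>auto simp: S_def field_simps\<close>)
    thus ?thesis using p by (simp add: field_simps)
  qed
  \<comment> \<open>The improved factor; \<open>\<delta> \<le> 1\<close> keeps it in the range of admissible factors.\<close>
  define t' where "t' = (1 + s) * (t - (t - 1) * \<delta>)"
  have "(t - 1) * \<delta> \<le> t - 1" using t1 \<delta> by (simp add: mult_left_le)
  hence a1: "1 \<le> t - (t - 1) * \<delta>" by linarith
  have t'1: "1 \<le> t'"
    unfolding t'_def using mult_mono[of 1 "1 + s" 1 "t - (t - 1) * \<delta>"] a1 s by simp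
  have "t' \<in> S"
  proof -
    have "qform X x \<le> t' * qform P x" if x: "x \<in> carrier_vec m" for x
    proof -
      have st: "qform (step X) x \<le> t * qform (step P) x"
        by (rule step_mono_scale[OF X Ppsd t1 tX x])
      have "t * (qform (step P) x + qform Q x) \<le> t * qform P x"
        using super[OF x] t1 by (intro mult_left_mono) auto
      hence "qform (step X) x + qform Q x \<le> t * qform P x - (t - 1) * qform Q x"
        using st by (simp add: algebra_simps)
      moreover have "(t - 1) * (\<delta> * qform P x) \<le> (t - 1) * qform Q x"
        using dom[OF x] t1 by (intro mult_left_mono) auto
      ultimately have "qform (step X) x + qform Q x \<le> (t - (t - 1) * \<delta>) * qform P x"
        by (simp add: algebra_simps)
      hence "(1 + s) * (qform (step X) x + qform Q x) \<le> (1 + s) * ((t - (t - 1) * \<delta>) * qform P x)"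
        using s by (intro mult_left_mono) auto
      thus ?thesis using sub[OF x] by (simp add: t'_def mult.assoc)
    qed
    thus ?thesis using t'1 by (simp add: S_def)
  qed
  hence "t \<le> t'" unfolding t_def using bdd by (rule cInf_lower)
  hence "(t - 1) * (\<delta> - s + s * \<delta>) \<le> s" by (simp add: t'_def algebra_simps)
  moreover have "\<delta> / 2 \<le> \<delta> - s + s * \<delta>"
    using s \<delta> mult_nonneg_nonneg[of s \<delta>] by linarith
  hence "(t - 1) * (\<delta> / 2) \<le> (t - 1) * (\<delta> - s + s * \<delta>)"
    using t1 by (intro mult_left_mono) auto
  ultimately have "t \<le> 1 + 2 * s / \<delta>" using \<delta> by (simp add: field_simps)
  thus ?thesis using tX[OF x] mult_right_mono[OF _ P0[OF x]] by (meson order_trans)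
qed

lemma riccati_comparison_exact:
  assumes X: "sym_psd m X" and P: "spd m P" and Q: "spd m Q"
    and sub: "\<And>x. x \<in> carrier_vec m \<Longrightarrow> qform X x \<le> qform (step X) x + qform Q x"
    and super: "\<And>x. x \<in> carrier_vec m \<Longrightarrow> qform (step P) x + qform Q x \<le> qform P x"
    and x: "x \<in> carrier_vec m"
  shows "qform X x \<le> qform P x"
proof -
  obtain \<delta> where "0 < \<delta>" "\<delta> \<le> 1" "\<And>x. x \<in> carrier_vec m \<Longrightarrow> \<delta> * qform P x \<le> qform Q x"
    using spd_dominates[OF Q spdD(1)[OF P]] by metis
  from riccati_comparison[OF X P this(1,2), of 0 Q x] this sub super x show ?thesis by simp
qed

definition riccati_solution :: "real mat \<Rightarrow> real mat \<Rightarrow> bool" where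
  "riccati_solution Q P \<longleftrightarrow> spd m P \<and> P = step P + Q"

lemma riccati_solutionD:
  assumes "riccati_solution Q P" "Q \<in> carrier_mat m m"
  shows "spd m P" "sym_psd m P" "P = step P + Q"
    "x \<in> carrier_vec m \<Longrightarrow> qform P x = qform (step P) x + qform Q x"
proof -
  show P: "spd m P" "P = step P + Q" using assms by (auto simp: riccati_solution_def)
  show psd: "sym_psd m P" by (rule spd_imp_psd[OF P(1)])
  show "qform P x = qform (step P) x + qform Q x" if "x \<in> carrier_vec m"
    using P(2) qform_add[OF step_carrier[OF psd] assms(2) that] by metis
qed

text \<open>A solution is a subsolution and a supersolution at once, so the comparison works in both directions.\<close>

lemma riccati_solution_unique:
  assumes Q: "spd m Q" and P: "riccati_solution Q P" and P': "riccati_solution Q P'"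
  shows "P = P'"
proof (rule qform_determines[of _ m])
  note D = riccati_solutionD[OF P spdD(1)[OF Q]] and D' = riccati_solutionD[OF P' spdD(1)[OF Q]]
  show "P \<in> carrier_mat m m" "transpose_mat P = P" "P' \<in> carrier_mat m m" "transpose_mat P' = P'"
    using spdD D(1) D'(1) by blast+
  fix x :: "real vec" assume x: "x \<in> carrier_vec m"
  show "qform P x = qform P' x"
    using riccati_comparison_exact[OF D(2) D'(1) Q _ _ x] riccati_comparison_exact[OF D'(2) D(1) Q _ _ x]
      D(4) D'(4) by (simp add: order_antisym)
qed

lemma bd_pred_solution:
  assumes Q: "spd m Q" and P: "riccati_solution Q P"
  shows "bd_pred c F H R Q = P"
  unfolding bd_pred_def
proof (rule the_equality)
  have m: "dim_row F = m" using F by simp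
  show "P \<in> carrier_mat (dim_row F) (dim_row F) \<and> sym_pos_def P \<and>
    P = F * block_proj c (meas_update H R P) * transpose_mat F + Q"
    using P m by (auto simp: riccati_solution_def spd_def step_def)
  fix P' assume "P' \<in> carrier_mat (dim_row F) (dim_row F) \<and> sym_pos_def P' \<and>
    P' = F * block_proj c (meas_update H R P') * transpose_mat F + Q"
  hence "riccati_solution Q P'" using m by (auto simp: riccati_solution_def spd_def step_def)
  thus "P' = P" using riccati_solution_unique[OF Q P] by simp
qed

end

lemma kf_pred_eq_bd: "kf_pred F H R Q = bd_pred 0 F H R Q"
  by (simp add: kf_pred_def bd_pred_def block_proj_0)

section \<open>Existence of solutions by monotone iteration\<close>

context riccati begin

lemma step_mono:
  assumes "sym_psd m X" "sym_psd m P" "\<And>x. x \<in> carrier_vec m \<Longrightarrow> qform X x \<le> qform P x"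
    "x \<in> carrier_vec m"
  shows "qform (step X) x \<le> qform (step P) x"
  using step_mono_scale[of X P 1 x] assms by simp

primrec iterate :: "real mat \<Rightarrow> nat \<Rightarrow> real mat" where
  "iterate Q 0 = Q"
| "iterate Q (Suc k) = step (iterate Q k) + Q"

lemma step_add_spd:
  assumes X: "sym_psd m X" and Q: "spd m Q"
  shows "spd m (step X + Q)"
    "\<And>x. x \<in> carrier_vec m \<Longrightarrow> qform (step X + Q) x = qform (step X) x + qform Q x"
    "\<And>x. x \<in> carrier_vec m \<Longrightarrow> qform Q x \<le> qform (step X + Q) x"
proof -
  note S = sym_psdD[OF step_psd[OF X]] and Q' = spdD[OF Q]
  show *: "qform (step X + Q) x = qform (step X) x + qform Q x" if "x \<in> carrier_vec m" for x
    by (rule qform_add[OF S(1) Q'(1) that])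
  show "qform Q x \<le> qform (step X + Q) x" if "x \<in> carrier_vec m" for x
    using *[OF that] S(3)[OF that] by simp
  show "spd m (step X + Q)"
  proof (rule spdI)
    show "step X + Q \<in> carrier_mat m m" "transpose_mat (step X + Q) = step X + Q"
      using S Q' transpose_add[of "step X" m m Q] by auto
    fix x :: "real vec" assume x: "x \<in> carrier_vec m" "x \<noteq> 0\<^sub>v m"
    show "0 < qform (step X + Q) x"
      using *[OF x(1)] S(3)[OF x(1)] Q'(3)[OF x] by simp
  qed
qed

text \<open>The iterates starting from \<open>Q\<close> increase and stay below the supersolution \<open>Y\<close>, hence converge
  to some \<open>L\<close>. The limit is a fixed point because eventually \<open>L \<le> (1 + e) P\<^sub>k\<close>: all
  iterates dominate the definite matrix \<open>Q\<close>, against which the vanishing difference can be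
  measured. Subhomogeneity then bounds the operator at \<open>L\<close>.\<close>

lemma riccati_solution_exists:
  assumes Q: "spd m Q" and Y: "sym_psd m Y"
    and super: "\<And>x. x \<in> carrier_vec m \<Longrightarrow> qform (step Y) x + qform Q x \<le> qform Y x"
  shows "\<exists>P. riccati_solution Q P"
proof -
  note Q' = spdD[OF Q]
  define P where "P = iterate Q"
  have P0: "P 0 = Q" and PS: "P (Suc k) = step (P k) + Q" for k by (auto simp: P_def)
  have spdP: "spd m (P k)" for k
    by (induction k) (use Q P0 PS step_add_spd(1) spd_imp_psd in auto)
  note psdP = spd_imp_psd[OF spdP]
  have qS: "qform (P (Suc k)) x = qform (step (P k)) x + qform Q x" if "x \<in> carrier_vec m" for k x
    using step_add_spd(2)[OF psdP Q that] PS by simp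
  have inc1: "x \<in> carrier_vec m \<Longrightarrow> qform (P k) x \<le> qform (P (Suc k)) x" for k x
  proof (induction k arbitrary: x)
    case 0 thus ?case using step_add_spd(3)[OF spd_imp_psd[OF Q] Q 0] P0 PS[of 0] by simp
  next
    case (Suc k)
    show ?case using step_mono[OF psdP psdP Suc.IH Suc.prems] qS[OF Suc.prems] by simp
  qed
  have inc: "incseq (\<lambda>k. qform (P k) x)" if "x \<in> carrier_vec m" for x
    using inc1[OF that] by (rule incseq_SucI)
  have leY: "x \<in> carrier_vec m \<Longrightarrow> qform (P k) x \<le> qform Y x" for k x
  proof (induction k arbitrary: x)
    case 0 thus ?case using super[OF 0] sym_psdD(3)[OF step_psd[OF Y] 0] P0 by simp
  next
    case (Suc k)
    show ?case using step_mono[OF psdP Y Suc.IH Suc.prems] qS[OF Suc.prems] super[OF Suc.prems] by simp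
  qed
  have conv: "convergent (\<lambda>k. qform (P k) x)" if "x \<in> carrier_vec m" for x
    using incseq_convergent[OF inc[OF that]] leY[OF that] by (meson convergent_def)
  have conv_entry: "convergent (\<lambda>k. P k $$ (i,j))" if "i < m" "j < m" for i j
  proof -
    let ?u = "unit_vec m i" and ?v = "unit_vec m j"
    have "convergent (\<lambda>k. (qform (P k) (?u + ?v) - qform (P k) ?u - qform (P k) ?v) * (1/2))"
      by (intro convergent_mult convergent_diff convergent_const conv) auto
    thus ?thesis by (simp add: entry_polarisation[OF spdD(1,2)[OF spdP] that])
  qed
  define L where "L = mat m m (\<lambda>ij. lim (\<lambda>k. P k $$ ij))"
  have L: "L \<in> carrier_mat m m" by (simp add: L_def)
  have lim_entry: "(\<lambda>k. P k $$ (i,j)) \<longlonglongrightarrow> L $$ (i,j)" if "i < m" "j < m" for i j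
    using conv_entry[OF that] that by (simp add: L_def convergent_LIMSEQ_iff)
  have symL: "transpose_mat L = L"
  proof (rule eq_matI)
    fix i j assume "i < dim_row L" "j < dim_col L"
    hence ij: "i < m" "j < m" using L by auto
    have "P k $$ (j,i) = P k $$ (i,j)" for k
      using spdD(1,2)[OF spdP[of k]] ij by (metis carrier_matD index_transpose_mat(1))
    thus "transpose_mat L $$ (i,j) = L $$ (i,j)" using ij by (simp add: L_def)
  qed (use L in auto)
  have lim_q: "(\<lambda>k. qform (P k) x) \<longlonglongrightarrow> qform L x" if x: "x \<in> carrier_vec m" for x
    unfolding qform_sum[OF L x] qform_sum[OF spdD(1)[OF spdP] x]
    by (intro tendsto_sum tendsto_mult lim_entry tendsto_const) auto
  have PL: "qform (P k) x \<le> qform L x" if x: "x \<in> carrier_vec m" for k x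
    using incseq_le[OF inc[OF x] lim_q[OF x]] .
  have spdL: "spd m L"
  proof (rule spdI[OF L symL])
    fix x :: "real vec" assume x: "x \<in> carrier_vec m" "x \<noteq> 0\<^sub>v m"
    show "0 < qform L x" using PL[OF x(1), of 0] Q'(3)[OF x] P0 by simp
  qed
  note psdL = spd_imp_psd[OF spdL]
  obtain l where l: "0 < l" "\<And>x. x \<in> carrier_vec m \<Longrightarrow> l * (x \<bullet> x) \<le> qform Q x"
    using spd_coercive[OF Q] by blast
  have QP: "qform Q x \<le> qform (P k) x" if "x \<in> carrier_vec m" for k x
    using incseqD[OF inc[OF that], of 0 k] P0 by simp
  have lim_frob: "(\<lambda>k. frob_norm (L - P k)) \<longlonglongrightarrow> 0"
  proof -
    have "(\<lambda>k. sqrt (\<Sum>i<m. \<Sum>j<m. (L $$ (i,j) - P k $$ (i,j))\<^sup>2))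
        \<longlonglongrightarrow> sqrt (\<Sum>i<m. \<Sum>j<m. (L $$ (i,j) - L $$ (i,j))\<^sup>2)"
      by (intro tendsto_real_sqrt tendsto_sum tendsto_power tendsto_diff tendsto_const lim_entry) auto
    moreover have "frob_norm (L - P k) = sqrt (\<Sum>i<m. \<Sum>j<m. (L $$ (i,j) - P k $$ (i,j))\<^sup>2)" for k
      using L spdD(1)[OF spdP[of k]] by (auto simp: frob_norm_def)
    ultimately show ?thesis by simp
  qed
  have close: "\<exists>k. \<forall>x \<in> carrier_vec m. qform L x \<le> (1 + e) * qform (P k) x" if e: "0 < e" for e
  proof -
    obtain k where k: "frob_norm (L - P k) < e * l"
      using order_tendstoD(2)[OF lim_frob, of "e * l"] e l(1)
      by (auto simp: eventually_sequentially)
    have "qform L x \<le> (1 + e) * qform (P k) x" if x: "x \<in> carrier_vec m" for x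
    proof -
      have LP: "L - P k \<in> carrier_mat m m" using L spdD(1)[OF spdP[of k]] by auto
      have "qform L x - qform (P k) x = qform (L - P k) x"
        using qform_minus[OF L spdD(1)[OF spdP[of k]] x] by simp
      also have "\<dots> \<le> frob_norm (L - P k) * (x \<bullet> x)" by (rule qform_le_frob_norm[OF LP x])
      also have "\<dots> \<le> e * l * (x \<bullet> x)" using k vec_sq_nonneg by (intro mult_right_mono) auto
      also have "\<dots> \<le> e * qform Q x" using l(2)[OF x] e by (simp add: mult.assoc)
      also have "\<dots> \<le> e * qform (P k) x" using QP[OF x] e by simp
      finally show ?thesis by (simp add: algebra_simps)
    qed
    thus ?thesis by blast
  qed
  note T = step_add_spd[OF psdL Q]
  have "qform L x = qform (step L + Q) x" if x: "x \<in> carrier_vec m" for x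
  proof (rule antisym)
    have "qform (P (Suc k)) x \<le> qform (step L + Q) x" for k
      using step_mono[OF psdP psdL PL x] qS[OF x] T(2)[OF x] by simp
    thus "qform L x \<le> qform (step L + Q) x"
      using LIMSEQ_le_const2[OF LIMSEQ_Suc[OF lim_q[OF x]]] by blast
    have "qform (step L + Q) x \<le> qform L x + e" if e: "0 < e" for e
    proof -
      define e' where "e' = e / (qform L x + 1)"
      have L0: "0 \<le> qform L x" using sym_psdD(3)[OF psdL x] .
      have e': "0 < e'" "e' * qform L x \<le> e" using e L0 by (auto simp: e'_def field_simps)
      obtain k where k: "\<And>x. x \<in> carrier_vec m \<Longrightarrow> qform L x \<le> (1 + e') * qform (P k) x"
        using close[OF e'(1)] by blast
      have "qform (step L) x \<le> (1 + e') * qform (step (P k)) x"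
        by (rule step_mono_scale[OF psdL psdP _ k x]) (use e' in auto)
      moreover have "qform Q x \<le> (1 + e') * qform Q x"
        using sym_psdD(3)[OF spd_imp_psd[OF Q] x] e' by (simp add: distrib_right)
      ultimately have "qform (step L + Q) x \<le> (1 + e') * qform (P (Suc k)) x"
        using T(2)[OF x] qS[OF x] by (simp add: distrib_left)
      also have "\<dots> \<le> (1 + e') * qform L x" using PL[OF x] e' by (intro mult_left_mono) auto
      finally show ?thesis using e'(2) by (simp add: distrib_right)
    qed
    thus "qform (step L + Q) x \<le> qform L x" by (rule field_le_epsilon)
  qed
  hence "L = step L + Q"
    by (intro qform_determines[OF L symL spdD(1,2)[OF T(1)]])
  thus ?thesis using spdL by (auto simp: riccati_solution_def)
qed

end

section \<open>Detectability and the full Riccati equation\<close>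

lemma pow_mat_commute:
  fixes A :: "'a :: comm_ring_1 mat"
  assumes A: "A \<in> carrier_mat m m"
  shows "A * A ^\<^sub>m k = A ^\<^sub>m k * A"
proof (induction k)
  case (Suc k)
  have "A * (A ^\<^sub>m k * A) = (A * A ^\<^sub>m k) * A"
    by (rule assoc_mult_mat[symmetric, of _ m m _ m _ m]) (use A in auto)
  thus ?case using Suc by simp
qed (use A in simp)

lemma pow_mat_smult:
  fixes A :: "'a :: comm_ring_1 mat"
  assumes A: "A \<in> carrier_mat m m"
  shows "(a \<cdot>\<^sub>m A) ^\<^sub>m k = a ^ k \<cdot>\<^sub>m A ^\<^sub>m k"
proof (induction k)
  case 0 thus ?case using A by (auto)
next
  case (Suc k)
  have "(a ^ k \<cdot>\<^sub>m A ^\<^sub>m k) * (a \<cdot>\<^sub>m A) = a \<cdot>\<^sub>m (a ^ k \<cdot>\<^sub>m (A ^\<^sub>m k * A))"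
    using A by (simp add: mult_smult_distrib[of _ m m _ m] mult_smult_assoc_mat[of _ m m _ m])
  also have "\<dots> = a ^ Suc k \<cdot>\<^sub>m (A ^\<^sub>m k * A)" by (auto simp: algebra_simps)
  finally show ?case using Suc by simp
qed

text \<open>Rescale \<open>A\<close> by a number \<open>q\<close> strictly between its spectral radius and \<open>1\<close>. The powers of the
  rescaled matrix are bounded by its Jordan normal form, so those of \<open>A\<close> decay like \<open>q\<^sup>k\<close>.\<close>

lemma stable_powers_vanish:
  fixes A :: "real mat"
  assumes A: "A \<in> carrier_mat m m" and m: "0 < m"
    and stable: "\<And>z. eigenvalue (map_mat complex_of_real A) z \<Longrightarrow> cmod z < 1" and e: "0 < e"
  shows "\<exists>k. \<forall>i<m. \<forall>j<m. \<bar>(A ^\<^sub>m k) $$ (i,j)\<bar> \<le> e"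
proof -
  let ?C = "map_mat complex_of_real A"
  have C: "?C \<in> carrier_mat m m" using A by simp
  define s where "s = spectral_radius ?C"
  have s_mem: "s \<in> cmod ` spectrum ?C" and s_max: "\<And>z. eigenvalue ?C z \<Longrightarrow> cmod z \<le> s"
    using spectral_radius_mem_max[OF C m] by (auto simp: s_def spectrum_def)
  have s: "0 \<le> s" "s < 1" using s_mem stable by (auto simp: spectrum_def)
  define q where "q = (1 + s) / 2"
  have q: "0 < q" "q < 1" "s < q" using s by (auto simp: q_def)
  define B where "B = complex_of_real (1/q) \<cdot>\<^sub>m ?C"
  have B: "B \<in> carrier_mat m m" using C by (simp add: B_def)
  have "spectral_radius B < 1"
  proof -
    obtain z where z: "eigenvalue B z" "spectral_radius B = cmod z"
      using spectral_radius_mem_max(1)[OF B m] by (auto simp: spectrum_def)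
    then obtain v where v: "v \<in> carrier_vec m" "v \<noteq> 0\<^sub>v m" "B *\<^sub>v v = z \<cdot>\<^sub>v v"
      using B by (auto simp: eigenvalue_def eigenvector_def)
    have Cv: "?C *\<^sub>v v = (of_real q * z) \<cdot>\<^sub>v v"
    proof -
      have "complex_of_real (1/q) \<cdot>\<^sub>v (?C *\<^sub>v v) = z \<cdot>\<^sub>v v"
        using v(3) C v(1) unfolding B_def by (auto intro!: eq_vecI simp: vec_eq_iff)
      hence "of_real q \<cdot>\<^sub>v (complex_of_real (1/q) \<cdot>\<^sub>v (?C *\<^sub>v v)) = of_real q \<cdot>\<^sub>v (z \<cdot>\<^sub>v v)" by simp
      thus ?thesis using q by (simp add: smult_smult_assoc)
    qed
    hence "eigenvalue ?C (of_real q * z)" using v C by (auto simp: eigenvalue_def eigenvector_def)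
    from s_max[OF this] q(1) have "q * cmod z \<le> s" by (simp add: norm_mult)
    hence "q * cmod z < q * 1" using q(3) by linarith
    thus ?thesis using q z mult_less_cancel_left_pos by metis
  qed
  moreover have "\<exists>n_as. jordan_nf B n_as"
    using char_poly_factorized[OF B] jordan_nf_exists[OF B] by blast
  ultimately obtain b where b: "\<And>k. norm_bound (B ^\<^sub>m k) b"
    using spectral_radius_jnf_norm_bound_less_1[OF B] by blast
  have bound: "\<bar>(A ^\<^sub>m k) $$ (i,j)\<bar> \<le> b * q ^ k" if ij: "i < m" "j < m" for i j k
  proof -
    have "(B ^\<^sub>m k) $$ (i,j) = of_real ((1/q) ^ k * (A ^\<^sub>m k) $$ (i,j))"
      using ij A C pow_mat_smult[OF C, of "complex_of_real (1/q)" k]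
        of_real_hom.mat_hom_pow[OF A, of k, where ?'a = complex, symmetric] by (simp add: B_def)
    moreover have "cmod ((B ^\<^sub>m k) $$ (i,j)) \<le> b"
      using b[of k] ij B by (auto simp: norm_bound_def)
    ultimately have "\<bar>(1/q) ^ k * (A ^\<^sub>m k) $$ (i,j)\<bar> \<le> b" by (metis norm_of_real)
    thus ?thesis using q by (simp add: abs_mult field_simps power_divide)
  qed
  have "(\<lambda>k. b * q ^ k) \<longlonglongrightarrow> b * 0" using q by (intro tendsto_mult LIMSEQ_realpow_zero tendsto_const) auto
  from order_tendstoD(2)[OF this, of e] e obtain k where "b * q ^ k < e"
    by (auto simp: eventually_sequentially)
  thus ?thesis using bound by (meson less_imp_le order_trans)
qed

lemma qform_smult:
  "A \<in> carrier_mat m m \<Longrightarrow> x \<in> carrier_vec m \<Longrightarrow> qform (a \<cdot>\<^sub>m A) x = a * qform A x"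
  by (simp add: qform_sum[of _ m] sum_distrib_left algebra_simps)

lemma qform_zero_mat: "x \<in> carrier_vec m \<Longrightarrow> qform (0\<^sub>m m m) x = 0"
  by (simp add: qform_sum[of _ m])

lemma qform_one: "x \<in> carrier_vec m \<Longrightarrow> qform (1\<^sub>m m) x = x \<bullet> x"
  by (simp add: qform_def)

lemma qform_scaled_identity: "x \<in> carrier_vec m \<Longrightarrow> qform (b \<cdot>\<^sub>m 1\<^sub>m m) x = b * (x \<bullet> x)"
  using qform_smult[OF one_carrier_mat] qform_one by metis

lemma scaled_identity_spd:
  assumes "0 < b" shows "spd m (b \<cdot>\<^sub>m 1\<^sub>m m)"
proof (rule spdI)
  fix x :: "real vec" assume x: "x \<in> carrier_vec m" "x \<noteq> 0\<^sub>v m"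
  obtain k where k: "k < m" "x $ k \<noteq> 0" using x by (metis carrier_vecD eq_vecI index_zero_vec)
  have "0 < (x $ k)\<^sup>2" using k by simp
  also have "\<dots> \<le> x \<bullet> x" unfolding vec_sq_sum[OF x(1)] using k(1) by (intro member_le_sum) auto
  finally show "0 < qform (b \<cdot>\<^sub>m 1\<^sub>m m) x" using assms qform_scaled_identity[OF x(1)] by simp
qed auto

text \<open>The partial sum of the series \<open>\<Sum>\<^sub>j A\<^sup>j (A\<^sup>j)\<^sup>T\<close>, whose limit solves the Lyapunov
  equation.\<close>

primrec gramian :: "real mat \<Rightarrow> nat \<Rightarrow> real mat" where
  "gramian A 0 = 0\<^sub>m (dim_row A) (dim_row A)"
| "gramian A (Suc k) = gramian A k + A ^\<^sub>m k * 1\<^sub>m (dim_row A) * transpose_mat (A ^\<^sub>m k)"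

text \<open>A strict Lyapunov inequality needs only a finite part of that series: passing from \<open>x\<close> to
  \<open>A\<^sup>T x\<close> shifts the sum, which loses the first term \<open>x \<bullet> x\<close> and gains a term that is small
  once the power of \<open>A\<close> is small.\<close>

lemma stable_lyapunov:
  fixes A :: "real mat"
  assumes A: "A \<in> carrier_mat m m" and m: "0 < m"
    and stable: "\<And>z. eigenvalue (map_mat complex_of_real A) z \<Longrightarrow> cmod z < 1"
  shows "\<exists>X. sym_psd m X \<and>
    (\<forall>x \<in> carrier_vec m. qform X (transpose_mat A *\<^sub>v x) + (x \<bullet> x) / 2 \<le> qform X x)"
proof -
  have dA: "dim_row A = m" using A by simp
  let ?N = "\<lambda>k x. (transpose_mat (A ^\<^sub>m k) *\<^sub>v x) \<bullet> (transpose_mat (A ^\<^sub>m k) *\<^sub>v x)"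
  have Ak: "A ^\<^sub>m k \<in> carrier_mat m m" for k using A by simp
  note one = one_carrier_mat[of m, where ?'a = real]
  have inc: "A ^\<^sub>m k * 1\<^sub>m m * transpose_mat (A ^\<^sub>m k) \<in> carrier_mat m m" for k
    by (metis Ak one mult_carrier_mat transpose_carrier_mat)
  have inc_q: "qform (A ^\<^sub>m k * 1\<^sub>m m * transpose_mat (A ^\<^sub>m k)) x = ?N k x"
    if "x \<in> carrier_vec m" for k x
    using qform_congruence[OF Ak one that, of k] Ak[of k] that
    by (subst qform_one[symmetric, of _ m]) auto
  have G: "sym_psd m (gramian A k)" for k
  proof (induction k)
    case 0
    show ?case using dA by (auto simp: sym_psd_def qform_zero_mat)
  next
    case (Suc k)
    show ?case using sym_psdD[OF Suc] inc[of k] inc_q[of _ k] vec_sq_nonneg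
        symmetric_congruence[OF Ak[of k] one]
      by (auto simp: sym_psd_def dA qform_add[of _ m] transpose_add[of _ m m])
  qed
  have shift: "transpose_mat (A ^\<^sub>m k) *\<^sub>v (transpose_mat A *\<^sub>v x) = transpose_mat (A ^\<^sub>m Suc k) *\<^sub>v x"
    if x: "x \<in> carrier_vec m" for k x
  proof -
    have "transpose_mat (A ^\<^sub>m Suc k) = transpose_mat (A * A ^\<^sub>m k)"
      using pow_mat_commute[OF A, of k] by simp
    also have "\<dots> = transpose_mat (A ^\<^sub>m k) * transpose_mat A" by (rule transpose_mult[OF A Ak])
    finally show ?thesis using Ak[of k] A x assoc_mult_mat_vec[of "transpose_mat (A ^\<^sub>m k)" m m "transpose_mat A" m x]
      by simp
  qed
  have telescope: "qform (gramian A k) (transpose_mat A *\<^sub>v x) + x \<bullet> x = qform (gramian A k) x + ?N k x"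
    if x: "x \<in> carrier_vec m" for k x
  proof (induction k)
    case 0
    have "transpose_mat A *\<^sub>v x \<in> carrier_vec m" using A x by simp
    thus ?case using x dA by (simp add: qform_zero_mat)
  next
    case (Suc k)
    have Ax: "transpose_mat A *\<^sub>v x \<in> carrier_vec m" using A x by simp
    show ?case using Suc sym_psdD(1)[OF G[of k]] inc[of k]
      by (simp only: gramian.simps dA qform_add[OF _ _ Ax] qform_add[OF _ _ x] inc_q[OF Ax] inc_q[OF x] shift[OF x])
  qed
  obtain k where k: "\<And>i j. i < m \<Longrightarrow> j < m \<Longrightarrow> \<bar>(A ^\<^sub>m k) $$ (i,j)\<bar> \<le> 1 / (2 * m)"
    using stable_powers_vanish[OF A m stable, of "1 / (2 * m)"] m by auto
  have small: "?N k x \<le> (x \<bullet> x) / 2" if x: "x \<in> carrier_vec m" for x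
  proof -
    have Tx: "transpose_mat (A ^\<^sub>m k) *\<^sub>v x \<in> carrier_vec m" using Ak[of k] x by simp
    have "?N k x = (\<Sum>j<m. (\<Sum>i<m. (A ^\<^sub>m k) $$ (i,j) * x $ i)\<^sup>2)"
      unfolding vec_sq_sum[OF Tx] using Ak[of k] A x
      by (intro sum.cong) (auto simp: scalar_prod_def atLeast0LessThan)
    also have "\<dots> \<le> (\<Sum>j<m. (\<Sum>i<m. ((A ^\<^sub>m k) $$ (i,j))\<^sup>2) * (\<Sum>i<m. (x $ i)\<^sup>2))"
      by (intro sum_mono sum_cauchy_schwarz)
    also have "\<dots> \<le> (\<Sum>j<m. (\<Sum>i<m. (1 / (2 * m))\<^sup>2) * (\<Sum>i<m. (x $ i)\<^sup>2))"
      using k by (intro sum_mono mult_right_mono sum_nonneg) (auto intro!: abs_le_square_iff[THEN iffD1])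
    also have "\<dots> = (x \<bullet> x) / 4"
      unfolding vec_sq_sum[OF x, symmetric] using m by (simp add: power2_eq_square field_simps)
    also have "\<dots> \<le> (x \<bullet> x) / 2" using vec_sq_nonneg[of x] by simp
    finally show ?thesis .
  qed
  show ?thesis
  proof (intro exI[of _ "gramian A k"] conjI ballI G)
    fix x :: "real vec" assume x: "x \<in> carrier_vec m"
    show "qform (gramian A k) (transpose_mat A *\<^sub>v x) + (x \<bullet> x) / 2 \<le> qform (gramian A k) x"
      using telescope[OF x, of k] small[OF x] by (simp add: field_simps)
  qed
qed

text \<open>The predicted covariance of the filter with a stabilising but suboptimal gain \<open>L\<close> dominates that
  of the Kalman filter, so a multiple of the Lyapunov matrix of \<open>F - L H\<close> is a supersolution of
  the Riccati equation.\<close>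

lemma (in riccati) full_solution_exists:
  assumes c: "c = 0" and m: "0 < m" and det: "detectable F H" and Q: "spd m Q"
  shows "\<exists>P. riccati_solution Q P"
proof -
  note R' = spdD[OF R] and Q' = spdD[OF Q]
  obtain L where L: "L \<in> carrier_mat m p"
    and stable: "\<And>z. eigenvalue (map_mat complex_of_real (F - L * H)) z \<Longrightarrow> cmod z < 1"
    using det F H by (auto simp: detectable_def)
  have A: "F - L * H \<in> carrier_mat m m" using F L H by auto
  obtain X where X: "sym_psd m X" and lyap: "\<And>x. x \<in> carrier_vec m \<Longrightarrow>
     qform X (transpose_mat (F - L * H) *\<^sub>v x) + (x \<bullet> x) / 2 \<le> qform X x"
    using stable_lyapunov[OF A m stable] by blast
  have LRL: "L * R * transpose_mat L \<in> carrier_mat m m" using L R' by auto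
  \<comment> \<open>The gain of half of \<open>\<kappa> (x \<bullet> x)\<close> in the Lyapunov inequality must pay for both noise terms.\<close>
  define \<kappa> where "\<kappa> = 2 * (frob_norm (L * R * transpose_mat L) + frob_norm Q)"
  have \<kappa>: "0 \<le> \<kappa>" using frob_norm_nonneg by (simp add: \<kappa>_def)
  define Y where "Y = \<kappa> \<cdot>\<^sub>m X"
  have qY: "qform Y x = \<kappa> * qform X x" if "x \<in> carrier_vec m" for x
    using qform_smult[OF sym_psdD(1)[OF X] that] by (simp add: Y_def)
  have "transpose_mat Y = \<kappa> \<cdot>\<^sub>m transpose_mat X" by (auto simp: Y_def)
  hence Y: "sym_psd m Y"
    unfolding sym_psd_def using sym_psdD[OF X] qY \<kappa> by (auto simp: Y_def)
  show ?thesis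
  proof (rule riccati_solution_exists[OF Q Y])
    fix x :: "real vec" assume x: "x \<in> carrier_vec m"
    have Lx: "transpose_mat L *\<^sub>v x \<in> carrier_vec p" using L x by simp
    have LH: "L * H \<in> carrier_mat m m" using L H by auto
    have Ax: "transpose_mat (F - L * H) *\<^sub>v x
        = transpose_mat F *\<^sub>v x - transpose_mat H *\<^sub>v (transpose_mat L *\<^sub>v x)"
      using transpose_minus[OF F LH] transpose_mult[OF L H] F H L x
      by (simp add: minus_mult_distrib_mat_vec[of _ m m])
    have Axc: "transpose_mat (F - L * H) *\<^sub>v x \<in> carrier_vec m" using A x by simp
    have "qform (step Y) x = qform (meas_update H R Y) (transpose_mat F *\<^sub>v x)"
      using qform_step[OF Y x] by (simp add: c block_proj_0)
    also have "\<dots> \<le> qform Y (transpose_mat (F - L * H) *\<^sub>v x) + qform R (transpose_mat L *\<^sub>v x)"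
      using meas_update_le[OF Y FT_vec[OF x] Lx] Ax by simp
    finally have 1: "qform (step Y) x
       \<le> \<kappa> * qform X (transpose_mat (F - L * H) *\<^sub>v x) + qform R (transpose_mat L *\<^sub>v x)"
      using qY[OF Axc] by simp
    have 2: "qform R (transpose_mat L *\<^sub>v x) \<le> frob_norm (L * R * transpose_mat L) * (x \<bullet> x)"
      using qform_congruence[OF L R'(1) x] qform_le_frob_norm[OF LRL x] by simp
    have 3: "qform Q x \<le> frob_norm Q * (x \<bullet> x)" by (rule qform_le_frob_norm[OF Q'(1) x])
    have 4: "\<kappa> * (qform X (transpose_mat (F - L * H) *\<^sub>v x) + (x \<bullet> x) / 2) \<le> qform Y x"
      using mult_left_mono[OF lyap[OF x] \<kappa>] qY[OF x] by simp
    have "\<kappa> * ((x \<bullet> x) / 2) = frob_norm (L * R * transpose_mat L) * (x \<bullet> x) + frob_norm Q * (x \<bullet> x)"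
      by (simp add: \<kappa>_def algebra_simps)
    thus "qform (step Y) x + qform Q x \<le> qform Y x"
      using 1 2 3 4[unfolded distrib_left] by linarith
  qed
qed

section \<open>Systems with block structure\<close>

definition block_struct :: "nat \<Rightarrow> nat \<Rightarrow> real mat \<Rightarrow> bool" where
  "block_struct a b A \<longleftrightarrow>
     (\<forall>k<dim_row A. \<forall>l<dim_col A. k div a \<noteq> l div b \<longrightarrow> A $$ (k,l) = 0)"

lemma block_struct_transpose_bpart:
  assumes A: "A \<in> carrier_mat r s" "block_struct a b A" and x: "x \<in> carrier_vec r"
  shows "transpose_mat A *\<^sub>v bpart a i x = bpart b i (transpose_mat A *\<^sub>v x)"
proof (rule eq_vecI)
  fix l assume "l < dim_vec (bpart b i (transpose_mat A *\<^sub>v x))"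
  hence l: "l < s" using A(1) by (simp add: bpart_def)
  have e: "A $$ (k,l) = 0" if "k < r" "k div a \<noteq> l div b" for k
    using A that l by (auto simp: block_struct_def)
  have "(transpose_mat A *\<^sub>v bpart a i x) $ l = (\<Sum>k<r. A $$ (k,l) * (if k div a = i then x $ k else 0))"
    using A(1) x l by (auto simp: scalar_prod_def bpart_def atLeast0LessThan intro!: sum.cong)
  also have "\<dots> = (\<Sum>k<r. if l div b = i then A $$ (k,l) * x $ k else 0)"
    using e by (intro sum.cong) auto
  also have "\<dots> = bpart b i (transpose_mat A *\<^sub>v x) $ l"
    using A(1) x l by (auto simp: scalar_prod_def bpart_def atLeast0LessThan intro!: sum.cong)
  finally show "(transpose_mat A *\<^sub>v bpart a i x) $ l = bpart b i (transpose_mat A *\<^sub>v x) $ l" .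
qed (use A(1) in \<open>simp add: bpart_def\<close>)

lemma block_struct_block_proj: "A \<in> carrier_mat m m \<Longrightarrow> block_struct a a A \<Longrightarrow> block_proj a A = A"
  by (auto simp: block_struct_def block_proj_def)

lemma bpart_minus: "x \<in> carrier_vec m \<Longrightarrow> y \<in> carrier_vec m \<Longrightarrow>
   bpart a i (x - y) = bpart a i x - bpart a i y"
  by (auto simp: bpart_def)

lemma tr_block_proj: "A \<in> carrier_mat m m \<Longrightarrow> tr (block_proj a A) = tr A"
  by (auto simp: tr_def block_proj_def)

lemma block_proj_idem: "block_proj a (block_proj a A) = block_proj a A"
  by (auto simp: block_proj_def)

text \<open>State blocks have size \<open>c\<close>, measurement blocks size \<open>d\<close>, and \<open>n\<close> bounds the number of
  blocks. The process noise may still couple the blocks.\<close>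

locale block_riccati = riccati +
  fixes d n :: nat
  assumes m_pos: "0 < m" and det: "detectable F H"
    and div_m: "\<And>k. k < m \<Longrightarrow> k div c < n" and div_p: "\<And>k. k < p \<Longrightarrow> k div d < n"
    and F_block: "block_struct c c F" and H_block: "block_struct d c H" and R_block: "block_struct d d R"
begin

sublocale full: riccati m p H R 0 F
  by unfold_locales (rule F)

lemma qform_parts:
  "A \<in> carrier_mat m m \<Longrightarrow> x \<in> carrier_vec m \<Longrightarrow>
    qform (block_proj c A) x = (\<Sum>i<n. qform A (bpart c i x))"
  by (rule qform_block_proj[OF _ _ div_m])

lemma FT_bpart: "x \<in> carrier_vec m \<Longrightarrow>
    transpose_mat F *\<^sub>v bpart c i x = bpart c i (transpose_mat F *\<^sub>v x)"
  by (rule block_struct_transpose_bpart[OF F F_block])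

lemma HT_bpart: "k \<in> carrier_vec p \<Longrightarrow>
    transpose_mat H *\<^sub>v bpart d i k = bpart c i (transpose_mat H *\<^sub>v k)"
  by (rule block_struct_transpose_bpart[OF H H_block])

lemma qform_R_parts: "k \<in> carrier_vec p \<Longrightarrow> qform R k = (\<Sum>i<n. qform R (bpart d i k))"
  using qform_block_proj[OF spdD(1)[OF R] _ div_p] block_struct_block_proj[OF spdD(1)[OF R] R_block]
  by simp

text \<open>Operator concavity of the update under the block-diagonal projection: the optimal weight for the
  projected covariance, cut into its blocks, is an admissible weight for each block part of \<open>x\<close>.\<close>

lemma pinching:
  assumes Y: "sym_psd m Y" and x: "x \<in> carrier_vec m"
  shows "qform (block_proj c (meas_update H R Y)) x \<le> qform (meas_update H R (block_proj c Y)) x"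
proof -
  note Y' = sym_psdD[OF Y] and DY = block_proj_psd[OF Y, of c]
  let ?k = "opt_gain (block_proj c Y) x"
  note k = opt_gain_carrier[OF DY x]
  let ?z = "x - transpose_mat H *\<^sub>v ?k"
  have z: "?z \<in> carrier_vec m" using x HT_vec[OF k] by simp
  have "qform (block_proj c (meas_update H R Y)) x = (\<Sum>i<n. qform (meas_update H R Y) (bpart c i x))"
    by (rule qform_block_proj[OF meas_update_carrier[OF Y] x div_m])
  also have "\<dots> \<le> (\<Sum>i<n. qform Y (bpart c i ?z) + qform R (bpart d i ?k))"
    using meas_update_le[OF Y bpart_carrier[OF x] bpart_carrier[OF k], of c _ d]
    by (intro sum_mono) (simp add: HT_bpart[OF k] bpart_minus[OF x HT_vec[OF k]])
  also have "\<dots> = qform (block_proj c Y) ?z + qform R ?k"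
    by (simp add: sum.distrib qform_block_proj[OF Y'(1) z div_m] qform_R_parts[OF k])
  finally show ?thesis by (simp add: meas_update_attained[OF DY x])
qed

lemma meas_update_block_diag:
  assumes P: "sym_psd m P" and diag: "block_proj c P = P"
  shows "block_proj c (meas_update H R P) = meas_update H R P"
proof -
  note U = sym_psdD[OF meas_update_psd[OF P]]
  have "loewner_le m (block_proj c (meas_update H R P)) (meas_update H R P)"
    using pinching[OF P] diag by (simp add: loewner_le_def)
  from loewner_trace_rigid[OF U(1,2) block_proj_carrier[OF U(1)] block_proj_symmetric[OF U(1,2)] this]
  show ?thesis using tr_block_proj[OF U(1)] by simp
qed

lemma block_proj_congruence:
  assumes A: "A \<in> carrier_mat m m" and x: "x \<in> carrier_vec m"
  shows "qform (block_proj c (F * A * transpose_mat F)) x = qform (block_proj c A) (transpose_mat F *\<^sub>v x)"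
proof -
  have FAF: "F * A * transpose_mat F \<in> carrier_mat m m" using F A by auto
  show ?thesis
    by (simp add: qform_parts[OF FAF x] qform_parts[OF A FT_vec[OF x]] qform_congruence[OF F A bpart_carrier[OF x]] FT_bpart[OF x])
qed

lemma block_proj_full_step:
  assumes P: "sym_psd m P" and x: "x \<in> carrier_vec m"
  shows "qform (block_proj c (full.step P)) x = qform (step P) x"
  using block_proj_congruence[OF meas_update_carrier[OF P] x] qform_step[OF P x]
  by (simp add: full.step_def block_proj_0)

lemma step_le_full_step:
  assumes P: "sym_psd m P" and x: "x \<in> carrier_vec m"
  shows "qform (step P) x \<le> qform (full.step (block_proj c P)) x"
  using pinching[OF P FT_vec[OF x]]
  by (simp add: qform_step[OF P x] full.qform_step[OF block_proj_psd[OF P] x] block_proj_0)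

text \<open>By pinching, the block-diagonal part of the solution is a subsolution of the same equation, hence
  lies below the solution; having the same trace, it is equal to it.\<close>

lemma full_solution_block_diag:
  assumes Q: "spd m Q" "block_proj c Q = Q" and P: "full.riccati_solution Q P"
  shows "block_proj c P = P"
proof -
  note D = full.riccati_solutionD[OF P spdD(1)[OF Q(1)]]
  note P' = sym_psdD[OF D(2)] and DP = block_proj_psd[OF D(2), of c]
  have S: "full.step P \<in> carrier_mat m m" by (rule full.step_carrier[OF D(2)])
  have "block_proj c (full.step P + Q) = block_proj c (full.step P) + block_proj c Q"
    by (rule block_proj_add[OF S spdD(1)[OF Q(1)]])
  hence DPeq: "block_proj c P = block_proj c (full.step P) + Q" using D(3) Q(2) by simp
  have "qform (block_proj c P) x \<le> qform P x" if x: "x \<in> carrier_vec m" for x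
  proof (rule full.riccati_comparison_exact[OF DP D(1) Q(1) _ _ x])
    fix x :: "real vec" assume x: "x \<in> carrier_vec m"
    show "qform (full.step P) x + qform Q x \<le> qform P x" using D(4)[OF x] by simp
    have "qform (block_proj c P) x = qform (step P) x + qform Q x"
      unfolding DPeq using qform_add[OF block_proj_carrier[OF S] spdD(1)[OF Q(1)] x]
        block_proj_full_step[OF D(2) x] by simp
    thus "qform (block_proj c P) x \<le> qform (full.step (block_proj c P)) x + qform Q x"
      using step_le_full_step[OF D(2) x] by simp
  qed
  hence "loewner_le m (block_proj c P) P" by (simp add: loewner_le_def)
  from loewner_trace_rigid[OF P'(1,2) sym_psdD(1,2)[OF DP] this] tr_block_proj[OF P'(1)]
  show ?thesis by simp
qed

lemma full_solution_is_block_solution: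
  assumes Q: "spd m Q" "block_proj c Q = Q" and P: "full.riccati_solution Q P"
  shows "riccati_solution Q P"
proof -
  note D = full.riccati_solutionD[OF P spdD(1)[OF Q(1)]]
  have "step P = full.step P"
    using meas_update_block_diag[OF D(2) full_solution_block_diag[OF Q P]]
    by (simp add: step_def full.step_def block_proj_0)
  thus ?thesis using P by (simp add: riccati_solution_def full.riccati_solution_def)
qed

text \<open>A multiple of the identity dominates \<open>Q\<close> and is block diagonal, so the full Riccati solution
  for it solves the projected equation too and is a supersolution for \<open>Q\<close>. Detectability therefore
  enters only through the full filter.\<close>

lemma solution_exists:
  assumes Q: "spd m Q" shows "\<exists>P. riccati_solution Q P"
proof -
  define b where "b = frob_norm Q + 1"
  have b: "0 < b" using frob_norm_nonneg[of Q] by (simp add: b_def)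
  let ?B = "b \<cdot>\<^sub>m 1\<^sub>m m :: real mat"
  note B = scaled_identity_spd[OF b, of m]
  have "block_proj c ?B = ?B" by (auto simp: block_proj_def)
  moreover obtain P where "full.riccati_solution ?B P"
    using full.full_solution_exists[OF refl m_pos det B] by blast
  ultimately have "riccati_solution ?B P" using full_solution_is_block_solution[OF B] by blast
  note D = riccati_solutionD[OF this spdD(1)[OF B]]
  show ?thesis
  proof (rule riccati_solution_exists[OF Q D(2)])
    fix x :: "real vec" assume x: "x \<in> carrier_vec m"
    have "qform Q x \<le> b * (x \<bullet> x)"
      using qform_le_frob_norm[OF spdD(1)[OF Q] x] vec_sq_nonneg[of x] by (simp add: b_def distrib_right)
    also have "\<dots> = qform ?B x" using qform_scaled_identity[OF x] by simp
    finally show "qform (step P) x + qform Q x \<le> qform P x" using D(4)[OF x] by simp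
  qed
qed

lemma bd_pred_is_solution:
  assumes "spd m Q" shows "riccati_solution Q (bd_pred c F H R Q)"
  using solution_exists[OF assms] bd_pred_solution[OF assms] by auto

lemma kf_pred_is_solution:
  assumes "spd m Q" shows "full.riccati_solution Q (kf_pred F H R Q)"
  unfolding kf_pred_eq_bd
  using full.full_solution_exists[OF refl m_pos det assms] full.bd_pred_solution[OF assms] by auto

lemma kf_pred_block_diag:
  assumes Q: "spd m Q" "block_proj c Q = Q"
  shows "block_proj c (kf_pred F H R Q) = kf_pred F H R Q" "bd_pred c F H R Q = kf_pred F H R Q"
  using full_solution_block_diag[OF Q kf_pred_is_solution[OF Q(1)]]
    bd_pred_solution[OF Q(1) full_solution_is_block_solution[OF Q kf_pred_is_solution[OF Q(1)]]] by auto

end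

section \<open>Perturbation of the prediction and of the closed loop\<close>

lemma mat_diff_cancel_right:
  fixes A :: "real mat"
  shows "A \<in> carrier_mat m p \<Longrightarrow> B \<in> carrier_mat m p \<Longrightarrow> C \<in> carrier_mat m p \<Longrightarrow>
    (A - B) - (C - B) = A - C"
  by (intro eq_matI) auto

lemma mat_diff_cancel_left:
  fixes A :: "real mat"
  shows "A \<in> carrier_mat m p \<Longrightarrow> B \<in> carrier_mat m p \<Longrightarrow> C \<in> carrier_mat m p \<Longrightarrow>
    (A - B) - (A - C) = C - B"
  by (intro eq_matI) auto

context measurement begin

lemma gain_innov:
  assumes P: "sym_psd m P"
  shows "gain H R P \<in> carrier_mat m p" "gain H R P * innov P = P * transpose_mat H"
proof -
  note P' = sym_psdD[OF P] and I = minv_spd_inverse[OF innov_spd[OF P]] and S = innov_carrier[OF sym_psdD(1)[OF P]]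
  have PH: "P * transpose_mat H \<in> carrier_mat m p" using P' H by auto
  show "gain H R P \<in> carrier_mat m p" using PH I(1) unfolding gain_def by auto
  have "gain H R P * innov P = P * transpose_mat H * (minv (innov P) * innov P)"
    unfolding gain_def by (rule assoc_mult_mat[OF PH I(1) S])
  also have "\<dots> = P * transpose_mat H" unfolding I(3) by (rule right_mult_one_mat[OF PH])
  finally show "gain H R P * innov P = P * transpose_mat H" .
qed

lemma gain_diff:
  assumes P: "sym_psd m P" and P': "sym_psd m P'"
  shows "gain H R P' - gain H R P
    = (1\<^sub>m m - gain H R P * H) * ((P' - P) * transpose_mat H) * minv (innov P')"
proof -
  let ?K = "gain H R P" and ?K' = "gain H R P'" and ?Ht = "transpose_mat H"
  let ?S = "innov P" and ?S' = "innov P'"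
  note g = gain_innov[OF P] and g' = gain_innov[OF P'] and cP = sym_psdD(1)[OF P] and cP' = sym_psdD(1)[OF P']
  note I' = minv_spd_inverse[OF innov_spd[OF P']] and S = innov_carrier[OF cP] and S' = innov_carrier[OF cP']
  have E: "(P' - P) * ?Ht = P' * ?Ht - P * ?Ht" by (rule minus_mult_distrib_mat[OF cP' cP HT])
  have PH: "P * ?Ht \<in> carrier_mat m p" "P' * ?Ht \<in> carrier_mat m p" using cP cP' HT by auto
  have EH: "(P' - P) * ?Ht \<in> carrier_mat m p" unfolding E by (rule minus_carrier_mat[OF PH(1)])
  have HEH: "H * ((P' - P) * ?Ht) = ?S' - ?S"
  proof -
    have "H * ((P' - P) * ?Ht) = H * (P' * ?Ht) - H * (P * ?Ht)"
      unfolding E by (rule mult_minus_distrib_mat[OF H PH(2,1)])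
    also have "\<dots> = H * P' * ?Ht - H * P * ?Ht"
      using assoc_mult_mat[OF H cP' HT] assoc_mult_mat[OF H cP HT] by simp
    also have "\<dots> = ?S' - ?S"
    proof -
      have "H * P' * ?Ht \<in> carrier_mat p p" "H * P * ?Ht \<in> carrier_mat p p" using H cP cP' by auto
      thus ?thesis using spdD(1)[OF R] by (intro eq_matI) auto
    qed
    finally show ?thesis .
  qed
  have KH: "?K * H \<in> carrier_mat m m" using g H by auto
  have "(1\<^sub>m m - ?K * H) * ((P' - P) * ?Ht) = 1\<^sub>m m * ((P' - P) * ?Ht) - ?K * H * ((P' - P) * ?Ht)"
    by (rule minus_mult_distrib_mat[OF one_carrier_mat KH EH])
  also have "\<dots> = (P' * ?Ht - P * ?Ht) - ?K * (?S' - ?S)"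
    by (simp only: left_mult_one_mat[OF EH] assoc_mult_mat[OF g(1) H EH] HEH) (simp only: E)
  also have "?K * (?S' - ?S) = ?K * ?S' - P * ?Ht"
    using mult_minus_distrib_mat[OF g(1) S' S] g(2) by simp
  also have "(P' * ?Ht - P * ?Ht) - (?K * ?S' - P * ?Ht) = P' * ?Ht - ?K * ?S'"
  proof -
    have "?K * ?S' \<in> carrier_mat m p" using g(1) S' by auto
    thus ?thesis by (rule mat_diff_cancel_right[OF PH(2,1)])
  qed
  also have "\<dots> = (?K' - ?K) * ?S'"
    using minus_mult_distrib_mat[OF g'(1) g(1) S'] g'(2) by simp
  finally have "(1\<^sub>m m - ?K * H) * ((P' - P) * ?Ht) * minv ?S' = (?K' - ?K) * ?S' * minv ?S'" by simp
  also have "\<dots> = (?K' - ?K) * (?S' * minv ?S')"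
    by (rule assoc_mult_mat[of _ m p _ p _ p]) (use g g' S' I' in auto)
  also have "\<dots> = ?K' - ?K" unfolding I'(2) by (rule right_mult_one_mat[of _ m]) (use g in auto)
  finally show ?thesis by simp
qed

text \<open>The innovation covariance dominates \<open>R\<close>, so its inverse is bounded independently of \<open>P\<close>.
  This makes the gain globally Lipschitz around a fixed covariance.\<close>

lemma frob_norm_minv_innov_le:
  assumes "sym_psd m P" shows "frob_norm (minv (innov P)) \<le> tr (minv R)"
proof -
  note S = innov_spd[OF assms] and P = sym_psdD[OF assms]
  have "loewner_le p R (innov P)"
    unfolding loewner_le_def using qform_innov[OF P(1)] P(3) HT_vec by simp
  hence le: "loewner_le p (minv (innov P)) (minv R)" by (rule minv_antimono[OF R S])
  have "frob_norm (minv (innov P)) \<le> tr (minv (innov P))"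
    by (rule frob_norm_le_tr[OF spd_imp_psd[OF minv_spd[OF S]]])
  also have "\<dots> \<le> 1 * tr (minv R)"
    using le by (intro tr_mono[OF minv_spd_inverse(1)[OF S] minv_spd_inverse(1)[OF R]]) (simp add: loewner_le_def)
  finally show ?thesis by simp
qed

end

context riccati begin

lemma closed_loop_lipschitz:
  assumes P: "sym_psd m P"
  obtains M where "0 \<le> M" "\<And>P'. sym_psd m P' \<Longrightarrow>
     frob_norm (closed_loop F H R P' - closed_loop F H R P) \<le> M * frob_norm (P' - P)"
proof -
  let ?T = "1\<^sub>m m - gain H R P * H"
  define M where "M = frob_norm ?T * (frob_norm (transpose_mat H) * tr (minv R) * frob_norm (H * F))"
  have trR: "0 \<le> tr (minv R)" by (rule frob_norm_le_tr(2)[OF spd_imp_psd[OF minv_spd[OF R]]])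
  have "0 \<le> M" unfolding M_def by (intro mult_nonneg_nonneg frob_norm_nonneg trR)
  moreover have "frob_norm (closed_loop F H R P' - closed_loop F H R P) \<le> M * frob_norm (P' - P)"
    if P': "sym_psd m P'" for P'
  proof -
    note g = gain_innov(1)[OF P] and g' = gain_innov(1)[OF P'] and cP = sym_psdD(1)[OF P] and cP' = sym_psdD(1)[OF P']
    let ?K = "gain H R P" and ?K' = "gain H R P'" and ?E = "P' - P" and ?I = "minv (innov P')"
    have dF: "dim_row F = m" using F by simp
    have HF: "H * F \<in> carrier_mat p m" using H F by auto
    have KHF: "closed_loop F H R X = F - gain H R X * (H * F)" if "sym_psd m X" for X
    proof -
      note gX = gain_innov(1)[OF that]
      have "gain H R X * H \<in> carrier_mat m m" using gX H by auto
      from minus_mult_distrib_mat[OF one_carrier_mat this F]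
      show ?thesis unfolding closed_loop_def dF using assoc_mult_mat[OF gX H F] F by simp
    qed
    have c: "?K * (H * F) \<in> carrier_mat m m" "?K' * (H * F) \<in> carrier_mat m m" using g g' HF by auto
    have cl: "closed_loop F H R P' \<in> carrier_mat m m" "closed_loop F H R P \<in> carrier_mat m m"
      unfolding KHF[OF P] KHF[OF P'] by (rule minus_carrier_mat[OF c(2)], rule minus_carrier_mat[OF c(1)])
    have "closed_loop F H R P - closed_loop F H R P' = ?K' * (H * F) - ?K * (H * F)"
      unfolding KHF[OF P] KHF[OF P'] by (rule mat_diff_cancel_left[OF F c])
    also have "\<dots> = (?K' - ?K) * (H * F)" by (rule minus_mult_distrib_mat[OF g' g HF, symmetric])
    finally have "frob_norm (closed_loop F H R P' - closed_loop F H R P) = frob_norm ((?K' - ?K) * (H * F))"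
      using frob_norm_minus_commute[OF cl] by simp
    also have "\<dots> \<le> frob_norm (?K' - ?K) * frob_norm (H * F)"
      by (rule frob_norm_mult[OF _ HF]) (use g g' in auto)
    also have "frob_norm (?K' - ?K) \<le> frob_norm ?T * (frob_norm ?E * frob_norm (transpose_mat H)) * tr (minv R)"
    proof -
      have T: "?T \<in> carrier_mat m m" using g H by auto
      have E: "?E \<in> carrier_mat m m" using cP cP' by auto
      have EH: "?E * transpose_mat H \<in> carrier_mat m p" using E H by auto
      have TEH: "?T * (?E * transpose_mat H) \<in> carrier_mat m p" using T EH by auto
      have "frob_norm (?K' - ?K) \<le> frob_norm (?T * (?E * transpose_mat H)) * frob_norm ?I"
        unfolding gain_diff[OF P P']
        by (rule frob_norm_mult[OF TEH minv_spd_inverse(1)[OF innov_spd[OF P']]])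
      also have "\<dots> \<le> frob_norm (?T * (?E * transpose_mat H)) * tr (minv R)"
        by (intro mult_left_mono frob_norm_minv_innov_le[OF P'] frob_norm_nonneg)
      also have "\<dots> \<le> (frob_norm ?T * (frob_norm ?E * frob_norm (transpose_mat H))) * tr (minv R)"
        by (intro mult_right_mono trR order_trans[OF frob_norm_mult[OF T EH]] mult_left_mono
            frob_norm_mult[OF E HT] frob_norm_nonneg)
      finally show ?thesis .
    qed
    finally show ?thesis by (simp add: M_def mult_ac frob_norm_nonneg mult_right_mono)
  qed
  ultimately show thesis by (rule that)
qed

end

context block_riccati begin

text \<open>With \<open>W \<le> s V\<close> for \<open>s\<close> proportional to the norm of \<open>W\<close>, the new solution satisfies the
  old equation up to the factor \<open>1 + s\<close>, and the comparison principle yields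
  \<open>P \<le> P1 \<le> (1 + O(s)) P\<close>.\<close>

lemma bd_pred_perturbation:
  assumes V: "spd m V"
  obtains \<delta> M where "0 < \<delta>" "0 < M" "\<And>W. sym_psd m W \<Longrightarrow> frob_norm W \<le> \<delta> \<Longrightarrow>
     frob_norm (bd_pred c F H R (V + W) - bd_pred c F H R V) \<le> M * frob_norm W \<and>
     frob_norm (bd_cl c F H R (V + W) - bd_cl c F H R V) \<le> M * frob_norm W"
proof -
  note V' = spdD[OF V]
  define P where "P = bd_pred c F H R V"
  note D = riccati_solutionD[OF bd_pred_is_solution[OF V] V'(1), folded P_def]
  note P' = spdD[OF D(1)]
  obtain \<theta> where \<theta>: "0 < \<theta>" "\<theta> \<le> 1" "\<And>x. x \<in> carrier_vec m \<Longrightarrow> \<theta> * qform P x \<le> qform V x"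
    using spd_dominates[OF V P'(1)] by blast
  obtain l where l: "0 < l" "\<And>x. x \<in> carrier_vec m \<Longrightarrow> l * (x \<bullet> x) \<le> qform V x"
    using spd_coercive[OF V] by blast
  obtain N where N: "0 \<le> N" "\<And>P'. sym_psd m P' \<Longrightarrow>
     frob_norm (closed_loop F H R P' - closed_loop F H R P) \<le> N * frob_norm (P' - P)"
    using closed_loop_lipschitz[OF D(2)] by blast
  define A where "A = 2 * tr P / (l * \<theta>)"
  have A: "0 \<le> A" using l(1) \<theta>(1) frob_norm_le_tr(2)[OF D(2)] by (simp add: A_def)
  show thesis
  proof (rule that[of "l * \<theta> / 2" "A + N * A + 1"])
    show "0 < l * \<theta> / 2" using l(1) \<theta>(1) by simp
    show "0 < A + N * A + 1" using A N(1) by (simp add: add_nonneg_pos)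
    fix W assume W: "sym_psd m W" and small: "frob_norm W \<le> l * \<theta> / 2"
    note W' = sym_psdD[OF W]
    define s where "s = frob_norm W / l"
    have s: "0 \<le> s" "s \<le> \<theta> / 2" using l(1) small frob_norm_nonneg[of W] by (auto simp: s_def field_simps)
    have WV: "qform W x \<le> s * qform V x" if x: "x \<in> carrier_vec m" for x
    proof -
      have "qform W x \<le> s * (l * (x \<bullet> x))" using qform_le_frob_norm[OF W'(1) x] l(1) by (simp add: s_def)
      also have "\<dots> \<le> s * qform V x" by (intro mult_left_mono l(2)[OF x] s)
      finally show ?thesis .
    qed
    have VWq: "qform (V + W) x = qform V x + qform W x" if "x \<in> carrier_vec m" for x
      by (rule qform_add[OF V'(1) W'(1) that])
    have VW: "spd m (V + W)"
    proof (rule spdI)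
      show "V + W \<in> carrier_mat m m" "transpose_mat (V + W) = V + W"
        using V' W' transpose_add[OF V'(1) W'(1)] by auto
      fix x :: "real vec" assume "x \<in> carrier_vec m" "x \<noteq> 0\<^sub>v m"
      thus "0 < qform (V + W) x" using VWq V'(3) W'(3) by (simp add: add_pos_nonneg)
    qed
    define P1 where "P1 = bd_pred c F H R (V + W)"
    note D1 = riccati_solutionD[OF bd_pred_is_solution[OF VW] spdD(1)[OF VW], folded P1_def]
    have lo: "qform P x \<le> qform P1 x" if x: "x \<in> carrier_vec m" for x
      by (rule riccati_comparison_exact[OF D(2) D1(1) V _ _ x]) (use D(4) D1(4) VWq W'(3) in auto)
    have hi: "qform P1 x \<le> (1 + 2 * s / \<theta>) * qform P x" if x: "x \<in> carrier_vec m" for x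
    proof (rule riccati_comparison[OF D1(2) D(1) \<theta>(1,2) s _ _ \<theta>(3) x])
      fix x :: "real vec" assume x: "x \<in> carrier_vec m"
      have "0 \<le> s * qform (step P1) x"
        using s(1) sym_psdD(3)[OF step_psd[OF D1(2)] x] by simp
      thus "qform P1 x \<le> (1 + s) * (qform (step P1) x + qform V x)"
        using D1(4)[OF x] VWq[OF x] WV[OF x] by (simp add: algebra_simps)
    qed (use D(4) in auto)
    have "frob_norm (P1 - P) \<le> 2 * s / \<theta> * tr P"
      by (rule frob_norm_diff_le[OF spdD(1,2)[OF D1(1)] P'(1,2) lo hi])
    hence e: "frob_norm (P1 - P) \<le> A * frob_norm W" by (simp add: A_def s_def mult_ac)
    have w: "0 \<le> frob_norm W" "0 \<le> A * frob_norm W" "0 \<le> N * (A * frob_norm W)"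
      using frob_norm_nonneg A N(1) by auto
    have "frob_norm (closed_loop F H R P1 - closed_loop F H R P) \<le> N * (A * frob_norm W)"
      using N(2)[OF D1(2)] mult_left_mono[OF e N(1)] by linarith
    thus "frob_norm (bd_pred c F H R (V + W) - bd_pred c F H R V) \<le> (A + N * A + 1) * frob_norm W \<and>
      frob_norm (bd_cl c F H R (V + W) - bd_cl c F H R V) \<le> (A + N * A + 1) * frob_norm W"
      using e w by (simp add: bd_cl_def P1_def[symmetric] P_def[symmetric] algebra_simps)
  qed
qed

text \<open>The full filter is the instance with one block, to which the perturbation bound applies as well.\<close>

lemma as_single_block: "block_riccati m p H R 0 F 0 1"
  by unfold_locales (use m_pos det in \<open>auto simp: block_struct_def\<close>)

end

section \<open>Updated covariances and the common noise\<close>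

lemma vec_add_diff_cancel:
  fixes a b :: "real vec"
  assumes "a \<in> carrier_vec m" "b \<in> carrier_vec m"
  shows "a + b - b = a" "a + b - a = b"
  using assms by auto

lemma vec_diff_zero_imp_eq:
  fixes a b :: "real vec"
  assumes a: "a \<in> carrier_vec m" and b: "b \<in> carrier_vec m" and z: "a - b = 0\<^sub>v m"
  shows "a = b"
proof (rule eq_vecI)
  fix j assume "j < dim_vec b"
  hence j: "j < m" using b by simp
  have "(a - b) $ j = 0" using z j by simp
  thus "a $ j = b $ j" using a b j by simp
qed (use a b in simp)

lemma posterior_noise_spd:
  assumes S: "spd p S" and U: "spd r U" and N: "N \<in> carrier_mat p r"
  shows "spd r (minv U + transpose_mat N * minv S * N)"
proof (rule spdI)
  note S' = spdD[OF minv_spd[OF S]] and U' = spdD[OF minv_spd[OF U]]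
  have NT: "transpose_mat N \<in> carrier_mat r p" using N by simp
  have c: "transpose_mat N * minv S * N \<in> carrier_mat r r" using NT S' N by auto
  show "minv U + transpose_mat N * minv S * N \<in> carrier_mat r r" using U' c by auto
  show "transpose_mat (minv U + transpose_mat N * minv S * N) = minv U + transpose_mat N * minv S * N"
    using transpose_add[OF U'(1) c] symmetric_congruence[OF NT S'(1,2)] U'(2) by simp
  fix x :: "real vec" assume x: "x \<in> carrier_vec r" "x \<noteq> 0\<^sub>v r"
  have "N *\<^sub>v x \<in> carrier_vec p" using N x by simp
  hence "0 \<le> qform (transpose_mat N * minv S * N) x"
    using qform_congruence[OF NT S'(1) x(1)] sym_psdD(3)[OF spd_imp_psd[OF minv_spd[OF S]]] by simp
  thus "0 < qform (minv U + transpose_mat N * minv S * N) x"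
    using qform_add[OF U'(1) c x(1)] U'(3)[OF x] by simp
qed

text \<open>The matrix \<open>C\<close> is the posterior covariance of a random vector with prior covariance \<open>U\<close>
  observed through \<open>N\<close> with noise covariance \<open>S\<close>, in information form. The statement exhibits
  the optimal weight \<open>\<Delta>\<close> of that observation.\<close>

lemma posterior_noise_attained:
  assumes S: "spd p S" and U: "spd r U" and N: "N \<in> carrier_mat p r" and g: "g \<in> carrier_vec r"
    and C: "C = minv (minv U + transpose_mat N * minv S * N)"
    and D: "\<Delta> = minv S *\<^sub>v (N *\<^sub>v (C *\<^sub>v g))"
  shows "\<Delta> \<in> carrier_vec p"
    "qform S \<Delta> + qform U (g - transpose_mat N *\<^sub>v \<Delta>) = qform C g"
proof -
  let ?J = "minv U + transpose_mat N * minv S * N"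
  note J = posterior_noise_spd[OF S U N] and S' = minv_spd_inverse[OF S] and U' = minv_spd_inverse[OF U]
  define u where "u = C *\<^sub>v g"
  have u: "u \<in> carrier_vec r" and Ju: "?J *\<^sub>v u = g"
    using minv_cancel_vec[OF J g] by (auto simp: u_def C)
  have Nu: "N *\<^sub>v u \<in> carrier_vec p" using N u by simp
  note d = minv_cancel_vec[OF S Nu] and w = minv_cancel_vec[OF U u]
  have D': "\<Delta> = minv S *\<^sub>v (N *\<^sub>v u)" using D by (simp add: u_def)
  show Dc: "\<Delta> \<in> carrier_vec p" using d D' by simp
  have NT: "transpose_mat N \<in> carrier_mat r p" using N by simp
  have NTD: "transpose_mat N *\<^sub>v \<Delta> \<in> carrier_vec r" using NT Dc by simp
  have c: "transpose_mat N * minv S * N \<in> carrier_mat r r" using NT S' N by auto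
  have "(transpose_mat N * minv S * N) *\<^sub>v u = transpose_mat N *\<^sub>v \<Delta>"
    using assoc_mult_mat_vec[of "transpose_mat N * minv S" r p N r u] assoc_mult_mat_vec[OF NT S'(1) Nu]
      NT S' N u D' by simp
  hence split: "minv U *\<^sub>v u + transpose_mat N *\<^sub>v \<Delta> = g"
    using Ju add_mult_distrib_mat_vec[OF U'(1) c u] by simp
  have "g - transpose_mat N *\<^sub>v \<Delta> = minv U *\<^sub>v u"
    unfolding split[symmetric] by (rule vec_add_diff_cancel(1)[OF w(3) NTD])
  hence "qform U (g - transpose_mat N *\<^sub>v \<Delta>) = u \<bullet> (minv U *\<^sub>v u)"
    using qform_minv[OF U u] by (simp add: qform_def)
  moreover have "qform S \<Delta> = u \<bullet> (transpose_mat N *\<^sub>v \<Delta>)"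
    using qform_minv[OF S Nu] D' transpose_vec_mult_scalar[OF N u Dc]
      comm_scalar_prod[OF Nu d(3)] comm_scalar_prod[OF u NTD]
    by (simp add: qform_def)
  ultimately have "qform S \<Delta> + qform U (g - transpose_mat N *\<^sub>v \<Delta>) = u \<bullet> g"
    unfolding split[symmetric] using scalar_prod_add_distrib[OF u w(3) NTD] by simp
  also have "\<dots> = qform C g" using comm_scalar_prod[OF u g] by (simp add: qform_def u_def)
  finally show "qform S \<Delta> + qform U (g - transpose_mat N *\<^sub>v \<Delta>) = qform C g" .
qed

lemma (in measurement) opt_gain_unique:
  assumes P: "sym_psd m P" and x: "x \<in> carrier_vec m" and k: "k \<in> carrier_vec p"
    and eq: "qform P (x - transpose_mat H *\<^sub>v k) + qform R k = qform (meas_update H R P) x"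
  shows "k = opt_gain P x"
proof -
  note k0 = opt_gain_carrier[OF P x]
  have "qform (innov P) (k - opt_gain P x) = 0"
    using meas_update_complete_square[OF P x k] eq by simp
  hence z: "k - opt_gain P x = 0\<^sub>v p"
    using spdD(3)[OF innov_spd[OF P], of "k - opt_gain P x"] k k0 by fastforce
  show ?thesis by (rule vec_diff_zero_imp_eq[OF k k0 z])
qed

lemma (in measurement) meas_update_mono:
  assumes "sym_psd m X" "sym_psd m P" "\<And>x. x \<in> carrier_vec m \<Longrightarrow> qform X x \<le> qform P x"
    "x \<in> carrier_vec m"
  shows "qform (meas_update H R X) x \<le> qform (meas_update H R P) x"
  using meas_update_mono_scale[of X P 1 x] assms by simp

lemma sym_psd_congruence:
  assumes "B \<in> carrier_mat m p" "sym_psd p A"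
  shows "sym_psd m (B * A * transpose_mat B)"
proof -
  note A = sym_psdD[OF assms(2)]
  have "transpose_mat B *\<^sub>v x \<in> carrier_vec p" if "x \<in> carrier_vec m" for x
    using assms(1) that by simp
  moreover have "B * A * transpose_mat B \<in> carrier_mat m m" using assms(1) A by auto
  ultimately show ?thesis
    unfolding sym_psd_def using symmetric_congruence[OF assms(1) A(1,2)]
    by (auto simp: qform_congruence[OF assms(1) A(1)] A(3))
qed

lemma psd_add_spd:
  assumes A: "sym_psd m A" and B: "spd m B" shows "spd m (A + B)"
proof (rule spdI)
  note A' = sym_psdD[OF A] and B' = spdD[OF B]
  show "A + B \<in> carrier_mat m m" "transpose_mat (A + B) = A + B"
    using A' B' transpose_add[OF A'(1) B'(1)] by auto
  fix x :: "real vec" assume "x \<in> carrier_vec m" "x \<noteq> 0\<^sub>v m"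
  thus "0 < qform (A + B) x" using qform_add[OF A'(1) B'(1)] A'(3) B'(3) by (simp add: add_nonneg_pos)
qed

text \<open>If an updated covariance \<open>X\<close> reproduces itself through one prediction and update up to a factor
  \<open>1 + s\<close>, then its prediction \<open>B\<close> satisfies the Riccati inequality up to the same factor. The comparison
  principle puts \<open>B\<close> between \<open>P\<close> and \<open>(1 + 2 s / \<theta>) P\<close>, and a further update keeps
  \<open>X\<close> within \<open>O(s)\<close> of the updated covariance of \<open>P\<close>.\<close>

lemma (in riccati) update_sandwich:
  assumes c: "c = 0" and V: "spd m V" and sol: "riccati_solution V P"
  obtains \<delta> M where "0 < \<delta>" "0 < M" "\<And>s X. 0 \<le> s \<Longrightarrow> s \<le> \<delta> \<Longrightarrow> sym_psd m X \<Longrightarrow>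
     (\<And>x. x \<in> carrier_vec m \<Longrightarrow>
       qform (meas_update H R (F * X * transpose_mat F + V)) x \<le> qform X x \<and>
       qform X x \<le> (1 + s) * qform (meas_update H R (F * X * transpose_mat F + V)) x) \<Longrightarrow>
     frob_norm (meas_update H R P - X) \<le> M * s"
proof -
  note V' = spdD[OF V]
  note D = riccati_solutionD[OF sol V'(1)]
  note U = meas_update_psd[OF D(2)]
  note U' = sym_psdD[OF U]
  obtain \<theta> where \<theta>: "0 < \<theta>" "\<theta> \<le> 1" "\<And>x. x \<in> carrier_vec m \<Longrightarrow> \<theta> * qform P x \<le> qform V x"
    using spd_dominates[OF V spdD(1)[OF D(1)]] by blast
  let ?\<Phi> = "meas_update H R"
  define T where "T = tr (?\<Phi> P)"
  have T: "0 \<le> T" unfolding T_def by (rule frob_norm_le_tr(2)[OF U])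
  show thesis
  proof (rule that[of "\<theta> / 2" "(1 + 3 / \<theta>) * T + 1"])
    show "0 < \<theta> / 2" using \<theta> by simp
    show "0 < (1 + 3 / \<theta>) * T + 1" using \<theta> T by (simp add: add_nonneg_pos)
    fix s X
    assume s: "0 \<le> s" "s \<le> \<theta> / 2" and X: "sym_psd m X"
      and sand: "\<And>x. x \<in> carrier_vec m \<Longrightarrow>
       qform (?\<Phi> (F * X * transpose_mat F + V)) x \<le> qform X x \<and>
       qform X x \<le> (1 + s) * qform (?\<Phi> (F * X * transpose_mat F + V)) x"
    define B where "B = F * X * transpose_mat F + V"
    note X' = sym_psdD[OF X] and FX = sym_psd_congruence[OF F X]
    have B: "spd m B" unfolding B_def by (rule psd_add_spd[OF FX V])
    note Bp = spd_imp_psd[OF B]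
    have qB: "qform B x = qform X (transpose_mat F *\<^sub>v x) + qform V x" if x: "x \<in> carrier_vec m" for x
      unfolding B_def using qform_add[OF sym_psdD(1)[OF FX] V'(1) x] qform_congruence[OF F X'(1) x] by simp
    have st: "qform (step Y) x = qform (?\<Phi> Y) (transpose_mat F *\<^sub>v x)"
      if "sym_psd m Y" "x \<in> carrier_vec m" for Y x
      using qform_step[OF that] by (simp add: c block_proj_0)
    have PB: "qform P x \<le> qform B x" if x: "x \<in> carrier_vec m" for x
    proof (rule riccati_comparison_exact[OF D(2) B V _ _ x])
      fix x :: "real vec" assume x: "x \<in> carrier_vec m"
      show "qform P x \<le> qform (step P) x + qform V x" using D(4)[OF x] by simp
      show "qform (step B) x + qform V x \<le> qform B x"
        using sand[OF FT_vec[OF x]] qB[OF x] st[OF Bp x] by (simp add: B_def)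
    qed
    have BP: "qform B x \<le> (1 + 2 * s / \<theta>) * qform P x" if x: "x \<in> carrier_vec m" for x
    proof (rule riccati_comparison[OF Bp D(1) \<theta>(1,2) s _ _ \<theta>(3) x])
      fix x :: "real vec" assume x: "x \<in> carrier_vec m"
      have "qform V x \<le> (1 + s) * qform V x"
        using sym_psdD(3)[OF spd_imp_psd[OF V] x] s(1) by (simp add: distrib_right)
      thus "qform B x \<le> (1 + s) * (qform (step B) x + qform V x)"
        using sand[OF FT_vec[OF x]] qB[OF x] st[OF Bp x] by (simp add: B_def distrib_left)
      show "qform (step P) x + qform V x \<le> qform P x" using D(4)[OF x] by simp
    qed
    let ?t = "s * (1 + 3 / \<theta>)"
    have lo: "qform (?\<Phi> P) x \<le> qform X x" if x: "x \<in> carrier_vec m" for x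
      using meas_update_mono[OF D(2) Bp PB x] sand[OF x] by (simp add: B_def)
    have hi: "qform X x \<le> (1 + ?t) * qform (?\<Phi> P) x" if x: "x \<in> carrier_vec m" for x
    proof -
      have "qform (?\<Phi> B) x \<le> (1 + 2 * s / \<theta>) * qform (?\<Phi> P) x"
        by (rule meas_update_mono_scale[OF Bp D(2) _ BP x]) (use s \<theta> in auto)
      hence "(1 + s) * qform (?\<Phi> B) x \<le> (1 + s) * ((1 + 2 * s / \<theta>) * qform (?\<Phi> P) x)"
        using s by (intro mult_left_mono) auto
      hence "qform X x \<le> ((1 + s) * (1 + 2 * s / \<theta>)) * qform (?\<Phi> P) x"
        using sand[OF x] by (simp add: B_def mult.assoc)
      also have "\<dots> \<le> (1 + ?t) * qform (?\<Phi> P) x"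
      proof (rule mult_right_mono[OF _ U'(3)[OF x]])
        have "s * (2 * s) \<le> s * 1" using s \<theta> by (intro mult_left_mono) auto
        hence "s * (2 * s) / \<theta> \<le> s / \<theta>" using \<theta> by (simp add: divide_right_mono)
        moreover have "1 + s + 2 * u + w \<le> 1 + s + 3 * u" if "w \<le> u" for u w :: real
          using that by simp
        ultimately have "1 + s + 2 * (s / \<theta>) + s * (2 * s) / \<theta> \<le> 1 + s + 3 * (s / \<theta>)" by blast
        thus "(1 + s) * (1 + 2 * s / \<theta>) \<le> 1 + ?t" by (simp add: algebra_simps add_divide_distrib)
      qed
      finally show ?thesis .
    qed
    have "frob_norm (X - ?\<Phi> P) \<le> ?t * T"
      unfolding T_def by (rule frob_norm_diff_le[OF X'(1,2) U'(1,2) lo hi])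
    thus "frob_norm (?\<Phi> P - X) \<le> ((1 + 3 / \<theta>) * T + 1) * s"
      using frob_norm_minus_commute[OF X'(1) U'(1)] s by (simp add: algebra_simps)
  qed
qed

text \<open>The process noise is \<open>V\<close>, block diagonal, plus a term \<open>G U G\<^sup>T\<close> common to all blocks. Here
  \<open>X\<close> and \<open>Pt\<close> are the updated and predicted covariances of the block-diagonal filter, and \<open>B\<close> is
  the prediction from \<open>X\<close> without the common term. The suffix \<open>grave\<close> marks the full filter
  driven by the block-diagonal part of the noise, in terms of which \<open>C\<close> is defined.\<close>

locale common_noise_filter = block_riccati +
  fixes V G U :: "real mat" and r :: nat
  assumes V: "spd m V" and V_block: "block_proj c V = V"
    and G: "G \<in> carrier_mat m r" and U: "spd r U"
begin

abbreviation W where "W \<equiv> G * U * transpose_mat G"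
abbreviation X where "X \<equiv> bd_upd c F H R (V + W)"
abbreviation B where "B \<equiv> F * X * transpose_mat F + V"
abbreviation Pt where "Pt \<equiv> bd_pred c F H R (V + W)"
abbreviation X_grave where "X_grave \<equiv> kf_upd F H R (block_proj c (V + W))"
abbreviation B_grave where "B_grave \<equiv> F * X_grave * transpose_mat F + V"
abbreviation C where "C \<equiv> C_mat c F H V R G U"

lemma W_psd: "sym_psd m W" by (rule sym_psd_congruence[OF G spd_imp_psd[OF U]])

lemma VW_spd: "spd m (V + W)"
  using psd_add_spd[OF W_psd V] comm_add_mat[OF spdD(1)[OF V] sym_psdD(1)[OF W_psd]] by simp

lemmas Pt_sol = riccati_solutionD[OF bd_pred_is_solution[OF VW_spd] spdD(1)[OF VW_spd]]

lemma X_eq: "X = block_proj c (meas_update H R Pt)" by (simp add: bd_upd_def)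

lemma X_psd: "sym_psd m X"
  unfolding X_eq by (rule block_proj_psd[OF meas_update_psd[OF Pt_sol(2)]])

lemma FXF_psd: "sym_psd m (F * X * transpose_mat F)" by (rule sym_psd_congruence[OF F X_psd])

lemma B_spd: "spd m B" by (rule psd_add_spd[OF FXF_psd V])

lemma B_psd: "sym_psd m B" by (rule spd_imp_psd[OF B_spd])

lemma Pt_eq: "Pt = B + W"
proof -
  have "Pt = F * X * transpose_mat F + (V + W)" using Pt_sol(3) by (simp add: step_def X_eq[symmetric])
  also have "\<dots> = B + W"
    by (rule assoc_add_mat[OF sym_psdD(1)[OF FXF_psd] spdD(1)[OF V] sym_psdD(1)[OF W_psd], symmetric])
  finally show ?thesis .
qed

lemma qform_Pt: "x \<in> carrier_vec m \<Longrightarrow> qform Pt x = qform B x + qform W x"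
  unfolding Pt_eq by (rule qform_add[OF sym_psdD(1)[OF B_psd] sym_psdD(1)[OF W_psd]])

lemma qform_B:
  "x \<in> carrier_vec m \<Longrightarrow> qform B x = qform X (transpose_mat F *\<^sub>v x) + qform V x"
  using qform_add[OF sym_psdD(1)[OF FXF_psd] spdD(1)[OF V]] qform_congruence[OF F sym_psdD(1)[OF X_psd]]
  by simp

lemma B_block: "block_proj c B = B"
proof (rule qform_determines[of _ m])
  note B' = sym_psdD[OF B_psd]
  show "block_proj c B \<in> carrier_mat m m" "transpose_mat (block_proj c B) = block_proj c B"
    "B \<in> carrier_mat m m" "transpose_mat B = B"
    using B' block_proj_carrier[OF B'(1)] block_proj_symmetric[OF B'(1,2)] by auto
  fix x :: "real vec" assume x: "x \<in> carrier_vec m"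
  have "block_proj c B = block_proj c (F * X * transpose_mat F) + block_proj c V"
    by (rule block_proj_add[OF sym_psdD(1)[OF FXF_psd] spdD(1)[OF V]])
  moreover have "block_proj c X = X" by (simp add: X_eq block_proj_idem)
  ultimately show "qform (block_proj c B) x = qform B x"
    using qform_add[OF block_proj_carrier[OF sym_psdD(1)[OF FXF_psd]] spdD(1)[OF V] x] qform_B[OF x]
      block_proj_congruence[OF sym_psdD(1)[OF X_psd] x] V_block by simp
qed

lemma update_lower:
  assumes x: "x \<in> carrier_vec m"
  shows "qform (meas_update H R B) x \<le> qform (meas_update H R Pt) x"
  by (rule meas_update_mono[OF B_psd Pt_sol(2) _ x]) (simp add: qform_Pt sym_psdD(3)[OF W_psd])

lemma DVW_spd: "spd m (block_proj c (V + W))" by (rule block_proj_spd[OF VW_spd])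

lemmas grave_sol = full.riccati_solutionD[OF kf_pred_is_solution[OF DVW_spd] spdD(1)[OF DVW_spd]]

lemma X_grave_psd: "sym_psd m X_grave"
  unfolding kf_upd_def by (rule meas_update_psd[OF grave_sol(2)])

text \<open>Projecting the equation of \<open>Pt\<close> and pinching shows that the block-diagonal part of \<open>Pt\<close> is a
  subsolution of the Riccati equation that defines the grave quantities.\<close>

lemma X_le_grave:
  assumes x: "x \<in> carrier_vec m"
  shows "qform X x \<le> qform X_grave x"
proof -
  note DP = block_proj_psd[OF Pt_sol(2), of c]
  have S: "step Pt \<in> carrier_mat m m" by (rule step_carrier[OF Pt_sol(2)])
  have le: "qform (block_proj c Pt) x \<le> qform (kf_pred F H R (block_proj c (V + W))) x"
    if x: "x \<in> carrier_vec m" for x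
  proof (rule full.riccati_comparison_exact[OF DP grave_sol(1) DVW_spd _ _ x])
    fix x :: "real vec" assume x: "x \<in> carrier_vec m"
    have "block_proj c (step Pt + (V + W)) = block_proj c (step Pt) + block_proj c (V + W)"
      by (rule block_proj_add[OF S spdD(1)[OF VW_spd]])
    hence "block_proj c Pt = block_proj c (step Pt) + block_proj c (V + W)"
      using Pt_sol(3) by simp
    moreover have "qform (block_proj c (step Pt)) x = qform (step Pt) x"
      using block_proj_congruence[OF block_proj_carrier[OF meas_update_carrier[OF Pt_sol(2)]] x, of c]
        qform_step[OF Pt_sol(2) x] by (simp add: step_def block_proj_idem)
    ultimately have "qform (block_proj c Pt) x = qform (step Pt) x + qform (block_proj c (V + W)) x"
      using qform_add[OF block_proj_carrier[OF S] spdD(1)[OF DVW_spd] x] by simp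
    thus "qform (block_proj c Pt) x \<le> qform (full.step (block_proj c Pt)) x + qform (block_proj c (V + W)) x"
      using step_le_full_step[OF Pt_sol(2) x] by simp
  qed (use grave_sol(4) in auto)
  have "qform X x \<le> qform (meas_update H R (block_proj c Pt)) x"
    unfolding X_eq by (rule pinching[OF Pt_sol(2) x])
  also have "\<dots> \<le> qform X_grave x"
    unfolding kf_upd_def by (rule meas_update_mono[OF DP grave_sol(2) le x])
  finally show ?thesis .
qed

lemma FXF_grave_psd: "sym_psd m (F * X_grave * transpose_mat F)"
  by (rule sym_psd_congruence[OF F X_grave_psd])

lemma B_grave_psd: "sym_psd m B_grave"
  by (rule spd_imp_psd[OF psd_add_spd[OF FXF_grave_psd V]])

lemma B_le_grave:
  assumes x: "x \<in> carrier_vec m" shows "qform B x \<le> qform B_grave x"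
  using qform_B[OF x] X_le_grave[OF FT_vec[OF x]] qform_add[OF sym_psdD(1)[OF FXF_grave_psd] spdD(1)[OF V] x]
    qform_congruence[OF F sym_psdD(1)[OF X_grave_psd] x] by simp

lemma HG: "H * G \<in> carrier_mat p r" using H G by auto

lemma C_eq: "C = minv (minv U + transpose_mat (H * G) * minv (innov B_grave) * (H * G))"
proof -
  have I: "minv (innov B_grave) \<in> carrier_mat p p" by (rule minv_spd_inverse(1)[OF innov_spd[OF B_grave_psd]])
  have "transpose_mat G * transpose_mat H * minv (innov B_grave) * H * G
     = transpose_mat G * transpose_mat H * minv (innov B_grave) * (H * G)"
    by (rule assoc_mult_mat[of _ r p _ m _ r]) (use I H G in auto)
  thus ?thesis by (simp add: C_mat_def transpose_mult[OF H G])
qed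

lemma C_spd: "spd r C"
  unfolding C_eq by (rule minv_spd[OF posterior_noise_spd[OF innov_spd[OF B_grave_psd] U HG]])

text \<open>Process the prior \<open>B\<close> with its own optimal weight, and add the correction \<open>\<Delta>\<close> that would
  optimally estimate the common noise if the innovation covariance were that of \<open>B_grave\<close>. Since
  \<open>B \<le> B_grave\<close>, the correction costs at most what the posterior covariance \<open>C\<close> accounts for.\<close>

lemma update_upper:
  assumes x: "x \<in> carrier_vec m"
  shows "qform (meas_update H R Pt) x \<le> qform (meas_update H R B) x
     + qform C (transpose_mat G *\<^sub>v (x - transpose_mat H *\<^sub>v opt_gain B x))"
proof -
  let ?k = "opt_gain B x" let ?z = "x - transpose_mat H *\<^sub>v ?k" let ?g = "transpose_mat G *\<^sub>v ?z"
  note k = opt_gain_carrier[OF B_psd x]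
  have z: "?z \<in> carrier_vec m" using x HT_vec[OF k] by simp
  have GT: "transpose_mat G \<in> carrier_mat r m" using G by simp
  have g: "?g \<in> carrier_vec r" using GT z by simp
  define \<Delta> where "\<Delta> = minv (innov B_grave) *\<^sub>v (H * G *\<^sub>v (C *\<^sub>v ?g))"
  note D = posterior_noise_attained[OF innov_spd[OF B_grave_psd] U HG g C_eq \<Delta>_def]
  have kD: "?k + \<Delta> \<in> carrier_vec p" using k D(1) by simp
  have HD: "transpose_mat H *\<^sub>v \<Delta> \<in> carrier_vec m" by (rule HT_vec[OF D(1)])
  have e: "x - transpose_mat H *\<^sub>v (?k + \<Delta>) = ?z - transpose_mat H *\<^sub>v \<Delta>"
    unfolding mult_add_distrib_mat_vec[OF HT k D(1)] using x HT_vec[OF k] HD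
    by (intro eq_vecI) (auto simp del: mult_mat_vec_carrier dim_mult_mat_vec index_mult_mat_vec)
  have zz: "?z - transpose_mat H *\<^sub>v \<Delta> \<in> carrier_vec m" using z HD by simp
  have "transpose_mat G *\<^sub>v (?z - transpose_mat H *\<^sub>v \<Delta>) = ?g - transpose_mat (H * G) *\<^sub>v \<Delta>"
    using mult_minus_distrib_mat_vec[OF GT z HD] transpose_mult[OF H G] assoc_mult_mat_vec[OF GT HT D(1)] by simp
  hence W: "qform W (?z - transpose_mat H *\<^sub>v \<Delta>) = qform U (?g - transpose_mat (H * G) *\<^sub>v \<Delta>)"
    using qform_congruence[OF G spdD(1)[OF U] zz] by simp
  have "?k + \<Delta> - ?k = \<Delta>" by (rule vec_add_diff_cancel(2)[OF k D(1)])
  hence sq: "qform B (?z - transpose_mat H *\<^sub>v \<Delta>) + qform R (?k + \<Delta>)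
      = qform (meas_update H R B) x + qform (innov B) \<Delta>"
    using meas_update_complete_square[OF B_psd x kD] e by simp
  have "qform (innov B) \<Delta> \<le> qform (innov B_grave) \<Delta>"
    using qform_innov[OF sym_psdD(1)[OF B_psd] D(1)] qform_innov[OF sym_psdD(1)[OF B_grave_psd] D(1)]
      B_le_grave[OF HD] by simp
  moreover have "qform (meas_update H R Pt) x \<le> qform Pt (?z - transpose_mat H *\<^sub>v \<Delta>) + qform R (?k + \<Delta>)"
    using meas_update_le[OF Pt_sol(2) x kD] e by simp
  ultimately show ?thesis using qform_Pt[OF zz] sq W D(2) by simp
qed

end

section \<open>Block-diagonal matrices given by lists of blocks\<close>

text \<open>The vector supported on block \<open>i\<close> of \<open>n\<close> blocks of length \<open>a\<close>. Restricting a
  quadratic form to such vectors extracts a diagonal block.\<close>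

definition emb :: "nat \<Rightarrow> nat \<Rightarrow> nat \<Rightarrow> real vec \<Rightarrow> real vec" where
  "emb a n i x = vec (n * a) (\<lambda>k. if k div a = i then x $ (k mod a) else 0)"

definition prj :: "nat \<Rightarrow> nat \<Rightarrow> real vec \<Rightarrow> real vec" where
  "prj a i y = vec a (\<lambda>k. y $ (i * a + k))"

lemma emb_carrier: "emb a n i x \<in> carrier_vec (n * a)"
  by (simp add: emb_def)

lemma prj_carrier: "prj a i y \<in> carrier_vec a"
  by (simp add: prj_def)

lemma block_index_less:
  fixes i n a k :: nat
  assumes "i < n" "k < a" shows "i * a + k < n * a"
proof -
  have "i * a + k < Suc i * a" using assms(2) by simp
  also have "\<dots> \<le> n * a" using assms(1) by (intro mult_le_mono1) simp
  finally show ?thesis .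
qed

lemma sum_over_block:
  fixes f :: "nat \<Rightarrow> real"
  assumes i: "i < n" and a: "0 < a"
  shows "(\<Sum>k<n * a. if k div a = i then f k else 0) = (\<Sum>k<a. f (i * a + k))"
proof -
  have "(\<Sum>k<n * a. if k div a = i then f k else 0) = sum f {k \<in> {..<n * a}. k div a = i}"
    by (rule sum.inter_filter[symmetric]) simp
  also have "\<dots> = (\<Sum>k<a. f (i * a + k))"
    using a i block_index_less[OF i]
    by (intro sum.reindex_bij_witness[of _ "\<lambda>k. i * a + k" "\<lambda>k. k mod a"]) auto
  finally show ?thesis .
qed

lemma qform_nth_diag_block:
  assumes A: "A \<in> carrier_mat (n * a) (n * a)" and x: "x \<in> carrier_vec a" and i: "i < n" and a: "0 < a"
  shows "qform (nth_diag_block a i A) x = qform A (emb a n i x)"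
proof -
  have "qform A (emb a n i x) = (\<Sum>k<n * a. if k div a = i then
      (\<Sum>l<n * a. if l div a = i then A $$ (k,l) * (x $ (k mod a) * x $ (l mod a)) else 0) else 0)"
    unfolding qform_sum[OF A emb_carrier] by (intro sum.cong) (auto simp: emb_def intro!: sum.cong)
  also have "\<dots> = (\<Sum>k<a. \<Sum>l<a. A $$ (i * a + k, i * a + l) * (x $ k * x $ l))"
    unfolding sum_over_block[OF i a] by simp
  also have "\<dots> = qform (nth_diag_block a i A) x"
    using x by (subst qform_sum[of _ a]) (auto simp: nth_diag_block_def)
  finally show ?thesis by simp
qed

lemma nth_diag_block_carrier: "nth_diag_block a i A \<in> carrier_mat a a"
  by (simp add: nth_diag_block_def)

lemma nth_diag_block_symmetric:
  assumes "A \<in> carrier_mat (n * a) (n * a)" "transpose_mat A = A" "i < n"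
  shows "transpose_mat (nth_diag_block a i A) = nth_diag_block a i A"
proof (rule eq_matI)
  fix k l assume "k < dim_row (nth_diag_block a i A)" "l < dim_col (nth_diag_block a i A)"
  hence kl: "k < a" "l < a" by (auto simp: nth_diag_block_def)
  have "A $$ (i * a + l, i * a + k) = A $$ (i * a + k, i * a + l)"
    using assms(1,2) block_index_less[OF assms(3)] kl by (metis carrier_matD index_transpose_mat(1))
  thus "transpose_mat (nth_diag_block a i A) $$ (k,l) = nth_diag_block a i A $$ (k,l)"
    using kl by (simp add: nth_diag_block_def)
qed (auto simp: nth_diag_block_def)

lemma nth_diag_block_psd:
  assumes "sym_psd (n * a) A" "i < n" "0 < a" shows "sym_psd a (nth_diag_block a i A)"
  using sym_psdD[OF assms(1)] nth_diag_block_carrier nth_diag_block_symmetric[of A n a i] assms(2,3)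
  by (simp add: sym_psd_def qform_nth_diag_block[of A n a] emb_carrier)

lemma emb_nonzero:
  assumes "x \<in> carrier_vec a" "x \<noteq> 0\<^sub>v a" "i < n" shows "emb a n i x \<noteq> 0\<^sub>v (n * a)"
proof -
  obtain k where k: "k < a" "x $ k \<noteq> 0" using assms by (metis carrier_vecD eq_vecI index_zero_vec)
  have "emb a n i x $ (i * a + k) \<noteq> 0"
    using k block_index_less[OF assms(3) k(1)] by (simp add: emb_def)
  thus ?thesis using block_index_less[OF assms(3) k(1)] by auto
qed

lemma nth_diag_block_spd:
  assumes A: "spd (n * a) A" and i: "i < n" and a: "0 < a" shows "spd a (nth_diag_block a i A)"
proof (rule spdI)
  note A' = spdD[OF A]
  show "nth_diag_block a i A \<in> carrier_mat a a" by (rule nth_diag_block_carrier)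
  show "transpose_mat (nth_diag_block a i A) = nth_diag_block a i A"
    by (rule nth_diag_block_symmetric[OF A'(1,2) i])
  fix x :: "real vec" assume x: "x \<in> carrier_vec a" "x \<noteq> 0\<^sub>v a"
  show "0 < qform (nth_diag_block a i A) x"
    unfolding qform_nth_diag_block[OF A'(1) x(1) i a]
    by (rule A'(3)[OF emb_carrier emb_nonzero[OF x i]])
qed

lemma emb_minus:
  assumes "x \<in> carrier_vec a" "y \<in> carrier_vec a" "0 < a"
  shows "emb a n i (x - y) = emb a n i x - emb a n i y"
  using assms by (auto simp: emb_def)

lemma bpart_eq_emb_prj:
  assumes "y \<in> carrier_vec (n * a)" "0 < a" shows "bpart a i y = emb a n i (prj a i y)"
  using assms by (intro eq_vecI) (auto simp: bpart_def emb_def prj_def)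

lemma bpart_emb: "bpart a j (emb a n i x) = (if j = i then emb a n i x else 0\<^sub>v (n * a))"
  by (auto simp: bpart_def emb_def)

lemma qform_block_proj_emb:
  assumes A: "A \<in> carrier_mat (n * a) (n * a)" and i: "i < n"
  shows "qform (block_proj a A) (emb a n i x) = qform A (emb a n i x)"
proof -
  have "qform (block_proj a A) (emb a n i x) = (\<Sum>j<n. qform A (bpart a j (emb a n i x)))"
    by (rule qform_block_proj[OF A emb_carrier]) (rule less_mult_imp_div_less)
  also have "\<dots> = (\<Sum>j<n. if j = i then qform A (emb a n i x) else 0)"
    by (intro sum.cong refl) (simp add: bpart_emb qform_zero_vec[OF A])
  finally show ?thesis using i by simp
qed

lemma qform_bpart_le:
  assumes A: "sym_psd m A" "block_proj a A = A" and y: "y \<in> carrier_vec m"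
  shows "qform A (bpart a i y) \<le> qform A y"
proof -
  note A' = sym_psdD[OF A(1)]
  have nn: "0 \<le> qform A (bpart a j y)" for j using A'(3) bpart_carrier[OF y] by blast
  have lt: "k div a < m + i + 1" if "k < m" for k
    using that div_le_dividend[of k a] by linarith
  have e: "qform A y = (\<Sum>j<m + i + 1. qform A (bpart a j y))"
    using qform_block_proj[OF A'(1) y lt] A(2) by simp
  show ?thesis unfolding e using nn by (intro member_le_sum) auto
qed

lemma diag_block_mat_blocks:
  fixes As :: "real mat list"
  assumes "set As \<subseteq> carrier_mat a b" "0 < a" "0 < b"
  shows "diag_block_mat As \<in> carrier_mat (length As * a) (length As * b) \<and>
    (\<forall>k < length As * a. \<forall>l < length As * b. diag_block_mat As $$ (k,l) =
      (if k div a = l div b then (As ! (k div a)) $$ (k mod a, l mod b) else 0))"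
  using assms(1)
proof (induction As)
  case Nil thus ?case by simp
next
  case (Cons A As)
  let ?D = "diag_block_mat As"
  have A: "A \<in> carrier_mat a b" and As: "set As \<subseteq> carrier_mat a b" using Cons.prems by auto
  note IH = Cons.IH[OF As]
  have D: "?D \<in> carrier_mat (length As * a) (length As * b)" using IH by blast
  have dims: "dim_row A = a" "dim_col A = b" "dim_row ?D = length As * a" "dim_col ?D = length As * b"
    using A D by auto
  have e: "diag_block_mat (A # As) = four_block_mat A (0\<^sub>m a (length As * b)) (0\<^sub>m (length As * a) b) ?D"
    using dims by (simp add: Let_def)
  show ?case
  proof (intro conjI allI impI)
    show "diag_block_mat (A # As) \<in> carrier_mat (length (A # As) * a) (length (A # As) * b)"
      unfolding e using A D by auto
    fix k l assume k: "k < length (A # As) * a" and l: "l < length (A # As) * b"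
    have kd: "k div a = (if k < a then 0 else Suc ((k - a) div a))" "k mod a = (if k < a then k else (k - a) mod a)"
      using assms(2) by (auto simp: le_div_geq le_mod_geq)
    have ld: "l div b = (if l < b then 0 else Suc ((l - b) div b))" "l mod b = (if l < b then l else (l - b) mod b)"
      using assms(3) by (auto simp: le_div_geq le_mod_geq)
    show "diag_block_mat (A # As) $$ (k,l) =
      (if k div a = l div b then ((A # As) ! (k div a)) $$ (k mod a, l mod b) else 0)"
      unfolding e kd ld using k l dims IH by (auto simp: index_mat_four_block)
  qed
qed

lemma vstack_blocks:
  assumes "set Gs \<subseteq> carrier_mat c r" "0 < c"
  shows "vstack r Gs \<in> carrier_mat (length Gs * c) r \<and>
    (\<forall>k < length Gs * c. \<forall>l < r. vstack r Gs $$ (k,l) = (Gs ! (k div c)) $$ (k mod c, l))"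
  using assms(1)
proof (induction Gs)
  case Nil thus ?case by (simp add: vstack_def)
next
  case (Cons A Gs)
  let ?D = "vstack r Gs"
  have A: "A \<in> carrier_mat c r" and Gs: "set Gs \<subseteq> carrier_mat c r" using Cons.prems by auto
  note IH = Cons.IH[OF Gs]
  have D: "?D \<in> carrier_mat (length Gs * c) r" using IH by blast
  have e: "vstack r (A # Gs) = A @\<^sub>r ?D" by (simp add: vstack_def)
  show ?case
  proof (intro conjI allI impI)
    show "vstack r (A # Gs) \<in> carrier_mat (length (A # Gs) * c) r"
      unfolding e using carrier_append_rows[OF A D] by simp
    fix k l assume k: "k < length (A # Gs) * c" and l: "l < r"
    have kd: "k div c = (if k < c then 0 else Suc ((k - c) div c))" "k mod c = (if k < c then k else (k - c) mod c)"
      using assms(2) by (auto simp: le_div_geq le_mod_geq)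
    show "vstack r (A # Gs) $$ (k,l) = ((A # Gs) ! (k div c)) $$ (k mod c, l)"
      unfolding e kd append_rows_def using k l A D IH by (auto simp: index_mat_four_block)
  qed
qed

lemma diag_block_mat_block_struct:
  assumes "set As \<subseteq> carrier_mat a b" "0 < a" "0 < b"
  shows "block_struct a b (diag_block_mat As)"
  using diag_block_mat_blocks[OF assms] by (auto simp: block_struct_def)

lemma diag_block_mat_transpose_emb:
  assumes As: "set As \<subseteq> carrier_mat a b" "0 < a" "0 < b" "length As = n" and i: "i < n"
    and x: "x \<in> carrier_vec a"
  shows "transpose_mat (diag_block_mat As) *\<^sub>v emb a n i x = emb b n i (transpose_mat (As ! i) *\<^sub>v x)"
proof (rule eq_vecI)
  note D = diag_block_mat_blocks[OF As(1-3), unfolded As(4)]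
  have Ai: "As ! i \<in> carrier_mat a b" using As i by auto
  fix l assume "l < dim_vec (emb b n i (transpose_mat (As ! i) *\<^sub>v x))"
  hence l: "l < n * b" by (simp add: emb_def)
  hence lb: "l mod b < b" using As(3) by simp
  have "(transpose_mat (diag_block_mat As) *\<^sub>v emb a n i x) $ l
     = (\<Sum>k<n * a. if k div a = i then diag_block_mat As $$ (k,l) * x $ (k mod a) else 0)"
    using D l by (auto simp: scalar_prod_def emb_def atLeast0LessThan intro!: sum.cong)
  also have "\<dots> = (\<Sum>k<a. diag_block_mat As $$ (i * a + k, l) * x $ k)"
    unfolding sum_over_block[OF i As(2)] by simp
  also have "\<dots> = (\<Sum>k<a. if l div b = i then (As ! i) $$ (k, l mod b) * x $ k else 0)"
    using D l block_index_less[OF i] by (intro sum.cong) auto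
  also have "\<dots> = emb b n i (transpose_mat (As ! i) *\<^sub>v x) $ l"
    using l lb Ai x by (auto simp: scalar_prod_def emb_def atLeast0LessThan intro!: sum.cong)
  finally show "(transpose_mat (diag_block_mat As) *\<^sub>v emb a n i x) $ l
    = emb b n i (transpose_mat (As ! i) *\<^sub>v x) $ l" .
qed (use diag_block_mat_blocks[OF As(1-3)] As(4) in \<open>auto simp: emb_def\<close>)

lemma vstack_transpose_emb:
  assumes Gs: "set Gs \<subseteq> carrier_mat c r" "0 < c" "length Gs = n" and i: "i < n"
    and x: "x \<in> carrier_vec c"
  shows "transpose_mat (vstack r Gs) *\<^sub>v emb c n i x = transpose_mat (Gs ! i) *\<^sub>v x"
proof (rule eq_vecI)
  note D = vstack_blocks[OF Gs(1,2), unfolded Gs(3)]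
  have Gi: "Gs ! i \<in> carrier_mat c r" using Gs i by auto
  fix l assume "l < dim_vec (transpose_mat (Gs ! i) *\<^sub>v x)"
  hence l: "l < r" using Gi by simp
  have "(transpose_mat (vstack r Gs) *\<^sub>v emb c n i x) $ l
     = (\<Sum>k<n * c. if k div c = i then vstack r Gs $$ (k,l) * x $ (k mod c) else 0)"
    using D l by (auto simp: scalar_prod_def emb_def atLeast0LessThan intro!: sum.cong)
  also have "\<dots> = (\<Sum>k<c. vstack r Gs $$ (i * c + k, l) * x $ k)"
    unfolding sum_over_block[OF i Gs(2)] by simp
  also have "\<dots> = (\<Sum>k<c. (Gs ! i) $$ (k, l) * x $ k)"
    using D l block_index_less[OF i] by (intro sum.cong) auto
  also have "\<dots> = (transpose_mat (Gs ! i) *\<^sub>v x) $ l"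
    using l Gi x by (auto simp: scalar_prod_def atLeast0LessThan intro!: sum.cong)
  finally show "(transpose_mat (vstack r Gs) *\<^sub>v emb c n i x) $ l = (transpose_mat (Gs ! i) *\<^sub>v x) $ l" .
qed (use vstack_blocks[OF Gs(1,2)] Gs i in \<open>auto dest: nth_mem\<close>)

lemma nth_diag_block_diag_block_mat:
  assumes "set As \<subseteq> carrier_mat a a" "0 < a" "length As = n" "i < n"
  shows "nth_diag_block a i (diag_block_mat As) = As ! i"
proof -
  have "As ! i \<in> carrier_mat a a" using assms by auto
  thus ?thesis
    using diag_block_mat_blocks[OF assms(1,2,2)] assms(3) block_index_less[OF assms(4)]
    by (intro eq_matI) (auto simp: nth_diag_block_def)
qed

locale block_lists =
  fixes c d n :: nat and Fs Hs Vs Rs :: "real mat list"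
  assumes system: "block_system c d n Fs Hs Vs Rs"
begin

lemma c_pos: "0 < c" and d_pos: "0 < d" and n_pos: "0 < n"
  and Fs: "set Fs \<subseteq> carrier_mat c c" "length Fs = n" and Hs: "set Hs \<subseteq> carrier_mat d c" "length Hs = n"
  and Vs: "set Vs \<subseteq> carrier_mat c c" "length Vs = n" and Rs: "set Rs \<subseteq> carrier_mat d d" "length Rs = n"
  using system by (auto simp: block_system_def)

lemma V_spd: "spd (n * c) (diag_block_mat Vs)"
  using system diag_block_mat_blocks[OF Vs(1) c_pos c_pos] Vs(2) by (simp add: block_system_def spd_def)

lemma V_block_diag: "block_proj c (diag_block_mat Vs) = diag_block_mat Vs"
  by (rule block_struct_block_proj[OF spdD(1)[OF V_spd] diag_block_mat_block_struct[OF Vs(1) c_pos c_pos]])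

sublocale block_riccati "n * c" "n * d" "diag_block_mat Hs" "diag_block_mat Rs" c "diag_block_mat Fs" d n
proof
  show "diag_block_mat Hs \<in> carrier_mat (n * d) (n * c)" "diag_block_mat Fs \<in> carrier_mat (n * c) (n * c)"
    using diag_block_mat_blocks[OF Hs(1) d_pos c_pos] diag_block_mat_blocks[OF Fs(1) c_pos c_pos] Hs(2) Fs(2)
    by auto
  show "spd (n * d) (diag_block_mat Rs)"
    using system diag_block_mat_blocks[OF Rs(1) d_pos d_pos] Rs(2) by (simp add: block_system_def spd_def)
  show "detectable (diag_block_mat Fs) (diag_block_mat Hs)" using system by (simp add: block_system_def)
  show "0 < n * c" using n_pos c_pos by simp
qed (auto intro: less_mult_imp_div_less diag_block_mat_block_struct[OF Fs(1) c_pos c_pos]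
    diag_block_mat_block_struct[OF Hs(1) d_pos c_pos] diag_block_mat_block_struct[OF Rs(1) d_pos d_pos])

lemma V_nth: "i < n \<Longrightarrow> nth_diag_block c i (diag_block_mat Vs) = Vs ! i"
  by (rule nth_diag_block_diag_block_mat[OF Vs(1) c_pos Vs(2)])

lemma R_nth: "i < n \<Longrightarrow> nth_diag_block d i (diag_block_mat Rs) = Rs ! i"
  by (rule nth_diag_block_diag_block_mat[OF Rs(1) d_pos Rs(2)])

lemma V_nth_spd: "i < n \<Longrightarrow> spd c (Vs ! i)"
  using nth_diag_block_spd[OF V_spd _ c_pos] V_nth by metis

lemma block_filter:
  assumes i: "i < n" shows "riccati c d (Hs ! i) (Rs ! i) (Fs ! i)"
proof
  show "Hs ! i \<in> carrier_mat d c" "Fs ! i \<in> carrier_mat c c" using Hs Fs i by auto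
  show "spd d (Rs ! i)" using nth_diag_block_spd[OF R i d_pos] R_nth[OF i] by simp
qed

lemma FT_emb: "i < n \<Longrightarrow> x \<in> carrier_vec c \<Longrightarrow>
    transpose_mat (diag_block_mat Fs) *\<^sub>v emb c n i x = emb c n i (transpose_mat (Fs ! i) *\<^sub>v x)"
  by (rule diag_block_mat_transpose_emb[OF Fs(1) c_pos c_pos Fs(2)])

lemma HT_emb: "i < n \<Longrightarrow> k \<in> carrier_vec d \<Longrightarrow>
    transpose_mat (diag_block_mat Hs) *\<^sub>v emb d n i k = emb c n i (transpose_mat (Hs ! i) *\<^sub>v k)"
  by (rule diag_block_mat_transpose_emb[OF Hs(1) d_pos c_pos Hs(2)])

text \<open>A block-diagonal prior is updated blockwise: inserting the embedded block weight into the full problem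
  gives one inequality, and projecting the full weight to the block gives the other, because
  dropping the other blocks decreases both forms. The optimal weights then agree as well, since the
  minimiser is unique.\<close>

lemma block_update:
  assumes i: "i < n" and P: "sym_psd (n * c) P" "block_proj c P = P" and x: "x \<in> carrier_vec c"
  shows "qform (meas_update (Hs ! i) (Rs ! i) (nth_diag_block c i P)) x
    = qform (meas_update (diag_block_mat Hs) (diag_block_mat Rs) P) (emb c n i x)"
    and "emb d n i (minv (Hs ! i * nth_diag_block c i P * transpose_mat (Hs ! i) + Rs ! i)
            *\<^sub>v (Hs ! i *\<^sub>v (nth_diag_block c i P *\<^sub>v x)))
        = opt_gain P (emb c n i x)"
proof -
  interpret blk: riccati c d "Hs ! i" "Rs ! i" 0 "Fs ! i" by (rule block_filter[OF i])
  let ?P = "nth_diag_block c i P" and ?x = "emb c n i x"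
  note P' = sym_psdD[OF P(1)] and Pi = nth_diag_block_psd[OF P(1) i c_pos]
  note xc = emb_carrier[of c n i x]
  have val: "qform P (?x - transpose_mat (diag_block_mat Hs) *\<^sub>v emb d n i k) + qform (diag_block_mat Rs) (emb d n i k)
     = qform ?P (x - transpose_mat (Hs ! i) *\<^sub>v k) + qform (Rs ! i) k" if k: "k \<in> carrier_vec d" for k
  proof -
    have z: "x - transpose_mat (Hs ! i) *\<^sub>v k \<in> carrier_vec c" using x blk.HT_vec[OF k] by simp
    show ?thesis
      using qform_nth_diag_block[OF P'(1) z i c_pos] qform_nth_diag_block[OF spdD(1)[OF R] k i d_pos] R_nth[OF i]
        HT_emb[OF i k] emb_minus[OF x blk.HT_vec[OF k] c_pos] by simp
  qed
  let ?ki = "blk.opt_gain ?P x" and ?k = "opt_gain P ?x"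
  note ki = blk.opt_gain_carrier[OF Pi x] and k = opt_gain_carrier[OF P(1) xc]
  note eki = emb_carrier[of d n i ?ki]
  have le: "qform (meas_update (diag_block_mat Hs) (diag_block_mat Rs) P) ?x
      \<le> qform (meas_update (Hs ! i) (Rs ! i) ?P) x"
    using meas_update_le[OF P(1) xc eki] val[OF ki] blk.meas_update_attained[OF Pi x] by simp
  have ge: "qform (meas_update (Hs ! i) (Rs ! i) ?P) x
      \<le> qform (meas_update (diag_block_mat Hs) (diag_block_mat Rs) P) ?x"
  proof -
    let ?z = "?x - transpose_mat (diag_block_mat Hs) *\<^sub>v ?k"
    have z: "?z \<in> carrier_vec (n * c)" using xc HT_vec[OF k] by simp
    have bz: "bpart c i ?z = ?x - transpose_mat (diag_block_mat Hs) *\<^sub>v bpart d i ?k"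
      using bpart_minus[OF xc HT_vec[OF k]] HT_bpart[OF k] by (simp add: bpart_emb)
    have "qform (meas_update (Hs ! i) (Rs ! i) ?P) x
        \<le> qform ?P (x - transpose_mat (Hs ! i) *\<^sub>v prj d i ?k) + qform (Rs ! i) (prj d i ?k)"
      by (rule blk.meas_update_le[OF Pi x prj_carrier])
    also have "\<dots> = qform P (bpart c i ?z) + qform (diag_block_mat Rs) (bpart d i ?k)"
      unfolding bz bpart_eq_emb_prj[OF k d_pos] by (rule val[OF prj_carrier, symmetric])
    also have "\<dots> \<le> qform P ?z + qform (diag_block_mat Rs) ?k"
      by (intro add_mono qform_bpart_le[OF P z] qform_bpart_le[OF spd_imp_psd[OF R] _ k]
          block_struct_block_proj[OF spdD(1)[OF R] R_block])
    also have "\<dots> = qform (meas_update (diag_block_mat Hs) (diag_block_mat Rs) P) ?x"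
      by (rule meas_update_attained[OF P(1) xc, symmetric])
    finally show ?thesis .
  qed
  show eq: "qform (meas_update (Hs ! i) (Rs ! i) ?P) x
    = qform (meas_update (diag_block_mat Hs) (diag_block_mat Rs) P) ?x" using le ge by simp
  show "emb d n i ?ki = ?k"
    by (rule opt_gain_unique[OF P(1) xc eki])
      (use val[OF ki] blk.meas_update_attained[OF Pi x] eq in simp)
qed

lemma nth_meas_update:
  assumes i: "i < n" and P: "sym_psd (n * c) P" "block_proj c P = P"
  shows "nth_diag_block c i (meas_update (diag_block_mat Hs) (diag_block_mat Rs) P)
    = meas_update (Hs ! i) (Rs ! i) (nth_diag_block c i P)"
proof (rule qform_determines[of _ c])
  interpret blk: riccati c d "Hs ! i" "Rs ! i" 0 "Fs ! i" by (rule block_filter[OF i])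
  note U = sym_psdD[OF meas_update_psd[OF P(1)]]
  note Ui = sym_psdD[OF blk.meas_update_psd[OF nth_diag_block_psd[OF P(1) i c_pos]]]
  show "meas_update (Hs ! i) (Rs ! i) (nth_diag_block c i P) \<in> carrier_mat c c"
    "transpose_mat (meas_update (Hs ! i) (Rs ! i) (nth_diag_block c i P)) = meas_update (Hs ! i) (Rs ! i) (nth_diag_block c i P)"
    using Ui by auto
  show "transpose_mat (nth_diag_block c i (meas_update (diag_block_mat Hs) (diag_block_mat Rs) P))
    = nth_diag_block c i (meas_update (diag_block_mat Hs) (diag_block_mat Rs) P)"
    by (rule nth_diag_block_symmetric[OF U(1,2) i])
  show "qform (nth_diag_block c i (meas_update (diag_block_mat Hs) (diag_block_mat Rs) P)) x
    = qform (meas_update (Hs ! i) (Rs ! i) (nth_diag_block c i P)) x" if "x \<in> carrier_vec c" for x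
    using qform_nth_diag_block[OF U(1) that i c_pos] block_update(1)[OF i P that] by simp
qed (rule nth_diag_block_carrier)

lemma nth_congruence_add:
  assumes i: "i < n" and P: "sym_psd (n * c) P" and Q: "sym_psd (n * c) Q"
  shows "nth_diag_block c i (diag_block_mat Fs * P * transpose_mat (diag_block_mat Fs) + Q)
    = Fs ! i * nth_diag_block c i P * transpose_mat (Fs ! i) + nth_diag_block c i Q"
proof (rule qform_determines[of _ c])
  let ?F = "diag_block_mat Fs"
  note FP = sym_psd_congruence[OF F P]
  note FP' = sym_psdD[OF FP] and Q' = sym_psdD[OF Q] and P' = sym_psdD[OF P]
  have Fi: "Fs ! i \<in> carrier_mat c c" using Fs i by auto
  note Pi = nth_diag_block_psd[OF P i c_pos] and Qi = nth_diag_block_psd[OF Q i c_pos]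
  note Qi' = sym_psdD[OF Qi] and FPi = sym_psdD[OF sym_psd_congruence[OF Fi Pi]]
  have S: "?F * P * transpose_mat ?F + Q \<in> carrier_mat (n * c) (n * c)" using FP' Q' by auto
  show "nth_diag_block c i (?F * P * transpose_mat ?F + Q) \<in> carrier_mat c c" by (rule nth_diag_block_carrier)
  show "transpose_mat (nth_diag_block c i (?F * P * transpose_mat ?F + Q)) = nth_diag_block c i (?F * P * transpose_mat ?F + Q)"
    using nth_diag_block_symmetric[OF S _ i] transpose_add[OF FP'(1) Q'(1)] FP'(2) Q'(2) by simp
  show "Fs ! i * nth_diag_block c i P * transpose_mat (Fs ! i) + nth_diag_block c i Q \<in> carrier_mat c c"
    using FPi Qi' by auto
  show "transpose_mat (Fs ! i * nth_diag_block c i P * transpose_mat (Fs ! i) + nth_diag_block c i Q)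
    = Fs ! i * nth_diag_block c i P * transpose_mat (Fs ! i) + nth_diag_block c i Q"
    using transpose_add[OF FPi(1) Qi'(1)] FPi(2) Qi'(2) by simp
  fix x :: "real vec" assume x: "x \<in> carrier_vec c"
  have Fx: "transpose_mat (Fs ! i) *\<^sub>v x \<in> carrier_vec c" using Fi x by simp
  note xc = emb_carrier[of c n i x]
  show "qform (nth_diag_block c i (?F * P * transpose_mat ?F + Q)) x
     = qform (Fs ! i * nth_diag_block c i P * transpose_mat (Fs ! i) + nth_diag_block c i Q) x"
    unfolding qform_nth_diag_block[OF S x i c_pos] qform_add[OF FP'(1) Q'(1) xc] qform_congruence[OF F P'(1) xc]
      FT_emb[OF i x] qform_add[OF FPi(1) Qi'(1) x] qform_congruence[OF Fi sym_psdD(1)[OF Pi] x]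
      qform_nth_diag_block[OF P'(1) Fx i c_pos] qform_nth_diag_block[OF Q'(1) x i c_pos] ..
qed

abbreviation P_V where "P_V \<equiv> kf_pred (diag_block_mat Fs) (diag_block_mat Hs) (diag_block_mat Rs) (diag_block_mat Vs)"

text \<open>The diagonal blocks of the full filter for \<open>V\<close> are the filters of the separate blocks. In
  particular they depend on the data of their block only.\<close>

lemma nth_kf_solution:
  assumes i: "i < n"
  shows "spd c (nth_diag_block c i P_V)"
    "nth_diag_block c i P_V = Fs ! i * meas_update (Hs ! i) (Rs ! i) (nth_diag_block c i P_V) * transpose_mat (Fs ! i) + Vs ! i"
    "nth_diag_block c i (kf_upd (diag_block_mat Fs) (diag_block_mat Hs) (diag_block_mat Rs) (diag_block_mat Vs))
      = meas_update (Hs ! i) (Rs ! i) (nth_diag_block c i P_V)"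
    "nth_diag_block c i P_V = kf_pred (Fs ! i) (Hs ! i) (Rs ! i) (Vs ! i)"
proof -
  interpret blk: riccati c d "Hs ! i" "Rs ! i" 0 "Fs ! i" by (rule block_filter[OF i])
  note D = full.riccati_solutionD[OF kf_pred_is_solution[OF V_spd] spdD(1)[OF V_spd]]
  note bd = kf_pred_block_diag(1)[OF V_spd V_block_diag]
  show s: "spd c (nth_diag_block c i P_V)" by (rule nth_diag_block_spd[OF D(1) i c_pos])
  show u: "nth_diag_block c i (kf_upd (diag_block_mat Fs) (diag_block_mat Hs) (diag_block_mat Rs) (diag_block_mat Vs))
      = meas_update (Hs ! i) (Rs ! i) (nth_diag_block c i P_V)"
    unfolding kf_upd_def by (rule nth_meas_update[OF i D(2) bd])
  have "P_V = diag_block_mat Fs * meas_update (diag_block_mat Hs) (diag_block_mat Rs) P_V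
      * transpose_mat (diag_block_mat Fs) + diag_block_mat Vs"
    using D(3) by (simp add: full.step_def block_proj_0)
  thus e: "nth_diag_block c i P_V = Fs ! i * meas_update (Hs ! i) (Rs ! i) (nth_diag_block c i P_V) * transpose_mat (Fs ! i) + Vs ! i"
    using nth_congruence_add[OF i meas_update_psd[OF D(2)] spd_imp_psd[OF V_spd]] V_nth[OF i]
      u[unfolded kf_upd_def] by metis
  have "blk.riccati_solution (Vs ! i) (nth_diag_block c i P_V)"
    using s e by (simp add: blk.riccati_solution_def blk.step_def block_proj_0)
  thus "nth_diag_block c i P_V = kf_pred (Fs ! i) (Hs ! i) (Rs ! i) (Vs ! i)"
    unfolding kf_pred_eq_bd by (rule blk.bd_pred_solution[OF V_nth_spd[OF i], symmetric])
qed

end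

locale common_noise_lists = block_lists +
  fixes r :: nat and Gs :: "real mat list" and U :: "real mat"
  assumes noise: "common_noise c n r Gs U"
begin

lemma Gs: "set Gs \<subseteq> carrier_mat c r" "length Gs = n"
  using noise by (auto simp: common_noise_def)

sublocale common_noise_filter "n * c" "n * d" "diag_block_mat Hs" "diag_block_mat Rs" c "diag_block_mat Fs" d n
  "diag_block_mat Vs" "vstack r Gs" U r
proof
  show "vstack r Gs \<in> carrier_mat (n * c) r" using vstack_blocks[OF Gs(1) c_pos] Gs(2) by simp
  show "spd r U" using noise by (auto simp: common_noise_def spd_def)
qed (fact V_spd V_block_diag)+

text \<open>On vectors of block \<open>i\<close> the upper bound for the update contains only \<open>G\<^sub>i C G\<^sub>i\<^sup>T\<close>, evaluated at
  the vector left after subtracting the measurement. This is at most \<open>s\<close> times \<open>V\<^sub>i\<close> there, hence at most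
  \<open>s\<close> times \<open>B\<^sub>i\<close>, and that in turn is part of the updated form of \<open>B\<^sub>i\<close>.\<close>

lemma block_sandwich:
  assumes i: "i < n" and l: "0 < l" "\<And>x. x \<in> carrier_vec c \<Longrightarrow> l * (x \<bullet> x) \<le> qform (Vs ! i) x"
    and s: "s = frob_norm (Gs ! i * C * transpose_mat (Gs ! i)) / l" and x: "x \<in> carrier_vec c"
  shows "qform (meas_update (Hs ! i) (Rs ! i) (Fs ! i * nth_diag_block c i X * transpose_mat (Fs ! i) + Vs ! i)) x
      \<le> qform (nth_diag_block c i X) x"
    "qform (nth_diag_block c i X) x
      \<le> (1 + s) * qform (meas_update (Hs ! i) (Rs ! i) (Fs ! i * nth_diag_block c i X * transpose_mat (Fs ! i) + Vs ! i)) x"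
proof -
  interpret blk: riccati c d "Hs ! i" "Rs ! i" 0 "Fs ! i" by (rule block_filter[OF i])
  let ?e = "emb c n i x" and ?Bi = "nth_diag_block c i B"
  let ?\<Phi> = "meas_update (diag_block_mat Hs) (diag_block_mat Rs)"
  note ec = emb_carrier[of c n i x]
  have Bi: "?Bi = Fs ! i * nth_diag_block c i X * transpose_mat (Fs ! i) + Vs ! i"
    using nth_congruence_add[OF i X_psd spd_imp_psd[OF V_spd]] V_nth[OF i] by simp
  have X: "qform (nth_diag_block c i X) x = qform (?\<Phi> Pt) ?e"
    unfolding qform_nth_diag_block[OF sym_psdD(1)[OF X_psd] x i c_pos]
    unfolding X_eq by (rule qform_block_proj_emb[OF meas_update_carrier[OF Pt_sol(2)] i])
  note bu = block_update[OF i B_psd B_block x]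
  show "qform (meas_update (Hs ! i) (Rs ! i) (Fs ! i * nth_diag_block c i X * transpose_mat (Fs ! i) + Vs ! i)) x
      \<le> qform (nth_diag_block c i X) x"
    unfolding Bi[symmetric] X bu(1) by (rule update_lower[OF ec])
  have VB: "qform (Vs ! i) z \<le> qform ?Bi z" if z: "z \<in> carrier_vec c" for z
  proof -
    note FX = sym_psd_congruence[OF blk.F nth_diag_block_psd[OF X_psd i c_pos]]
    show ?thesis unfolding Bi
      using qform_add[OF sym_psdD(1)[OF FX] spdD(1)[OF V_nth_spd[OF i]] z] sym_psdD(3)[OF FX z] by simp
  qed
  note Bp = nth_diag_block_psd[OF B_psd i c_pos]
  let ?k = "blk.opt_gain ?Bi x" let ?y = "x - transpose_mat (Hs ! i) *\<^sub>v ?k"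
  note k = blk.opt_gain_carrier[OF Bp x]
  have y: "?y \<in> carrier_vec c" using x blk.HT_vec[OF k] by simp
  have Gi: "Gs ! i \<in> carrier_mat c r" using Gs i by auto
  note C' = spdD(1)[OF C_spd]
  have GCG: "Gs ! i * C * transpose_mat (Gs ! i) \<in> carrier_mat c c" using Gi C' by auto
  have "?e - transpose_mat (diag_block_mat Hs) *\<^sub>v opt_gain B ?e = emb c n i ?y"
    unfolding bu(2)[symmetric] HT_emb[OF i k] by (rule emb_minus[OF x blk.HT_vec[OF k] c_pos, symmetric])
  hence "qform (?\<Phi> Pt) ?e \<le> qform (?\<Phi> B) ?e + qform C (transpose_mat (Gs ! i) *\<^sub>v ?y)"
    using update_upper[OF ec] vstack_transpose_emb[OF Gs(1) c_pos Gs(2) i y] by simp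
  also have "qform C (transpose_mat (Gs ! i) *\<^sub>v ?y) = qform (Gs ! i * C * transpose_mat (Gs ! i)) ?y"
    by (rule qform_congruence[OF Gi C' y, symmetric])
  also have "\<dots> \<le> frob_norm (Gs ! i * C * transpose_mat (Gs ! i)) * (?y \<bullet> ?y)"
    by (rule qform_le_frob_norm[OF GCG y])
  also have "\<dots> = s * (l * (?y \<bullet> ?y))" using l(1) s by simp
  also have "\<dots> \<le> s * qform (?\<Phi> B) ?e"
  proof (rule mult_left_mono)
    show "0 \<le> s" using s l(1) frob_norm_nonneg by simp
    have "l * (?y \<bullet> ?y) \<le> qform (Vs ! i) ?y" by (rule l(2)[OF y])
    also have "\<dots> \<le> qform ?Bi ?y" by (rule VB[OF y])
    also have "\<dots> \<le> qform ?Bi ?y + qform (Rs ! i) ?k"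
      using sym_psdD(3)[OF spd_imp_psd[OF blk.R] k] by simp
    also have "\<dots> = qform (?\<Phi> B) ?e"
      unfolding bu(1)[symmetric] by (rule blk.meas_update_attained[OF Bp x, symmetric])
    finally show "l * (?y \<bullet> ?y) \<le> qform (?\<Phi> B) ?e" .
  qed
  finally show "qform (nth_diag_block c i X) x
      \<le> (1 + s) * qform (meas_update (Hs ! i) (Rs ! i) (Fs ! i * nth_diag_block c i X * transpose_mat (Fs ! i) + Vs ! i)) x"
    unfolding Bi[symmetric] X bu(1) by (simp add: distrib_right)
qed

end

section \<open>The error bounds\<close>

context block_lists
begin

lemma block_constants:
  assumes i: "i < n"
  obtains l \<delta> M where "0 < l" "0 < \<delta>" "0 < M"
    "\<And>x. x \<in> carrier_vec c \<Longrightarrow> l * (x \<bullet> x) \<le> qform (Vs ! i) x"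
    "\<And>s X. 0 \<le> s \<Longrightarrow> s \<le> \<delta> \<Longrightarrow> sym_psd c X \<Longrightarrow>
       (\<And>x. x \<in> carrier_vec c \<Longrightarrow>
         qform (meas_update (Hs ! i) (Rs ! i) (Fs ! i * X * transpose_mat (Fs ! i) + Vs ! i)) x \<le> qform X x \<and>
         qform X x \<le> (1 + s) * qform (meas_update (Hs ! i) (Rs ! i) (Fs ! i * X * transpose_mat (Fs ! i) + Vs ! i)) x) \<Longrightarrow>
       frob_norm (meas_update (Hs ! i) (Rs ! i) (kf_pred (Fs ! i) (Hs ! i) (Rs ! i) (Vs ! i)) - X) \<le> M * s"
proof -
  interpret blk: riccati c d "Hs ! i" "Rs ! i" 0 "Fs ! i" by (rule block_filter[OF i])
  note kf = nth_kf_solution[OF i]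
  have sol: "blk.riccati_solution (Vs ! i) (kf_pred (Fs ! i) (Hs ! i) (Rs ! i) (Vs ! i))"
    using kf(1,2) kf(4)[symmetric] by (simp add: blk.riccati_solution_def blk.step_def block_proj_0)
  obtain l where l: "0 < l" "\<And>x. x \<in> carrier_vec c \<Longrightarrow> l * (x \<bullet> x) \<le> qform (Vs ! i) x"
    using spd_coercive[OF V_nth_spd[OF i]] by blast
  show thesis
  proof (rule blk.update_sandwich[OF refl V_nth_spd[OF i] sol], goal_cases)
    case (1 \<delta> M)
    show ?case by (rule that[OF l(1) 1(1,2) l(2) 1(3)])
  qed
qed

end

text \<open>The constants come from the filter of block \<open>i\<close> alone. They are taken from one arbitrary system
  that contains the block; if there is none, the claim is void.\<close>

theorem block_error:
  fixes c d :: nat and Fi Hi Vi Ri :: "real mat"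
  shows "\<exists>\<delta>>0. \<exists>M>0. \<forall>n r Fs Hs Vs Rs Gs U i.
    block_system c d n Fs Hs Vs Rs \<longrightarrow> common_noise c n r Gs U \<longrightarrow>
    i < n \<longrightarrow> Fs ! i = Fi \<longrightarrow> Hs ! i = Hi \<longrightarrow> Vs ! i = Vi \<longrightarrow> Rs ! i = Ri \<longrightarrow>
    (let F = diag_block_mat Fs; H = diag_block_mat Hs;
         V = diag_block_mat Vs; R = diag_block_mat Rs; G = vstack r Gs;
         \<epsilon> = frob_norm (Gs ! i * C_mat c F H V R G U * transpose_mat (Gs ! i));
         \<Delta> = nth_diag_block c i (kf_upd F H R V)
              - nth_diag_block c i (bd_upd c F H R (V + G * U * transpose_mat G))
     in \<epsilon> \<le> \<delta> \<longrightarrow> frob_norm \<Delta> \<le> M * \<epsilon>)"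
proof (cases "\<exists>n Fs Hs Vs Rs i. block_system c d n Fs Hs Vs Rs \<and>
    i < n \<and> Fs ! i = Fi \<and> Hs ! i = Hi \<and> Vs ! i = Vi \<and> Rs ! i = Ri")
  case False
  thus ?thesis by (intro exI[of _ "1::real"] conjI) auto
next
  case True
  then obtain n0 Fs0 Hs0 Vs0 Rs0 i0 where sys0: "block_system c d n0 Fs0 Hs0 Vs0 Rs0" and i0: "i0 < n0"
    and eq0: "Fs0 ! i0 = Fi" "Hs0 ! i0 = Hi" "Vs0 ! i0 = Vi" "Rs0 ! i0 = Ri" by blast
  interpret ref: block_lists c d n0 Fs0 Hs0 Vs0 Rs0 by unfold_locales (rule sys0)
  obtain l \<delta> M where pos: "0 < l" "0 < \<delta>" "0 < M"
    and l: "\<And>x. x \<in> carrier_vec c \<Longrightarrow> l * (x \<bullet> x) \<le> qform Vi x"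
    and bound: "\<And>s X. 0 \<le> s \<Longrightarrow> s \<le> \<delta> \<Longrightarrow> sym_psd c X \<Longrightarrow>
       (\<And>x. x \<in> carrier_vec c \<Longrightarrow>
         qform (meas_update Hi Ri (Fi * X * transpose_mat Fi + Vi)) x \<le> qform X x \<and>
         qform X x \<le> (1 + s) * qform (meas_update Hi Ri (Fi * X * transpose_mat Fi + Vi)) x) \<Longrightarrow>
       frob_norm (meas_update Hi Ri (kf_pred Fi Hi Ri Vi) - X) \<le> M * s"
    using ref.block_constants[OF i0, unfolded eq0] by blast
  have pos': "0 < l * \<delta>" "0 < M / l" using pos by auto
  show ?thesis
  proof (rule exI[of _ "l * \<delta>"], rule conjI[OF pos'(1)], rule exI[of _ "M / l"],
      rule conjI[OF pos'(2)], intro allI impI)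
    fix n r Fs Hs Vs Rs Gs U i
    assume sys: "block_system c d n Fs Hs Vs Rs" and noise: "common_noise c n r Gs U" and i: "i < n"
      and eq: "Fs ! i = Fi" "Hs ! i = Hi" "Vs ! i = Vi" "Rs ! i = Ri"
    interpret nl: common_noise_lists c d n Fs Hs Vs Rs r Gs U by unfold_locales (rule sys, rule noise)
    define \<epsilon> where "\<epsilon> = frob_norm (Gs ! i * nl.C * transpose_mat (Gs ! i))"
    have small: "frob_norm (meas_update Hi Ri (kf_pred Fi Hi Ri Vi) - nth_diag_block c i nl.X) \<le> M / l * \<epsilon>"
      if e: "\<epsilon> \<le> l * \<delta>"
    proof -
      have "0 \<le> \<epsilon> / l" "\<epsilon> / l \<le> \<delta>"
        using e pos frob_norm_nonneg by (auto simp: \<epsilon>_def field_simps)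
      from bound[OF this nth_diag_block_psd[OF nl.X_psd i nl.c_pos]]
      show ?thesis
        using nl.block_sandwich[OF i pos(1) _ refl, unfolded eq, folded \<epsilon>_def] l by simp
    qed
    have upd: "nth_diag_block c i (kf_upd (diag_block_mat Fs) (diag_block_mat Hs) (diag_block_mat Rs) (diag_block_mat Vs))
        = meas_update Hi Ri (kf_pred Fi Hi Ri Vi)"
      using nl.nth_kf_solution(3,4)[OF i] eq by simp
    show "let F = diag_block_mat Fs; H = diag_block_mat Hs;
         V = diag_block_mat Vs; R = diag_block_mat Rs; G = vstack r Gs;
         \<epsilon> = frob_norm (Gs ! i * C_mat c F H V R G U * transpose_mat (Gs ! i));
         \<Delta> = nth_diag_block c i (kf_upd F H R V)
              - nth_diag_block c i (bd_upd c F H R (V + G * U * transpose_mat G))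
     in \<epsilon> \<le> l * \<delta> \<longrightarrow> frob_norm \<Delta> \<le> M / l * \<epsilon>"
      using small unfolding Let_def upd \<epsilon>_def by blast
  qed
qed

theorem prediction_error:
  assumes sys: "block_system c d n Fs Hs Vs Rs"
  shows "let F = diag_block_mat Fs; H = diag_block_mat Hs;
             V = diag_block_mat Vs; R = diag_block_mat Rs
         in \<exists>\<delta>>0. \<exists>M>0.
              \<forall>(r::nat) (Gs::real mat list) (U::real mat).
                common_noise c n r Gs U \<longrightarrow>
                (let G = vstack r Gs; W = G * U * transpose_mat G; \<eta> = frob_norm W
                 in \<eta> \<le> \<delta> \<longrightarrow>
                      frob_norm (kf_pred F H R (V + W) - kf_pred F H R V) \<le> M * \<eta> \<and>
                      frob_norm (kf_cl F H R (V + W) - kf_cl F H R V) \<le> M * \<eta> \<and>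
                      frob_norm (bd_pred c F H R (V + W) - kf_pred F H R V) \<le> M * \<eta> \<and>
                      frob_norm (bd_cl c F H R (V + W) - kf_cl F H R V) \<le> M * \<eta>)"
proof -
  interpret bl: block_lists c d n Fs Hs Vs Rs by unfold_locales (rule sys)
  let ?F = "diag_block_mat Fs" and ?H = "diag_block_mat Hs" and ?V = "diag_block_mat Vs" and ?R = "diag_block_mat Rs"
  interpret single: block_riccati "n * c" "n * d" ?H ?R 0 ?F 0 1 by (rule bl.as_single_block)
  obtain \<delta>1 M1 where 1: "0 < \<delta>1" "0 < M1" "\<And>W. sym_psd (n * c) W \<Longrightarrow> frob_norm W \<le> \<delta>1 \<Longrightarrow>
     frob_norm (bd_pred c ?F ?H ?R (?V + W) - bd_pred c ?F ?H ?R ?V) \<le> M1 * frob_norm W \<and>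
     frob_norm (bd_cl c ?F ?H ?R (?V + W) - bd_cl c ?F ?H ?R ?V) \<le> M1 * frob_norm W"
    using bl.bd_pred_perturbation[OF bl.V_spd] by blast
  obtain \<delta>2 M2 where 2: "0 < \<delta>2" "0 < M2" "\<And>W. sym_psd (n * c) W \<Longrightarrow> frob_norm W \<le> \<delta>2 \<Longrightarrow>
     frob_norm (bd_pred 0 ?F ?H ?R (?V + W) - bd_pred 0 ?F ?H ?R ?V) \<le> M2 * frob_norm W \<and>
     frob_norm (bd_cl 0 ?F ?H ?R (?V + W) - bd_cl 0 ?F ?H ?R ?V) \<le> M2 * frob_norm W"
    using single.bd_pred_perturbation[OF bl.V_spd] by blast
  have bd: "bd_pred c ?F ?H ?R ?V = kf_pred ?F ?H ?R ?V"
    by (rule bl.kf_pred_block_diag(2)[OF bl.V_spd bl.V_block_diag])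
  hence cl: "bd_cl c ?F ?H ?R ?V = kf_cl ?F ?H ?R ?V" by (simp add: bd_cl_def kf_cl_def)
  have cl0: "bd_cl 0 ?F ?H ?R Q = kf_cl ?F ?H ?R Q" for Q by (simp add: bd_cl_def kf_cl_def kf_pred_eq_bd)
  have "frob_norm (kf_pred ?F ?H ?R (?V + W) - kf_pred ?F ?H ?R ?V) \<le> max M1 M2 * frob_norm W \<and>
        frob_norm (kf_cl ?F ?H ?R (?V + W) - kf_cl ?F ?H ?R ?V) \<le> max M1 M2 * frob_norm W \<and>
        frob_norm (bd_pred c ?F ?H ?R (?V + W) - kf_pred ?F ?H ?R ?V) \<le> max M1 M2 * frob_norm W \<and>
        frob_norm (bd_cl c ?F ?H ?R (?V + W) - kf_cl ?F ?H ?R ?V) \<le> max M1 M2 * frob_norm W"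
    if W: "sym_psd (n * c) W" and small: "frob_norm W \<le> min \<delta>1 \<delta>2" for W
  proof -
    have "M1 * frob_norm W \<le> max M1 M2 * frob_norm W" "M2 * frob_norm W \<le> max M1 M2 * frob_norm W"
      using frob_norm_nonneg by (auto intro: mult_right_mono)
    thus ?thesis using 1(3)[OF W] 2(3)[OF W] small unfolding bd cl cl0 kf_pred_eq_bd[symmetric] by auto
  qed
  moreover have "sym_psd (n * c) (vstack r Gs * U * transpose_mat (vstack r Gs))"
    if "common_noise c n r Gs U" for r Gs U
  proof -
    interpret nl: common_noise_lists c d n Fs Hs Vs Rs r Gs U by unfold_locales (rule that)
    show ?thesis by (rule nl.W_psd)
  qed
  moreover have "0 < min \<delta>1 \<delta>2" "0 < max M1 M2" using 1(1,2) 2(1,2) by auto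
  ultimately show ?thesis unfolding Let_def by blast
qed

theorem proposition2p2:
  shows
    "(\<forall>(c::nat) (d::nat) (Fi::real mat) (Hi::real mat) (Vi::real mat) (Ri::real mat).
        \<exists>\<delta>>0. \<exists>M>0.
          \<forall>(n::nat) (r::nat) (Fs::real mat list) (Hs::real mat list) (Vs::real mat list)
            (Rs::real mat list) (Gs::real mat list) (U::real mat) (i::nat).
            block_system c d n Fs Hs Vs Rs \<longrightarrow> common_noise c n r Gs U \<longrightarrow>
            i < n \<longrightarrow> Fs ! i = Fi \<longrightarrow> Hs ! i = Hi \<longrightarrow> Vs ! i = Vi \<longrightarrow> Rs ! i = Ri \<longrightarrow>
            (let F = diag_block_mat Fs; H = diag_block_mat Hs;
                 V = diag_block_mat Vs; R = diag_block_mat Rs; G = vstack r Gs;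
                 \<epsilon> = frob_norm (Gs ! i * C_mat c F H V R G U * transpose_mat (Gs ! i));
                 \<Delta> = nth_diag_block c i (kf_upd F H R V)
                      - nth_diag_block c i (bd_upd c F H R (V + G * U * transpose_mat G))
             in \<epsilon> \<le> \<delta> \<longrightarrow> frob_norm \<Delta> \<le> M * \<epsilon>))
     \<and>
     (\<forall>(c::nat) (d::nat) (n::nat) (Fs::real mat list) (Hs::real mat list) (Vs::real mat list)
        (Rs::real mat list).
        block_system c d n Fs Hs Vs Rs \<longrightarrow>
        (let F = diag_block_mat Fs; H = diag_block_mat Hs;
             V = diag_block_mat Vs; R = diag_block_mat Rs
         in \<exists>\<delta>>0. \<exists>M>0.
              \<forall>(r::nat) (Gs::real mat list) (U::real mat).
                common_noise c n r Gs U \<longrightarrow>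
                (let G = vstack r Gs; W = G * U * transpose_mat G; \<eta> = frob_norm W
                 in \<eta> \<le> \<delta> \<longrightarrow>
                      frob_norm (kf_pred F H R (V + W) - kf_pred F H R V) \<le> M * \<eta> \<and>
                      frob_norm (kf_cl F H R (V + W) - kf_cl F H R V) \<le> M * \<eta> \<and>
                      frob_norm (bd_pred c F H R (V + W) - kf_pred F H R V) \<le> M * \<eta> \<and>
                      frob_norm (bd_cl c F H R (V + W) - kf_cl F H R V) \<le> M * \<eta>)))"
  using block_error prediction_error by (intro conjI allI impI)

end
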